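(* Let $K$ be a field of characteristic zero. Let $2\leq d:=d_1=d_2=d_3$ be an integer. Let $f_1,f_2,f_3\in S=K[x_1,x_2,x_3]$ be a regular sequence of homogeneous polynomials of degree $d$, let $I=(f_1,f_2,f_3)$ and let $J=\operatorname{Gin}(I)$ be the generic initial ideal with respect to the reverse lexicographic order. Suppose $S/I$ has the strong Lefschetz property. If $d$ is odd, then $J$ is the ideal generated by - $x_1^{d-2}\{x_1,x_2\}^2$; $x_1^{d-2j-1}x_2^{3j+1}$ and $x_1^{d-2j-2}x_2^{3j+2}$ for $1\leq j\leq\frac{d-3}{2}$; $x_2^{\frac{3d-1}{2}}$; $x_3x_2^{\frac{3d-3}{2}}$; - $x_3^{2j+1}x_1^{2j}x_2^{\frac{3d-3}{2}-3j},\ldots,x_3^{2j+1}x_2^{\frac{3d-3}{2}-j}$ for $1\leq j\leq\frac{d-3}{2}$; - $x_3^{d-2+2j}\{x_1,x_2\}^{d-j}$ for $1\leq j\leq d$. If $d$ is even, then $J$ is the ideal generated by - $x_1^{d-2}\{x_1,x_2\}^2$; $x_1^{d-2j-1}x_2^{3j+1}$ and $x_1^{d-2j-2}x_2^{3j+2}$ for $1\leq j\leq\frac{d-4}{2}$; $x_1x_2^{\frac{3d-4}{2}}$; $x_2^{\frac{3d-2}{2}}$; - $x_3^{2j}x_1^{2j-1}x_2^{\frac{3d}{2}-3j},\ldots,x_3^{2j}x_2^{\frac{3d-2}{2}-j}$ for $1\leq j\leq\frac{d-2}{2}$; - $x_3^{d-2+2j}\{x_1,x_2\}^{d-j}$ for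 $1\leq j\leq d$.
   Context: $\{x_1,x_2\}^j$ denotes the set of all monomials of degree $j$ in $x_1,x_2$ (with $\{x_1,x_2\}^0=\{1\}$), and $m\{x_1,x_2\}^j$ is the set of products of the monomial $m$ with elements of it. A list $x_3^{c}x_1^{a}x_2^{b},\ldots,x_3^{c}x_2^{a+b}$ means all monomials $x_3^{c}x_1^{a-i}x_2^{b+i}$ with $0\leq i\leq a$. $S/I$ has the strong Lefschetz property (SLP) if there is a linear form $\ell\in S$ such that for all integers $b\geq 1$ and $t\geq 0$ the multiplication map $\ell^b:(S/I)_t\to(S/I)_{t+b}$ is injective or surjective. $\operatorname{Gin}(I)$ is the common initial ideal, with respect to the graded reverse lexicographic order with $x_1>x_2>x_3$, of $\alpha I$ for all $\alpha$ in a nonempty Zariski open subset of $GL_3(K)$ acting by linear changes of coordinates. *)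

theory Defs
  imports "HOL-Analysis.Analysis" "HOL-Library.Poly_Mapping"
begin

section \<open>Polynomials in three variables\<close>

text \<open>
  Monomials are exponent vectors \<^typ>\<open>'x \<Rightarrow>\<^sub>0 nat\<close>, and the polynomial ring is the convolution ring
  \<^typ>\<open>('x \<Rightarrow>\<^sub>0 nat) \<Rightarrow>\<^sub>0 'k\<close>. The variables $x_1, x_2, x_3$ are indexed by the elements
  \<open>1\<close>, \<open>2\<close>, \<open>3\<close> of the three-element type \<^typ>\<open>3\<close>, as for the components of \<^typ>\<open>real ^ 3\<close>.
  The order that the library puts on this type (in which \<open>3 = 0\<close> is the least element) is never used.
\<close>

type_synonym ('x, 'k) poly_ring = "('x \<Rightarrow>\<^sub>0 nat) \<Rightarrow>\<^sub>0 'k"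

type_synonym 'k poly3 = "(3, 'k) poly_ring"

definition Var :: "'x \<Rightarrow> ('x, 'k::comm_ring_1) poly_ring" where
  "Var i = Poly_Mapping.single (Poly_Mapping.single i 1) 1"

definition Const :: "'k \<Rightarrow> ('x, 'k::comm_ring_1) poly_ring" where
  "Const c = Poly_Mapping.single 0 c"

text \<open>Evaluation at the point \<open>a\<close> of a commutative ring, the coefficients being mapped by \<open>h\<close>.\<close>

definition poly_eval ::
    "('k \<Rightarrow> 'r) \<Rightarrow> ('x \<Rightarrow> 'r) \<Rightarrow> ('x, 'k::comm_ring_1) poly_ring \<Rightarrow> 'r::comm_ring_1" where
  "poly_eval h a p =
     (\<Sum>m\<in>Poly_Mapping.keys p.
        h (Poly_Mapping.lookup p m) * (\<Prod>i\<in>Poly_Mapping.keys m. a i ^ Poly_Mapping.lookup m i))"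

definition mdeg :: "('x \<Rightarrow>\<^sub>0 nat) \<Rightarrow> nat" where
  "mdeg m = (\<Sum>i\<in>Poly_Mapping.keys m. Poly_Mapping.lookup m i)"

text \<open>As usual, the zero polynomial is homogeneous of every degree.\<close>

definition homogeneous :: "nat \<Rightarrow> ('x, 'k::comm_ring_1) poly_ring \<Rightarrow> bool" where
  "homogeneous t f \<longleftrightarrow> (\<forall>m\<in>Poly_Mapping.keys f. mdeg m = t)"

section \<open>Ideals, quotients and regular sequences\<close>

text \<open>The ideal generated by a set is its span in the ring as a module over itself.\<close>

global_interpretation ring_module: module "(*) :: 'r \<Rightarrow> 'r \<Rightarrow> 'r::comm_ring_1"
  defines gen_ideal = ring_module.span
  by standard (simp_all add: algebra_simps)

definition regular_sequence :: "'r::comm_ring_1 list \<Rightarrow> bool" where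
  "regular_sequence fs \<longleftrightarrow>
     (\<forall>i<length fs. \<forall>g. fs ! i * g \<in> gen_ideal (set (take i fs)) \<longrightarrow> g \<in> gen_ideal (set (take i fs)))
     \<and> gen_ideal (set fs) \<noteq> UNIV"

definition ideal_cong :: "'r::comm_ring_1 set \<Rightarrow> ('r \<times> 'r) set" where
  "ideal_cong I = {(f, g). f - g \<in> I}"

text \<open>The component \<open>(S/I)\<^sub>t\<close>: the residue classes of the homogeneous polynomials of degree \<open>t\<close>.\<close>

definition quot_component ::
    "('x, 'k::comm_ring_1) poly_ring set \<Rightarrow> nat \<Rightarrow> ('x, 'k) poly_ring set set" where
  "quot_component I t = {f. homogeneous t f} // ideal_cong I"

text \<open>Multiplication by \<open>h\<close> on the residue classes of \<open>S/I\<close>.\<close>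

definition quot_mult :: "'r::comm_ring_1 set \<Rightarrow> 'r \<Rightarrow> 'r set \<Rightarrow> 'r set" where
  "quot_mult I h X = (\<Union>f\<in>X. ideal_cong I `` {h * f})"

definition strong_lefschetz :: "('x, 'k::comm_ring_1) poly_ring set \<Rightarrow> bool" where
  "strong_lefschetz I \<longleftrightarrow>
     (\<exists>l. homogeneous 1 l \<and>
        (\<forall>b\<ge>1. \<forall>t. inj_on (quot_mult I (l ^ b)) (quot_component I t)
                 \<or> quot_mult I (l ^ b) ` quot_component I t = quot_component I (t + b)))"

section \<open>Generic initial ideals\<close>

text \<open>
  \<open>revlex_less m n\<close>: \<open>m\<close> is smaller than \<open>n\<close> in the graded reverse lexicographic order with
  $x_1 > x_2 > x_3$. In equal degrees the smaller monomial is the one with the larger exponent at the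
  last variable where the two differ; this is never the first variable alone.
\<close>

definition revlex_less :: "(3 \<Rightarrow>\<^sub>0 nat) \<Rightarrow> (3 \<Rightarrow>\<^sub>0 nat) \<Rightarrow> bool" where
  "revlex_less m n \<longleftrightarrow>
     mdeg m < mdeg n \<or>
     mdeg m = mdeg n \<and>
       (Poly_Mapping.lookup m 3 > Poly_Mapping.lookup n 3 \<or>
        Poly_Mapping.lookup m 3 = Poly_Mapping.lookup n 3 \<and> Poly_Mapping.lookup m 2 > Poly_Mapping.lookup n 2)"

definition is_initial_monomial :: "'k::comm_ring_1 poly3 \<Rightarrow> (3 \<Rightarrow>\<^sub>0 nat) \<Rightarrow> bool" where
  "is_initial_monomial f m \<longleftrightarrow>
     m \<in> Poly_Mapping.keys f \<and> (\<forall>n\<in>Poly_Mapping.keys f. n \<noteq> m \<longrightarrow> revlex_less n m)"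

definition initial_ideal :: "'k::comm_ring_1 poly3 set \<Rightarrow> 'k poly3 set" where
  "initial_ideal I = gen_ideal {Poly_Mapping.single m 1 | m. \<exists>f\<in>I. is_initial_monomial f m}"

text \<open>The linear change of coordinates $x_j \mapsto \sum_i \alpha_{ij} x_i$.\<close>

definition coord_change :: "'k::comm_ring_1 ^ 3 ^ 3 \<Rightarrow> 'k poly3 \<Rightarrow> 'k poly3" where
  "coord_change \<alpha> = poly_eval Const (\<lambda>j. \<Sum>i\<in>UNIV. Const (\<alpha> $ i $ j) * Var i)"

text \<open>
  The Zariski topology on $GL_3(K)$ is the subspace topology from the affine space of matrices:
  open sets are the complements of common zero sets of polynomials in the nine matrix entries.
\<close>

definition zariski_open_GL3 :: "('k::field ^ 3 ^ 3) set \<Rightarrow> bool" where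
  "zariski_open_GL3 U \<longleftrightarrow>
     (\<exists>F :: (3 \<times> 3, 'k) poly_ring set.
        U = {\<alpha>. invertible \<alpha> \<and> (\<exists>p\<in>F. poly_eval id (\<lambda>(i, j). \<alpha> $ i $ j) p \<noteq> 0)})"

definition Gin :: "'k::field poly3 set \<Rightarrow> 'k poly3 set" where
  "Gin I = (THE J. \<exists>U. zariski_open_GL3 U \<and> U \<noteq> {} \<and>
                    (\<forall>\<alpha>\<in>U. initial_ideal (coord_change \<alpha> ` I) = J))"

section \<open>The lists of monomials\<close>

abbreviation x1 :: "'k::comm_ring_1 poly3" where "x1 \<equiv> Var 1"
abbreviation x2 :: "'k::comm_ring_1 poly3" where "x2 \<equiv> Var 2"
abbreviation x3 :: "'k::comm_ring_1 poly3" where "x3 \<equiv> Var 3"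

text \<open>\<open>x12_monomials m j\<close> is $m\{x_1,x_2\}^j$.\<close>

definition x12_monomials :: "'k::comm_ring_1 poly3 \<Rightarrow> nat \<Rightarrow> 'k poly3 set" where
  "x12_monomials m j = {m * (x1 ^ a * x2 ^ b) | a b. a + b = j}"

text \<open>\<open>monomial_list c a b\<close> is $x_3^c x_1^a x_2^b, \ldots, x_3^c x_2^{a+b}$.\<close>

definition monomial_list :: "nat \<Rightarrow> nat \<Rightarrow> nat \<Rightarrow> 'k::comm_ring_1 poly3 set" where
  "monomial_list c a b = {x3 ^ c * x1 ^ (a - i) * x2 ^ (b + i) | i. i \<le> a}"

end

theory Submission
  imports Defs "HOL-Computational_Algebra.Polynomial"
begin

text \<open>
  Write $h$ for the Hilbert function of $S/I$ and call $x_1^a x_2^b x_3^c$ standard if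
  $2(a+b)+c \le 3d-3$ and $3a+2b \le 3d-3$. There are $h(t)$ standard monomials of degree $t$, and
  the nonstandard ones generate the ideal in the statement. It suffices to find coordinates in which
  no nonzero element of $I$ is a combination of standard monomials of one degree: this is an open
  condition, and then every nonstandard monomial is congruent modulo $I$ to standard ones, which
  turn out to be smaller when $c = 0$ or $2(a+b)+c > 3d-3$; the remaining nonstandard monomials are
  multiples by a power of $x_3$ of the ones with $c = 0$.

  For such coordinates let $x_3$ be the Lefschetz element $\ell$. A combination of standard
  monomials in $I$ is $x_3^c g$ with $x_3 \nmid g$, and the Lefschetz property gives $g \in I$. Modulo
  $\ell$ the form $g$ is divisible by $x_2^v$, where $v$ is the dimension of the image of $I$ in
  degree $\deg g$. In characteristic zero a $v$-dimensional space of binary forms contains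
  no nonzero multiple of $m^v$ for a general linear form $m$, so a general choice of $x_2$ excludes this.
\<close>

text \<open>Both inequalities are read off from h, which depends on d alone: it is symmetric about
  (3d-3)/2 and increases up to the middle, its first difference in degree k being min(k+1, 3d-2-2k)
  there. Put k = a+b. The first inequality is c <= 3d-3-2k, a range in which h(k) <= h(k+c), so that
  multiplication by l^c out of degree k must be injective whichever alternative the Lefschetz
  property offers. The second one bounds a by the first difference, which is the dimension of
  (S/(I,l))_k; equivalently b >= v, where v is the codimension of that number in the
  (k+1)-dimensional space of binary forms of degree k.

  The obstacle is that Gin concerns general coordinates, while the Lefschetz property supplies a
  single form l. Hence one coordinate system is built, with l as x_3 and x_2 moving in a
  one-parameter family, and the condition is then spread to an open set. This works because a
  vanishing intersection is a linear independence condition on each I_t, with coefficients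
  polynomial in the matrix entries, and only degrees below 3d contain standard monomials.\<close>

text \<open>As a rewrite rule this undoes \<open>mult.assoc\<close> and makes \<open>algebra_simps\<close> loop.\<close>

declare ring_module.scale_scale [simp del]

section \<open>Finite-dimensional subspaces\<close>

context vector_space
begin

text \<open>The polynomial ring has infinite dimension, so here and below finiteness is carried by a
  finite set \<open>W\<close> whose span contains the spaces at hand. In the applications
  \<open>W\<close> consists of the monomials of one degree.\<close>

lemma basis_between:
  assumes "A \<subseteq> V" "V \<subseteq> span W" "finite W" "independent A"
  obtains B where "A \<subseteq> B" "B \<subseteq> V" "independent B" "V \<subseteq> span B" "finite B" "card B = dim V"
proof -
  obtain B where B: "A \<subseteq> B" "B \<subseteq> V" "independent B" "V \<subseteq> span B"
    using maximal_independent_subset_extend[OF assms(1,4)] by blast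
  have "finite B"
    using independent_span_bound[OF assms(3) B(3)] B(2) assms(2) by blast
  with B basis_card_eq_dim[OF B(2,4,3)] that show thesis by blast
qed

lemma finite_basis:
  assumes "V \<subseteq> span W" "finite W"
  obtains B where "B \<subseteq> V" "independent B" "V \<subseteq> span B" "finite B" "card B = dim V"
  by (rule basis_between[OF empty_subsetI assms independent_empty]) (rule that)

lemma subspace_eq_if_dim_le:
  assumes "subspace A" "A \<subseteq> V" "V \<subseteq> span W" "finite W" "dim V \<le> dim A"
  shows "A = V"
proof -
  obtain BA where BA: "BA \<subseteq> A" "independent BA" "A \<subseteq> span BA" "finite BA" "card BA = dim A"
    by (rule finite_basis[of A W]) (use assms in auto)
  obtain B where B: "BA \<subseteq> B" "B \<subseteq> V" "independent B" "V \<subseteq> span B" "finite B" "card B = dim V"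
    by (rule basis_between[OF _ assms(3,4) BA(2)]) (use BA(1) assms(2) in auto)
  have "BA = B"
    using card_seteq[OF B(5,1)] B(6) BA(5) assms(5) by simp
  then show ?thesis
    using B(4) assms(1,2) BA(1) span_minimal by blast
qed

text \<open>Grassmann's formula. It serves three dimension counts: the Hilbert function, the kernel
  of multiplication by a power of \<open>l\<close>, and the sum of the transformed ideal with the
  span of the standard monomials.\<close>

lemma dim_sum_inter:
  assumes A: "subspace A" and B: "subspace B" and fin: "A \<subseteq> span W" "B \<subseteq> span W" "finite W"
  shows "dim {x + y | x y. x \<in> A \<and> y \<in> B} + dim (A \<inter> B) = dim A + dim B"
proof -
  obtain BI where BI: "BI \<subseteq> A \<inter> B" "independent BI" "A \<inter> B \<subseteq> span BI" "finite BI"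
      "card BI = dim (A \<inter> B)"
    by (rule finite_basis[of "A \<inter> B" W]) (use fin in auto)
  obtain BA where BA: "BI \<subseteq> BA" "BA \<subseteq> A" "independent BA" "A \<subseteq> span BA" "finite BA" "card BA = dim A"
    by (rule basis_between[OF _ fin(1,3) BI(2)]) (use BI(1) in auto)
  have BAB: "BA \<union> B \<subseteq> span W" using BA(2) fin by blast
  obtain D where D: "BA \<subseteq> D" "D \<subseteq> BA \<union> B" "independent D" "BA \<union> B \<subseteq> span D" "finite D"
    by (rule basis_between[OF _ BAB fin(3) BA(3)]) auto
  \<comment> \<open>\<open>C\<close> extends the basis of \<open>A\<close> to one of
    \<open>A + B\<close> by vectors of \<open>B\<close> alone, because \<open>D\<close> was chosen
    inside \<open>BA \<union> B\<close>.\<close>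
  define C where "C = D - BA"
  have C: "C \<subseteq> B" "finite C" "D = BA \<union> C" "BA \<inter> C = {}"
    using D by (auto simp: C_def)
  have spA: "span BA = A" using BA A span_minimal by blast
  have spC: "span C \<subseteq> B" using C(1) B span_minimal by blast
  have spD: "span D = {x + y | x y. x \<in> A \<and> y \<in> B}"
  proof
    show "span D \<subseteq> {x + y | x y. x \<in> A \<and> y \<in> B}"
      unfolding C(3) span_Un spA using spC by blast
    have "B \<subseteq> span D" "A \<subseteq> span D"
      using D(4) spA span_mono[OF D(1)] by auto
    then show "{x + y | x y. x \<in> A \<and> y \<in> B} \<subseteq> span D"
      by (auto intro!: span_add)
  qed
  have 1: "dim {x + y | x y. x \<in> A \<and> y \<in> B} = card D"
    using dim_span_eq_card_independent[OF D(3)] spD by simp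
  \<comment> \<open>The modular law: in \<open>b = x + y\<close> with \<open>y\<close> in the span
    of \<open>C\<close>, which lies in \<open>B\<close>, the part \<open>x\<close> falls into
    \<open>A \<inter> B\<close>.\<close>
  have "B \<subseteq> span (BI \<union> C)"
  proof
    fix b assume b: "b \<in> B"
    then have "b \<in> span (BA \<union> C)" using D(4) C(3) by blast
    then obtain x y where xy: "b = x + y" "x \<in> A" "y \<in> span C"
      unfolding span_Un spA by blast
    have "x = b - y" using xy(1) by simp
    then have "x \<in> B" using subspace_diff[OF B b, of y] xy(3) spC by blast
    then have "x \<in> span BI" using xy(2) BI(3) by blast
    then show "b \<in> span (BI \<union> C)" unfolding span_Un using xy by blast
  qed
  moreover have "independent (BI \<union> C)"
    using D(3) BA(1) C(3) independent_mono by blast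
  moreover have "BI \<union> C \<subseteq> B" using BI(1) C(1) by blast
  ultimately have "dim B = card (BI \<union> C)"
    using basis_card_eq_dim by metis
  also have "\<dots> = card BI + card C"
    using BI(4) C BA(1) by (intro card_Un_disjoint) auto
  finally have "dim B = dim (A \<inter> B) + card C" using BI(5) by simp
  moreover have "card D = dim A + card C"
    using C BA by (simp add: card_Un_disjoint)
  ultimately show ?thesis using 1 by simp
qed

end

lemma (in vector_space_pair) dim_injective_image:
  assumes "Vector_Spaces.linear s1 s2 f" "vs1.subspace V" "inj_on f V"
  shows "vs2.dim (f ` V) = vs1.dim V"
proof -
  interpret f: module_hom s1 s2 f
    using assms(1) linear_iff_module_hom by blast
  obtain B where B: "B \<subseteq> V" "vs1.independent B" "V \<subseteq> vs1.span B" "card B = vs1.dim V"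
    using vs1.basis_exists by blast
  have sp: "vs1.span B = V" using B assms(2) vs1.span_minimal by blast
  have "vs2.dim (f ` V) = vs2.dim (vs2.span (f ` B))"
    using f.span_image sp by simp
  also have "\<dots> = card (f ` B)"
    using f.independent_injective_image[OF B(2)] sp assms(3)
    by (simp add: vs2.dim_span_eq_card_independent del: vs2.dim_span)
  also have "\<dots> = card B"
    using card_image assms(3) B(1) inj_on_subset by blast
  finally show ?thesis using B(4) by simp
qed

text \<open>A basis of \<open>L\<close> extended to \<open>V\<close> has
  \<open>dim V - dim L\<close> further vectors, and only these survive under \<open>f\<close>.
  Applied with L = l I_(k-1) inside V = I_k, it bounds the number of generators of the image of I_k
  modulo l.\<close>

lemma (in vector_space_pair) image_generators:
  assumes "Vector_Spaces.linear s1 s2 f" "L \<subseteq> V" "V \<subseteq> vs1.span W" "finite W" "vs1.subspace V" "f ` L \<subseteq> {0}"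
  obtains C where "finite C" "card C \<le> vs1.dim V - vs1.dim L" "f ` V \<subseteq> vs2.span C"
proof -
  interpret f: module_hom s1 s2 f
    using assms(1) linear_iff_module_hom by blast
  obtain BL where BL: "BL \<subseteq> L" "vs1.independent BL" "L \<subseteq> vs1.span BL" "finite BL"
      "card BL = vs1.dim L"
    by (rule vs1.finite_basis[of L W]) (use assms in auto)
  obtain B where B: "BL \<subseteq> B" "B \<subseteq> V" "vs1.independent B" "V \<subseteq> vs1.span B" "finite B" "card B = vs1.dim V"
    by (rule vs1.basis_between[OF _ assms(3,4) BL(2)]) (use BL(1) assms(2) in auto)
  have "f ` B \<subseteq> insert 0 (f ` (B - BL))"
    using BL(1) assms(6) by blast
  then have "vs2.span (f ` B) \<subseteq> vs2.span (f ` (B - BL))"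
    using vs2.span_mono vs2.span_insert_0 by blast
  then have "f ` V \<subseteq> vs2.span (f ` (B - BL))"
    using f.spans_image[OF B(4)] by blast
  moreover have "card (f ` (B - BL)) \<le> vs1.dim V - vs1.dim L"
    using card_image_le[of "B - BL" f] B BL by (simp add: card_Diff_subset)
  ultimately show thesis using that[of "f ` (B - BL)"] B(5) by blast
qed

section \<open>Linear spaces of univariate polynomials\<close>

global_interpretation upoly: vector_space "smult :: 'k::field \<Rightarrow> 'k poly \<Rightarrow> 'k poly"
  by standard (simp_all add: smult_add_right smult_add_left)

lemma lead_coeff_pderiv_eq:
  fixes p :: "'k::field_char_0 poly"
  assumes "pderiv p \<noteq> 0"
  shows "lead_coeff (pderiv p) = of_nat (degree p) * lead_coeff p"
proof -
  have "degree p \<noteq> 0" using assms pderiv_eq_0_iff by blast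
  then have "Suc (degree (pderiv p)) = degree p" by (simp add: degree_pderiv)
  then show ?thesis by (simp add: coeff_pderiv del: of_nat_Suc)
qed

text \<open>Subtracting a multiple of \<open>g\<close> leaves \<open>h\<close> with the same
  relation but no term of degree \<open>degree g\<close>. If \<open>h\<close> were nonzero,
  comparing leading coefficients in h' g = h g' would identify the two degrees as elements of the
  field, and characteristic zero turns this into an equality of numbers.\<close>

lemma proportional_if_wronskian_zero:
  fixes f g :: "'k::field_char_0 poly"
  assumes eq: "pderiv f * g = f * pderiv g" and g: "g \<noteq> 0"
  shows "\<exists>c. f = smult c g"
proof -
  define c where "c = coeff f (degree g) / lead_coeff g"
  define h where "h = f - smult c g"
  have h0: "coeff h (degree g) = 0" using g by (simp add: h_def c_def)
  have eqh: "pderiv h * g = h * pderiv g"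
    using eq by (simp add: h_def pderiv_diff pderiv_smult algebra_simps)
  have "h = 0"
  proof (rule ccontr)
    assume h: "h \<noteq> 0"
    then have deg: "degree h \<noteq> degree g" using h0 leading_coeff_0_iff by metis
    have "pderiv h = 0 \<longleftrightarrow> pderiv g = 0" using eqh g h by auto
    then have "degree h = 0 \<longleftrightarrow> degree g = 0" by (simp add: pderiv_eq_0_iff)
    then have nz: "pderiv h \<noteq> 0" "pderiv g \<noteq> 0" using deg by (auto simp: pderiv_eq_0_iff)
    have "lead_coeff (pderiv h * g) = lead_coeff (h * pderiv g)" using eqh by simp
    then have "of_nat (degree h) * lead_coeff h * lead_coeff g = lead_coeff h * (of_nat (degree g) * lead_coeff g)"
      by (simp only: lead_coeff_mult nz[THEN lead_coeff_pderiv_eq])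
    then have "of_nat (degree h) = (of_nat (degree g) :: 'k)" using g h by simp
    then show False using deg by simp
  qed
  then show ?thesis unfolding h_def by auto
qed

lemma power_dvd_pderiv:
  fixes p f :: "'k::field_char_0 poly"
  assumes "p ^ Suc n dvd f"
  shows "p ^ n dvd pderiv f"
proof -
  obtain h where "f = p ^ Suc n * h" using assms by auto
  then have "pderiv f = p ^ Suc n * pderiv h + h * (smult (of_nat (Suc n)) (p ^ n) * pderiv p)"
    by (simp only: pderiv_mult pderiv_power_Suc)
  then show ?thesis
    by (simp only:) (intro dvd_add dvd_mult2 dvd_mult dvd_smult le_imp_power_dvd; simp)
qed

text \<open>The exceptional points are the zeros of the Wronskian of the space. The induction divides
  by an element \<open>g\<close> of the space and differentiates, so that the Wronskian itself is not needed.\<close>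

lemma finite_exceptional_points:
  fixes F :: "'k::field_char_0 poly set"
  assumes "finite F"
  shows "finite {s. \<exists>f\<in>upoly.span F. f \<noteq> 0 \<and> [:-s, 1:] ^ card F dvd f}"
  using assms
proof (induction "card F" arbitrary: F rule: less_induct)
  case less
  show ?case
  proof (cases "F = {}")
    case True then show ?thesis by simp
  next
    case False
    then obtain g F' where F: "F = insert g F'" "g \<notin> F'" by (meson equals0I mk_disjoint_insert)
    have fin: "finite F'" and card: "card F = Suc (card F')" using F less.prems by auto
    show ?thesis
    proof (cases "g = 0")
      case True
      then have sp: "upoly.span F = upoly.span F'" using F by simp
      have le: "card F' \<le> card F" using card by simp
      have "{s. \<exists>f\<in>upoly.span F. f \<noteq> 0 \<and> [:-s, 1:] ^ card F dvd f}
        \<subseteq> {s. \<exists>f\<in>upoly.span F'. f \<noteq> 0 \<and> [:-s, 1:] ^ card F' dvd f}"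
      proof clarify
        fix s f assume "f \<in> upoly.span F" "f \<noteq> 0" "[:-s, 1:] ^ card F dvd f"
        then show "\<exists>f\<in>upoly.span F'. f \<noteq> 0 \<and> [:-s, 1:] ^ card F' dvd f"
          using power_le_dvd[OF _ le] sp by metis
      qed
      then show ?thesis using less.hyps[of F'] card fin finite_subset by auto
    next
      case g: False
      \<comment> \<open>\<open>T f\<close> is g^2 times the derivative of f/g. It kills
        \<open>g\<close>, so one generator disappears, and it lowers the order of vanishing at a
        point by at most one.\<close>
      define T where "T f = pderiv f * g - f * pderiv g" for f
      interpret T: module_hom smult smult T
        by standard (simp_all add: T_def pderiv_add pderiv_smult algebra_simps)
      define G where "G = T ` F'"
      have Tg: "T g = 0" by (simp add: T_def)
      have cG: "card G \<le> card F'" and fG: "finite G" using fin by (auto simp: G_def card_image_le)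
      have finG: "finite {s. \<exists>f\<in>upoly.span G. f \<noteq> 0 \<and> [:-s, 1:] ^ card G dvd f}"
        using less.hyps[of G] cG card fG by auto
      \<comment> \<open>The zeros of \<open>g\<close> join the exceptional set because elsewhere
        \<open>T f\<close> cannot vanish: it would make \<open>f\<close> a nonzero multiple of
        \<open>g\<close>, whereas \<open>f\<close> vanishes at \<open>s\<close> and \<open>g\<close>
        does not.\<close>
      have "{s. \<exists>f\<in>upoly.span F. f \<noteq> 0 \<and> [:-s, 1:] ^ card F dvd f}
        \<subseteq> {s. \<exists>f\<in>upoly.span G. f \<noteq> 0 \<and> [:-s, 1:] ^ card G dvd f} \<union> {s. poly g s = 0}"
      proof clarify
        fix s f assume f: "f \<in> upoly.span F" "f \<noteq> 0" "[:-s, 1:] ^ card F dvd f"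
          and s: "poly g s \<noteq> 0"
        have "T f \<in> upoly.span (T ` F)" using f(1) T.span_image by blast
        then have Tf: "T f \<in> upoly.span G" by (simp add: F(1) Tg G_def)
        have "[:-s, 1:] ^ card F' dvd T f"
          unfolding T_def
        proof (intro dvd_diff dvd_mult2)
          show "[:-s, 1:] ^ card F' dvd pderiv f" by (rule power_dvd_pderiv) (use f(3) card in metis)
          show "[:-s, 1:] ^ card F' dvd f" by (rule power_le_dvd[OF f(3)]) (use card in simp)
        qed
        then have d: "[:-s, 1:] ^ card G dvd T f" using power_le_dvd cG by metis
        have "T f \<noteq> 0"
        proof
          assume "T f = 0"
          then have "pderiv f * g = f * pderiv g" by (simp add: T_def)
          then obtain c where c: "f = smult c g" using proportional_if_wronskian_zero[OF _ g] by blast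
          then have "c \<noteq> 0" using f(2) by auto
          have "[:-s, 1:] ^ 1 dvd f" by (rule power_le_dvd[OF f(3)]) (use card in simp)
          then have "poly f s = 0" by (simp add: poly_eq_0_iff_dvd)
          then show False using c s \<open>c \<noteq> 0\<close> by simp
        qed
        then show "\<exists>f\<in>upoly.span G. f \<noteq> 0 \<and> [:-s, 1:] ^ card G dvd f" using Tf d by blast
      qed
      then show ?thesis using finG poly_roots_finite[OF g] finite_subset by blast
    qed
  qed
qed

section \<open>Polynomial rings\<close>

lemma single_times_poly_lookup:
  fixes p :: "('x, 'k::comm_ring_1) poly_ring"
  shows "Poly_Mapping.lookup (Poly_Mapping.single m c * p) (m + n) = c * Poly_Mapping.lookup p n"
  unfolding lookup_mult by (simp add: lookup_single when_mult)

lemma single_times_poly_lookup_eq_0: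
  fixes p :: "('x, 'k::comm_ring_1) poly_ring"
  assumes "\<And>n. k \<noteq> m + n"
  shows "Poly_Mapping.lookup (Poly_Mapping.single m c * p) k = 0"
  unfolding lookup_mult by (simp add: lookup_single when_mult assms)

lemma lookup_Const_times [simp]:
  "Poly_Mapping.lookup (Const c * p) m = c * Poly_Mapping.lookup p m"
  unfolding Const_def using single_times_poly_lookup[of 0 c p m] by simp

lemma Const_simps [simp]: "Const 0 = 0" "Const 1 = 1"
  by (simp_all add: Const_def)

lemma Const_add: "Const (a + b) = Const a + Const b"
  by (simp add: Const_def single_add)

lemma Const_mult: "Const (a * b) = Const a * Const b"
  by (simp add: Const_def mult_single)

lemma Const_sum: "Const (sum f A) = (\<Sum>a\<in>A. Const (f a))"
  by (induction A rule: infinite_finite_induct) (simp_all add: Const_add)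

global_interpretation kpoly:
  vector_space "\<lambda>c p. Const c * p :: ('x, 'k::field) poly_ring"
proof
  fix a b :: 'k and x y :: "('x, 'k) poly_ring"
  show "Const a * (x + y) = Const a * x + Const a * y" by (rule distrib_left)
  show "Const (a + b) * x = Const a * x + Const b * x" by (simp only: Const_add distrib_right)
  show "Const a * (Const b * x) = Const (a * b) * x" by (simp only: Const_mult mult.assoc)
  show "Const 1 * x = x" by (simp only: Const_simps mult_1_left)
qed

lemma poly_eq_sum_single:
  fixes p :: "('x, 'k::comm_ring_1) poly_ring"
  shows "p = (\<Sum>m\<in>Poly_Mapping.keys p. Poly_Mapping.single m (Poly_Mapping.lookup p m))"
proof (rule poly_mapping_eqI)
  fix k
  have "(\<Sum>m\<in>Poly_Mapping.keys p. Poly_Mapping.lookup (Poly_Mapping.single m (Poly_Mapping.lookup p m)) k)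
      = (\<Sum>m\<in>Poly_Mapping.keys p. if m = k then Poly_Mapping.lookup p m else 0)"
    by (rule sum.cong) (simp_all add: lookup_single when_def)
  also have "\<dots> = Poly_Mapping.lookup p k"
    by (simp add: in_keys_iff)
  finally show "Poly_Mapping.lookup p k
      = Poly_Mapping.lookup (\<Sum>m\<in>Poly_Mapping.keys p. Poly_Mapping.single m (Poly_Mapping.lookup p m)) k"
    by (simp add: lookup_sum)
qed

definition monom_val :: "('x \<Rightarrow> 'r::comm_ring_1) \<Rightarrow> ('x \<Rightarrow>\<^sub>0 nat) \<Rightarrow> 'r" where
  "monom_val a m = (\<Prod>i\<in>Poly_Mapping.keys m. a i ^ Poly_Mapping.lookup m i)"

lemma monom_val_superset:
  "finite A \<Longrightarrow> Poly_Mapping.keys m \<subseteq> A \<Longrightarrow> monom_val a m = (\<Prod>i\<in>A. a i ^ Poly_Mapping.lookup m i)"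
  unfolding monom_val_def by (rule prod.mono_neutral_left) (auto simp: in_keys_iff)

lemma monom_val_0 [simp]: "monom_val a 0 = 1"
  by (simp add: monom_val_def)

lemma monom_val_add: "monom_val a (m + n) = monom_val a m * monom_val a n"
proof -
  let ?A = "Poly_Mapping.keys m \<union> Poly_Mapping.keys n"
  have "monom_val a (m + n) = (\<Prod>i\<in>?A. a i ^ Poly_Mapping.lookup (m + n) i)"
    using keys_add[of m n] by (intro monom_val_superset) auto
  also have "\<dots> = (\<Prod>i\<in>?A. a i ^ Poly_Mapping.lookup m i) * (\<Prod>i\<in>?A. a i ^ Poly_Mapping.lookup n i)"
    by (simp add: lookup_add power_add prod.distrib)
  also have "\<dots> = monom_val a m * monom_val a n"
    by (simp add: monom_val_superset[of ?A])
  finally show ?thesis .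
qed

lemma monom_val_single [simp]: "monom_val a (Poly_Mapping.single i n) = a i ^ n"
  by (cases "n = 0") (simp_all add: monom_val_def)

lemma monom_val_Var: "monom_val Var m = (Poly_Mapping.single m 1 :: ('x, 'k::comm_ring_1) poly_ring)"
proof -
  have pw: "Var i ^ n = (Poly_Mapping.single (Poly_Mapping.single i n) 1 :: ('x, 'k) poly_ring)" for i n
    by (induction n) (simp_all add: Var_def mult_single single_add[symmetric])
  have "finite A \<Longrightarrow> (\<Prod>i\<in>A. Poly_Mapping.single (f i) 1) = (Poly_Mapping.single (sum f A) 1 :: ('x, 'k) poly_ring)"
    for A and f :: "'x \<Rightarrow> 'x \<Rightarrow>\<^sub>0 nat"
    by (induction A rule: finite_induct) (simp_all add: mult_single)
  then have "monom_val Var m = (Poly_Mapping.single (\<Sum>i\<in>Poly_Mapping.keys m. Poly_Mapping.single i (Poly_Mapping.lookup m i)) 1 :: ('x, 'k) poly_ring)"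
    by (simp add: monom_val_def pw)
  also have "(\<Sum>i\<in>Poly_Mapping.keys m. Poly_Mapping.single i (Poly_Mapping.lookup m i)) = m"
    by (rule poly_mapping_eqI) (auto simp: lookup_sum lookup_single when_def sum.delta in_keys_iff)
  finally show ?thesis .
qed

lemma single_eq_Const_monom_val:
  "Poly_Mapping.single m c = Const c * (monom_val Var m :: ('x, 'k::comm_ring_1) poly_ring)"
  by (simp add: monom_val_Var Const_def mult_single)

locale coeff_hom =
  fixes h :: "'k::comm_ring_1 \<Rightarrow> 'r::comm_ring_1"
  assumes h_add: "h (a + b) = h a + h b"
    and h_mult: "h (a * b) = h a * h b"
    and h_1 [simp]: "h 1 = 1"
begin

lemma h_0 [simp]: "h 0 = 0"
  using h_add[of 0 0] by simp

lemma poly_eval_superset: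
  assumes "finite A" "Poly_Mapping.keys p \<subseteq> A"
  shows "poly_eval h a p = (\<Sum>m\<in>A. h (Poly_Mapping.lookup p m) * monom_val a m)"
  unfolding poly_eval_def monom_val_def[symmetric]
  using assms by (intro sum.mono_neutral_left) (auto simp: in_keys_iff)

lemma poly_eval_0 [simp]: "poly_eval h a 0 = 0"
  by (simp add: poly_eval_def)

lemma poly_eval_add: "poly_eval h a (p + q) = poly_eval h a p + poly_eval h a q"
proof -
  let ?A = "Poly_Mapping.keys p \<union> Poly_Mapping.keys q"
  have "poly_eval h a (p + q) = (\<Sum>m\<in>?A. h (Poly_Mapping.lookup (p + q) m) * monom_val a m)"
    using keys_add[of p q] by (intro poly_eval_superset) auto
  also have "\<dots> = poly_eval h a p + poly_eval h a q"
    by (simp add: poly_eval_superset[of ?A] lookup_add h_add distrib_right sum.distrib)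
  finally show ?thesis .
qed

lemma poly_eval_sum: "poly_eval h a (sum f A) = (\<Sum>x\<in>A. poly_eval h a (f x))"
  by (induction A rule: infinite_finite_induct) (simp_all add: poly_eval_add)

lemma poly_eval_single: "poly_eval h a (Poly_Mapping.single m c) = h c * monom_val a m"
  by (cases "c = 0") (simp_all add: poly_eval_superset[of "{m}"])

lemma poly_eval_Const [simp]: "poly_eval h a (Const c) = h c"
  by (simp add: Const_def poly_eval_single)

lemma poly_eval_1 [simp]: "poly_eval h a 1 = 1"
  using poly_eval_Const[of a 1] by simp

lemma poly_eval_Var [simp]: "poly_eval h a (Var i) = a i"
  by (simp add: Var_def poly_eval_single)

lemma poly_eval_mult: "poly_eval h a (p * q) = poly_eval h a p * poly_eval h a q"
proof -
  let ?s = "\<lambda>p m. Poly_Mapping.single m (Poly_Mapping.lookup p m)"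
  have "p * q = (\<Sum>m\<in>Poly_Mapping.keys p. \<Sum>n\<in>Poly_Mapping.keys q. ?s p m * ?s q n)"
    by (metis (no_types) poly_eq_sum_single sum_product)
  then have "poly_eval h a (p * q) = (\<Sum>m\<in>Poly_Mapping.keys p. \<Sum>n\<in>Poly_Mapping.keys q.
      (h (Poly_Mapping.lookup p m) * monom_val a m) * (h (Poly_Mapping.lookup q n) * monom_val a n))"
    by (simp only: poly_eval_sum mult_single poly_eval_single h_mult monom_val_add mult_ac)
  also have "\<dots> = poly_eval h a p * poly_eval h a q"
    by (simp add: sum_product poly_eval_def monom_val_def)
  finally show ?thesis .
qed

lemma poly_eval_power: "poly_eval h a (p ^ n) = poly_eval h a p ^ n"
  by (induction n) (simp_all add: poly_eval_mult)

lemma poly_eval_uminus: "poly_eval h a (- p) = - poly_eval h a p"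
  using poly_eval_add[of a p "- p"] by (simp add: add_eq_0_iff)

lemma poly_eval_diff: "poly_eval h a (p - q) = poly_eval h a p - poly_eval h a q"
  using poly_eval_add[of a p "- q"] by (simp add: poly_eval_uminus)

text \<open>Uniqueness in the universal property of the polynomial ring. Identities between composed
  substitutions are proved below by checking them on the variables.\<close>

lemma poly_eval_unique:
  assumes add: "\<And>p q. F (p + q) = F p + F q" and mult: "\<And>p q. F (p * q) = F p * F q"
    and Const: "\<And>c. F (Const c) = h c"
  shows "F p = poly_eval h (\<lambda>i. F (Var i)) p"
proof -
  have F0: "F 0 = 0" using add[of 0 0] by simp
  have F1: "F 1 = 1" using Const[of 1] by simp
  have F_sum: "F (sum f A) = (\<Sum>x\<in>A. F (f x))" for f and A :: "('a \<Rightarrow>\<^sub>0 nat) set"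
    by (induction A rule: infinite_finite_induct) (simp_all add: add F0)
  have F_pow: "F (p ^ n) = F p ^ n" for p n
    by (induction n) (simp_all add: mult F1)
  have F_prod: "F (prod f A) = (\<Prod>x\<in>A. F (f x))" for f and A :: "'a set"
    by (induction A rule: infinite_finite_induct) (simp_all add: mult F1)
  have "F p = (\<Sum>m\<in>Poly_Mapping.keys p. F (Poly_Mapping.single m (Poly_Mapping.lookup p m)))"
    by (subst poly_eq_sum_single) (simp add: F_sum)
  also have "\<dots> = poly_eval h (\<lambda>i. F (Var i)) p"
    by (simp add: poly_eval_def single_eq_Const_monom_val mult Const monom_val_def F_prod F_pow)
  finally show ?thesis .
qed

end

section \<open>Homogeneous polynomials\<close>

lemma mdeg_superset:
  "finite A \<Longrightarrow> Poly_Mapping.keys m \<subseteq> A \<Longrightarrow> mdeg m = (\<Sum>i\<in>A. Poly_Mapping.lookup m i)"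
  unfolding mdeg_def by (rule sum.mono_neutral_left) (auto simp: in_keys_iff)

lemma mdeg_add: "mdeg (m + n) = mdeg m + mdeg n"
proof -
  let ?A = "Poly_Mapping.keys m \<union> Poly_Mapping.keys n"
  have "mdeg (m + n) = (\<Sum>i\<in>?A. Poly_Mapping.lookup (m + n) i)"
    using keys_add[of m n] by (intro mdeg_superset) auto
  also have "\<dots> = mdeg m + mdeg n"
    by (simp add: lookup_add sum.distrib mdeg_superset[of ?A])
  finally show ?thesis .
qed

lemma mdeg_0 [simp]: "mdeg 0 = 0"
  by (simp add: mdeg_def)

lemma mdeg_single [simp]: "mdeg (Poly_Mapping.single i n) = n"
  by (cases "n = 0") (simp_all add: mdeg_def)

lemma homogeneous_0 [simp]: "homogeneous t 0"
  by (simp add: homogeneous_def)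

lemma homogeneous_add: "homogeneous t f \<Longrightarrow> homogeneous t g \<Longrightarrow> homogeneous t (f + g)"
  unfolding homogeneous_def using keys_add[of f g] by blast

lemma homogeneous_sum: "(\<And>x. x \<in> A \<Longrightarrow> homogeneous t (f x)) \<Longrightarrow> homogeneous t (sum f A)"
  by (induction A rule: infinite_finite_induct) (auto intro: homogeneous_add)

lemma homogeneous_mult: "homogeneous s f \<Longrightarrow> homogeneous t g \<Longrightarrow> homogeneous (s + t) (f * g)"
  unfolding homogeneous_def using keys_mult[of f g] by (fastforce simp: mdeg_add)

lemma homogeneous_single: "mdeg m = t \<Longrightarrow> homogeneous t (Poly_Mapping.single m c)"
  by (simp add: homogeneous_def)

lemma homogeneous_Const: "homogeneous 0 (Const c)"
  by (simp add: Const_def homogeneous_single)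

lemma homogeneous_1: "homogeneous 0 1"
  using homogeneous_Const[of 1] by simp

lemma homogeneous_Var: "homogeneous 1 (Var i)"
  unfolding Var_def by (rule homogeneous_single) simp

lemma homogeneous_Const_times: "homogeneous t f \<Longrightarrow> homogeneous t (Const c * f)"
  using homogeneous_mult[OF homogeneous_Const, of t f c] by simp

lemma homogeneous_power: "homogeneous s f \<Longrightarrow> homogeneous (n * s) (f ^ n)"
  by (induction n) (auto simp: homogeneous_1 intro: homogeneous_mult)

lemma homogeneous_prod:
  assumes "\<And>x. x \<in> A \<Longrightarrow> homogeneous (s x) (f x)"
  shows "homogeneous (\<Sum>x\<in>A. s x) (\<Prod>x\<in>A. f x)"
  using assms by (induction A rule: infinite_finite_induct) (auto simp: homogeneous_1 intro: homogeneous_mult)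

lemma subspace_homogeneous: "kpoly.subspace {f. homogeneous t f}"
  by (rule kpoly.subspaceI) (auto intro: homogeneous_add homogeneous_Const_times)

lemma homogeneous_diff:
  fixes f :: "('x, 'k::field) poly_ring"
  shows "homogeneous t f \<Longrightarrow> homogeneous t g \<Longrightarrow> homogeneous t (f - g)"
  using kpoly.subspace_diff[OF subspace_homogeneous] by blast

definition hom_component :: "nat \<Rightarrow> ('x, 'k::comm_ring_1) poly_ring \<Rightarrow> ('x, 'k) poly_ring" where
  "hom_component t p = Poly_Mapping.mapp (\<lambda>m c. c when mdeg m = t) p"

lemma lookup_hom_component:
  "Poly_Mapping.lookup (hom_component t p) m = (Poly_Mapping.lookup p m when mdeg m = t)"
  by (auto simp: hom_component_def lookup_mapp when_def in_keys_iff)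

lemma homogeneous_hom_component: "homogeneous t (hom_component t p)"
  by (auto simp: homogeneous_def in_keys_iff lookup_hom_component)

lemma hom_component_add: "hom_component t (p + q) = hom_component t p + hom_component t q"
  by (rule poly_mapping_eqI) (simp add: lookup_hom_component lookup_add when_def)

lemma hom_component_0 [simp]: "hom_component t 0 = 0"
  by (rule poly_mapping_eqI) (simp add: lookup_hom_component)

lemma hom_component_sum: "hom_component t (sum f A) = (\<Sum>x\<in>A. hom_component t (f x))"
  by (induction A rule: infinite_finite_induct) (simp_all add: hom_component_add)

lemma hom_component_homogeneous:
  "homogeneous s p \<Longrightarrow> hom_component t p = (if s = t then p else 0)"
  by (rule poly_mapping_eqI) (auto simp: lookup_hom_component homogeneous_def in_keys_iff when_def)

lemma sum_hom_component:
  assumes "finite E" "mdeg ` Poly_Mapping.keys p \<subseteq> E"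
  shows "(\<Sum>e\<in>E. hom_component e p) = p"
proof (rule poly_mapping_eqI)
  fix m
  have "Poly_Mapping.lookup (\<Sum>e\<in>E. hom_component e p) m = (\<Sum>e\<in>E. if e = mdeg m then Poly_Mapping.lookup p m else 0)"
    by (auto simp: lookup_sum lookup_hom_component when_def intro: sum.cong)
  also have "\<dots> = Poly_Mapping.lookup p m"
    using assms by (cases "m \<in> Poly_Mapping.keys p") (auto simp: not_in_keys_iff_lookup_eq_zero)
  finally show "Poly_Mapping.lookup (\<Sum>e\<in>E. hom_component e p) m = Poly_Mapping.lookup p m" .
qed

lemma hom_component_mult:
  assumes f: "homogeneous d f"
  shows "hom_component t (f * g) = (if d \<le> t then f * hom_component (t - d) g else 0)"
proof -
  define E where "E = insert (t - d) (mdeg ` Poly_Mapping.keys g)"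
  have E: "finite E" "(\<Sum>e\<in>E. hom_component e g) = g"
    by (auto simp: E_def intro: sum_hom_component)
  have "hom_component t (f * g) = hom_component t (f * (\<Sum>e\<in>E. hom_component e g))"
    by (simp add: E(2))
  also have "\<dots> = (\<Sum>e\<in>E. if d + e = t then f * hom_component e g else 0)"
    by (simp add: sum_distrib_left hom_component_sum
        hom_component_homogeneous[OF homogeneous_mult[OF f homogeneous_hom_component]])
  also have "\<dots> = (\<Sum>e\<in>E. if e = t - d then (if d \<le> t then f * hom_component e g else 0) else 0)"
    by (rule sum.cong) auto
  also have "\<dots> = (if d \<le> t then f * hom_component (t - d) g else 0)"
    by (subst sum.delta[OF E(1)]) (simp add: E_def)
  finally show ?thesis .
qed

lemma homogeneous_monom_val:
  assumes "\<And>i. homogeneous 1 (a i)"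
  shows "homogeneous (mdeg m) (monom_val a m)"
  unfolding monom_val_def mdeg_def using homogeneous_power[OF assms]
  by (intro homogeneous_prod) auto

section \<open>Linear changes of coordinates\<close>

interpretation Const: coeff_hom "Const :: 'k \<Rightarrow> ('x, 'k::comm_ring_1) poly_ring"
  by standard (simp_all add: Const_add Const_mult)

interpretation id: coeff_hom id
  by standard simp_all

interpretation const_upoly: coeff_hom "\<lambda>c :: 'k::comm_ring_1. [:c:]"
  by standard (simp_all add: one_pCons)

lemma coord_change_hom:
  "coord_change \<alpha> (p + q) = coord_change \<alpha> p + coord_change \<alpha> q"
  "coord_change \<alpha> (p - q) = coord_change \<alpha> p - coord_change \<alpha> q"
  "coord_change \<alpha> (p * q) = coord_change \<alpha> p * coord_change \<alpha> q"
  "coord_change \<alpha> (p ^ n) = coord_change \<alpha> p ^ n"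
  "coord_change \<alpha> (sum f A) = (\<Sum>x\<in>A. coord_change \<alpha> (f x))"
  "coord_change \<alpha> 0 = 0"
  "coord_change \<alpha> 1 = 1"
  "coord_change \<alpha> (Const c) = Const c"
  "coord_change \<alpha> (Var j) = (\<Sum>i\<in>UNIV. Const (\<alpha> $ i $ j) * Var i)"
  by (simp_all add: coord_change_def Const.poly_eval_add Const.poly_eval_mult Const.poly_eval_diff
      Const.poly_eval_power Const.poly_eval_sum)

text \<open>Column j of a matrix holds the image of x_j, so composition of substitutions is the
  matrix product in the same order.\<close>

lemma coord_change_compose:
  "coord_change \<alpha> (coord_change \<beta> p) = coord_change (\<alpha> ** \<beta>) p"
proof -
  have "coord_change \<alpha> (coord_change \<beta> p) = poly_eval Const (\<lambda>j. coord_change \<alpha> (coord_change \<beta> (Var j))) p"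
    by (rule Const.poly_eval_unique) (simp_all add: coord_change_hom(1,3,8))
  also have "(\<lambda>j. coord_change \<alpha> (coord_change \<beta> (Var j))) = (\<lambda>j. \<Sum>i\<in>UNIV. Const ((\<alpha> ** \<beta>) $ i $ j) * Var i)"
  proof
    fix j
    have "coord_change \<alpha> (coord_change \<beta> (Var j))
        = (\<Sum>k\<in>UNIV. \<Sum>i\<in>UNIV. Const (\<beta> $ k $ j) * (Const (\<alpha> $ i $ k) * Var i))"
      by (simp add: coord_change_hom(3,5,8,9) sum_distrib_left)
    also have "\<dots> = (\<Sum>i\<in>UNIV. \<Sum>k\<in>UNIV. Const (\<beta> $ k $ j) * (Const (\<alpha> $ i $ k) * Var i))"
      by (rule sum.swap)
    also have "\<dots> = (\<Sum>i\<in>UNIV. Const ((\<alpha> ** \<beta>) $ i $ j) * Var i)"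
    proof (rule sum.cong[OF refl])
      fix i
      have "Const ((\<alpha> ** \<beta>) $ i $ j) * Var i = (\<Sum>k\<in>UNIV. Const (\<alpha> $ i $ k * \<beta> $ k $ j) * Var i)"
        by (simp add: matrix_matrix_mult_def Const_sum sum_distrib_right)
      also have "\<dots> = (\<Sum>k\<in>UNIV. Const (\<beta> $ k $ j) * (Const (\<alpha> $ i $ k) * Var i))"
        by (rule sum.cong) (simp_all only: Const_mult mult_ac)
      finally show "(\<Sum>k\<in>UNIV. Const (\<beta> $ k $ j) * (Const (\<alpha> $ i $ k) * Var i))
          = Const ((\<alpha> ** \<beta>) $ i $ j) * Var i" by simp
    qed
    finally show "coord_change \<alpha> (coord_change \<beta> (Var j)) = (\<Sum>i\<in>UNIV. Const ((\<alpha> ** \<beta>) $ i $ j) * Var i)" .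
  qed
  finally show ?thesis by (simp add: coord_change_def)
qed

lemma coord_change_id: "coord_change (mat 1) p = p"
proof -
  have "p = poly_eval Const Var p"
    by (rule Const.poly_eval_unique[where F = "\<lambda>p. p"]) simp_all
  moreover have "(\<Sum>i\<in>UNIV. Const (mat 1 $ i $ j) * Var i) = (Var j :: 'a poly3)" for j :: 3
  proof -
    have "(\<Sum>i\<in>UNIV. Const (mat 1 $ i $ j) * Var i) = (\<Sum>i\<in>UNIV. if i = j then Var i else 0 :: 'a poly3)"
      by (rule sum.cong) (simp_all add: mat_def)
    then show ?thesis by simp
  qed
  ultimately show ?thesis by (simp add: coord_change_def)
qed

lemma homogeneous_coord_change:
  assumes "homogeneous t p"
  shows "homogeneous t (coord_change \<alpha> p)"
proof -
  have "homogeneous 1 (\<Sum>i\<in>UNIV. Const (\<alpha> $ i $ j) * Var i)" for j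
    by (intro homogeneous_sum homogeneous_Const_times homogeneous_Var)
  then have "homogeneous t (monom_val (\<lambda>j. \<Sum>i\<in>UNIV. Const (\<alpha> $ i $ j) * Var i) m)"
    if "m \<in> Poly_Mapping.keys p" for m
    using homogeneous_monom_val[of "\<lambda>j. \<Sum>i\<in>UNIV. Const (\<alpha> $ i $ j) * Var i" m] assms that
    by (simp add: homogeneous_def[of t p])
  then show ?thesis
    unfolding coord_change_def poly_eval_def monom_val_def[symmetric]
    by (intro homogeneous_sum homogeneous_Const_times)
qed

section \<open>Monomials in three variables\<close>

definition mon :: "nat \<Rightarrow> nat \<Rightarrow> nat \<Rightarrow> 3 \<Rightarrow>\<^sub>0 nat" where
  "mon a b c = Poly_Mapping.single 1 a + Poly_Mapping.single 2 b + Poly_Mapping.single 3 c"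

lemma distinct_3: "(1::3) \<noteq> 2" "(1::3) \<noteq> 3" "(2::3) \<noteq> 3" "(2::3) \<noteq> 1" "(3::3) \<noteq> 1" "(3::3) \<noteq> 2"
  by simp_all

lemma lookup_mon:
  "Poly_Mapping.lookup (mon a b c) 1 = a" "Poly_Mapping.lookup (mon a b c) 2 = b"
  "Poly_Mapping.lookup (mon a b c) 3 = c"
  using distinct_3 by (simp_all only: mon_def lookup_add lookup_single when_def if_False refl if_True add_0_left add_0_right)

lemma monomial_eqI:
  assumes "Poly_Mapping.lookup m 1 = Poly_Mapping.lookup n 1"
    "Poly_Mapping.lookup m 2 = Poly_Mapping.lookup n 2"
    "Poly_Mapping.lookup m 3 = Poly_Mapping.lookup n 3"
  shows "m = (n :: 3 \<Rightarrow>\<^sub>0 nat)"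
proof (rule poly_mapping_eqI)
  show "Poly_Mapping.lookup m k = Poly_Mapping.lookup n k" for k
    using exhaust_3[of k] assms by metis
qed

lemma mon_lookup:
  "mon (Poly_Mapping.lookup m 1) (Poly_Mapping.lookup m 2) (Poly_Mapping.lookup m 3) = m"
  by (rule monomial_eqI) (simp_all only: lookup_mon)

lemma mon_cases:
  obtains a b c where "m = mon a b c"
  using mon_lookup[of m] that by metis

lemma mon_eq_iff: "mon a b c = mon a' b' c' \<longleftrightarrow> a = a' \<and> b = b' \<and> c = c'"
  using lookup_mon by metis

lemma mon_add: "mon a b c + mon a' b' c' = mon (a + a') (b + b') (c + c')"
  by (rule monomial_eqI) (simp_all only: lookup_add lookup_mon)

lemma mdeg_mon: "mdeg (mon a b c) = a + b + c"
  by (simp only: mon_def mdeg_add mdeg_single)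

lemma monom_val_mon: "monom_val e (mon a b c) = e 1 ^ a * e 2 ^ b * e 3 ^ c"
  by (simp only: mon_def monom_val_add monom_val_single)

lemma single_mon:
  "Poly_Mapping.single (mon a b c) 1 = (x1 ^ a * x2 ^ b * x3 ^ c :: 'k::comm_ring_1 poly3)"
  unfolding monom_val_Var[symmetric] monom_val_mon ..

lemma revlex_less_mon:
  "revlex_less (mon a b c) (mon a' b' c') \<longleftrightarrow> a + b + c < a' + b' + c' \<or>
     a + b + c = a' + b' + c' \<and> (c > c' \<or> c = c' \<and> b > b')"
  by (simp only: revlex_less_def mdeg_mon lookup_mon)

definition degree_monomials :: "nat \<Rightarrow> (3 \<Rightarrow>\<^sub>0 nat) set" where
  "degree_monomials t = {m. mdeg m = t}"

text \<open>The pair (k, a) stores k = a + b. In degree t the two conditions on standard monomials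
  become k + t + 2 < 3d and a + 2k + 2 < 3d, which is why \<open>card_standard\<close> reuses this
  parametrization.\<close>

lemma degree_monomials_eq_image:
  "degree_monomials t = (\<lambda>(k, a). mon a (k - a) (t - k)) ` (SIGMA k:{..t}. {..k})"
proof -
  have "m \<in> (\<lambda>(k, a). mon a (k - a) (t - k)) ` (SIGMA k:{..t}. {..k})" if "mdeg m = t" for m
  proof -
    obtain a b c where m: "m = mon a b c" by (rule mon_cases)
    show ?thesis by (rule image_eqI[of _ _ "(a + b, a)"]) (use that in \<open>auto simp: m mdeg_mon\<close>)
  qed
  then show ?thesis by (auto simp: degree_monomials_def mdeg_mon)
qed

lemma inj_on_mon: "inj_on (\<lambda>(k, a). mon a (k - a) (t - k)) (SIGMA k:{..t}. {..k})"
  by (auto simp: inj_on_def mon_eq_iff)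

lemma finite_degree_monomials: "finite (degree_monomials t)"
  by (simp add: degree_monomials_eq_image)

lemma card_degree_monomials: "2 * card (degree_monomials t) = (t + 1) * (t + 2)"
proof -
  have "card (degree_monomials t) = (\<Sum>k\<le>t. k + 1)"
    unfolding degree_monomials_eq_image by (subst card_image[OF inj_on_mon]) simp
  moreover have "2 * (\<Sum>k\<le>t. k + 1) = (t + 1) * (t + 2)"
    by (induction t) simp_all
  ultimately show ?thesis by simp
qed

text \<open>The monomials outside the generic initial ideal. All inequalities are shifted so that no
  truncated subtraction occurs: the weights are at most \<open>3 d - 3\<close>.\<close>

definition standard_monomials :: "nat \<Rightarrow> (3 \<Rightarrow>\<^sub>0 nat) set" where
  "standard_monomials d = {m.
     2 * (Poly_Mapping.lookup m 1 + Poly_Mapping.lookup m 2) + Poly_Mapping.lookup m 3 + 2 < 3 * d \<and>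
     3 * Poly_Mapping.lookup m 1 + 2 * Poly_Mapping.lookup m 2 + 2 < 3 * d}"

lemma mon_in_standard:
  "mon a b c \<in> standard_monomials d \<longleftrightarrow> 2 * (a + b) + c + 2 < 3 * d \<and> 3 * a + 2 * b + 2 < 3 * d"
  by (simp only: standard_monomials_def mem_Collect_eq lookup_mon)

section \<open>Counting the standard monomials of each degree\<close>

abbreviation standard_in_degree :: "nat \<Rightarrow> nat \<Rightarrow> (3 \<Rightarrow>\<^sub>0 nat) set" where
  "standard_in_degree d t \<equiv> standard_monomials d \<inter> degree_monomials t"

lemma card_standard:
  "card (standard_in_degree d t)
     = (\<Sum>k\<in>{k. k \<le> t \<and> k + t + 2 < 3 * d}. min (k + 1) (3 * d - 2 - 2 * k))"
proof -
  let ?f = "\<lambda>(k, a). mon a (k - a) (t - k)"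
  let ?S = "SIGMA k:{k. k \<le> t \<and> k + t + 2 < 3 * d}. {..<min (k + 1) (3 * d - 2 - 2 * k)}"
  have "standard_in_degree d t = ?f ` ?S"
  proof (intro equalityI subsetI)
    fix m assume m: "m \<in> standard_in_degree d t"
    obtain a b c where abc: "m = mon a b c" by (rule mon_cases)
    show "m \<in> ?f ` ?S"
      by (rule image_eqI[of _ _ "(a + b, a)"])
        (use m in \<open>auto simp: abc mdeg_mon mon_in_standard degree_monomials_def\<close>)
  next
    fix m assume "m \<in> ?f ` ?S"
    then show "m \<in> standard_in_degree d t"
      by (auto simp: mdeg_mon mon_in_standard degree_monomials_def)
  qed
  moreover have "inj_on ?f ?S"
    by (rule inj_on_subset[OF inj_on_mon]) auto
  moreover have "finite {k. k \<le> t \<and> k + t + 2 < 3 * d}"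
    by (rule finite_subset[of _ "{..t}"]) auto
  ultimately show ?thesis by (simp add: card_image)
qed

text \<open>The Hilbert function of a complete intersection of three forms of degree d, up to the
  middle degree, as the sum of its first differences. Higher degrees are reached by the symmetry of
  t and 3d-3-t.\<close>

definition hilbert_half :: "nat \<Rightarrow> nat \<Rightarrow> nat" where
  "hilbert_half d e = (\<Sum>k\<le>e. min (k + 1) (3 * d - 2 - 2 * k))"

lemma card_standard_hilbert:
  assumes "1 \<le> d"
  shows "card (standard_in_degree d t) = (if 3 * d \<le> t + 2 then 0 else hilbert_half d (min t (3 * d - 3 - t)))"
proof (cases "3 * d \<le> t + 2")
  case True
  then have "{k. k \<le> t \<and> k + t + 2 < 3 * d} = {}" by auto
  then show ?thesis using True by (simp only: card_standard) simp
next
  case False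
  then have "{k. k \<le> t \<and> k + t + 2 < 3 * d} = {..min t (3 * d - 3 - t)}" by auto
  then show ?thesis using False by (simp add: card_standard hilbert_half_def)
qed

lemma hilbert_half_mono: "e \<le> e' \<Longrightarrow> hilbert_half d e \<le> hilbert_half d e'"
  unfolding hilbert_half_def by (rule sum_mono2) auto

text \<open>Symmetry and unimodality: the second hypothesis says k <= 3d-3-(k+c), so
  \<open>k + c\<close> and its mirror image are both at least \<open>k\<close>.\<close>

lemma card_standard_mono:
  assumes "1 \<le> d" "2 * k + c + 2 < 3 * d"
  shows "card (standard_in_degree d k) \<le> card (standard_in_degree d (k + c))"
  using assms by (auto simp: card_standard_hilbert intro!: hilbert_half_mono)

lemma card_standard_Suc:
  assumes "1 \<le> d" "2 * Suc k + 2 < 3 * d"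
  shows "card (standard_in_degree d (Suc k)) = card (standard_in_degree d k) + min (k + 2) (3 * d - 4 - 2 * k)"
  using assms by (simp add: card_standard_hilbert hilbert_half_def)

lemma hilbert_half_closed_low:
  assumes "e < d"
  shows "2 * int (hilbert_half d e) = (int e + 1) * (int e + 2)"
  using assms
proof (induction e)
  case 0 then show ?case by (simp add: hilbert_half_def)
next
  case (Suc e)
  then have "hilbert_half d (Suc e) = hilbert_half d e + (e + 2)"
    by (simp add: hilbert_half_def)
  with Suc show ?case by (simp add: algebra_simps)
qed

text \<open>In these degrees the three forms remove three times the number of monomials of degree
  e-d, and everything is doubled. The correction vanishes for \<open>e + 1 = d\<close>, where the
  formula meets the previous one; the induction starts there.\<close>

lemma hilbert_half_closed_high:
  assumes "d \<le> e + 1" "2 * e + 2 < 3 * d"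
  shows "2 * int (hilbert_half d e) = (int e + 1) * (int e + 2) - 3 * (int e - int d + 1) * (int e - int d + 2)"
  using assms
proof (induction e)
  case 0
  then have "d = 1" by simp
  then show ?case by (simp add: hilbert_half_def)
next
  case (Suc e)
  show ?case
  proof (cases "d = Suc (Suc e)")
    case True
    then show ?thesis using hilbert_half_closed_low[of "Suc e" d] by simp
  next
    case False
    have "hilbert_half d (Suc e) = hilbert_half d e + (3 * d - 4 - 2 * e)"
      using Suc.prems False by (simp add: hilbert_half_def)
    then have "int (hilbert_half d (Suc e)) = int (hilbert_half d e) + (3 * int d - 4 - 2 * int e)"
      using Suc.prems by simp
    then have "2 * int (hilbert_half d (Suc e)) = 2 * int (hilbert_half d e) + 2 * (3 * int d - 4 - 2 * int e)"
      by simp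
    moreover have IH: "2 * int (hilbert_half d e) = (int e + 1) * (int e + 2) - 3 * (int e - int d + 1) * (int e - int d + 2)"
      using Suc False by simp
    ultimately have "2 * int (hilbert_half d (Suc e)) = 2 * int (hilbert_half d e) + 2 * (3 * int d - 4 - 2 * int e)"
      by metis
    also have "\<dots> = (int e + 1 + 1) * (int e + 1 + 2) - 3 * (int e + 1 - int d + 1) * (int e + 1 - int d + 2)"
      unfolding IH by algebra
    finally show ?thesis by (simp add: add.commute)
  qed
qed

text \<open>Twice the number of monomials of degree \<open>t - j\<close>; the polynomial also vanishes at \<open>-1\<close> and \<open>-2\<close>.\<close>

definition twice_count :: "nat \<Rightarrow> nat \<Rightarrow> int" where
  "twice_count t j = (if j \<le> t then (int t - int j + 1) * (int t - int j + 2) else 0)"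

lemma twice_count_eq: "j \<le> t + 2 \<Longrightarrow> twice_count t j = (int t - int j + 1) * (int t - int j + 2)"
proof -
  assume "j \<le> t + 2"
  then consider "j \<le> t" | "j = t + 1" | "j = t + 2" by linarith
  then show ?thesis by cases (simp_all add: twice_count_def)
qed

text \<open>The right-hand side is twice the coefficient of z^t in (1-z^d)^3/(1-z)^3. The case
  distinction follows which of its four terms vanish and on which side of the middle degree
  \<open>t\<close> lies.\<close>

lemma twice_card_standard:
  assumes d: "1 \<le> d"
  shows "2 * int (card (standard_in_degree d t)) = twice_count t 0 - 3 * twice_count t d + 3 * twice_count t (2 * d) - twice_count t (3 * d)"
proof -
  consider (a) "3 * d \<le> t + 2" | (b) "t + 2 < 3 * d" "2 * d \<le> t + 2" | (c) "t + 2 < 2 * d" "3 * d \<le> 2 * t + 2"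
    | (e) "2 * t + 2 < 3 * d" "d \<le> t" | (f) "t < d" by linarith
  then show ?thesis
  proof cases
    case a
    then have "card (standard_in_degree d t) = 0" using d by (simp add: card_standard_hilbert)
    \<comment> \<open>All four terms are values of one quadratic polynomial here, and the third
      difference of such a polynomial is zero.\<close>
    moreover have "twice_count t 0 - 3 * twice_count t d + 3 * twice_count t (2 * d) - twice_count t (3 * d) = 0"
    proof -
      have "twice_count t 0 - 3 * twice_count t d + 3 * twice_count t (2 * d) - twice_count t (3 * d) = (x + 1) * (x + 2) - 3 * ((x - y + 1) * (x - y + 2))
          + 3 * ((x - 2 * y + 1) * (x - 2 * y + 2)) - (x - 3 * y + 1) * (x - 3 * y + 2)"
        if "x = int t" "y = int d" for x y
        using a that by (simp add: twice_count_eq)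
      moreover have "(x + 1) * (x + 2) - 3 * ((x - y + 1) * (x - y + 2))
          + 3 * ((x - 2 * y + 1) * (x - 2 * y + 2)) - (x - 3 * y + 1) * (x - 3 * y + 2) = 0" for x y :: int
        by algebra
      ultimately show ?thesis by metis
    qed
    ultimately show ?thesis by simp
  next
    case b
    \<comment> \<open>Beyond the middle degree the count at \<open>t\<close> is the count at the
      mirror degree e = 3d-3-t.\<close>
    define e where "e = 3 * d - 3 - t"
    have e: "min t (3 * d - 3 - t) = e" "e < d" "int e = 3 * int d - 3 - int t" using b by (auto simp: e_def)
    have "twice_count t (3 * d) = 0" using b by (simp add: twice_count_def)
    moreover have "2 * int (card (standard_in_degree d t)) = (int e + 1) * (int e + 2)"
      using hilbert_half_closed_low[of e d] e b d by (simp add: card_standard_hilbert)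
    ultimately show ?thesis proof -
      assume *: "twice_count t (3 * d) = 0" "2 * int (card (standard_in_degree d t)) = (int e + 1) * (int e + 2)"
      have "twice_count t 0 - 3 * twice_count t d + 3 * twice_count t (2 * d) = (int t + 1) * (int t + 2) - 3 * ((int t - int d + 1) * (int t - int d + 2))
          + 3 * ((int t - 2 * int d + 1) * (int t - 2 * int d + 2))"
        using b by (simp add: twice_count_eq)
      also have "\<dots> = (3 * int d - 3 - int t + 1) * (3 * int d - 3 - int t + 2)" by algebra
      finally show ?thesis using * e(3) by simp
    qed
  next
    case c
    define e where "e = 3 * d - 3 - t"
    have e: "min t (3 * d - 3 - t) = e" "d \<le> e + 1" "2 * e + 2 < 3 * d" "int e = 3 * int d - 3 - int t"
      using c by (auto simp: e_def)
    have "twice_count t (3 * d) = 0" "twice_count t (2 * d) = 0" using c by (simp_all add: twice_count_def)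
    moreover have "2 * int (card (standard_in_degree d t)) = (int e + 1) * (int e + 2) - 3 * (int e - int d + 1) * (int e - int d + 2)"
      using hilbert_half_closed_high[of d e] e c d by (simp add: card_standard_hilbert)
    ultimately show ?thesis proof -
      assume *: "twice_count t (3 * d) = 0" "twice_count t (2 * d) = 0"
        "2 * int (card (standard_in_degree d t)) = (int e + 1) * (int e + 2) - 3 * (int e - int d + 1) * (int e - int d + 2)"
      have "twice_count t 0 - 3 * twice_count t d = (int t + 1) * (int t + 2) - 3 * ((int t - int d + 1) * (int t - int d + 2))"
        using c by (simp add: twice_count_eq)
      also have "\<dots> = (3 * int d - 3 - int t + 1) * (3 * int d - 3 - int t + 2)
          - 3 * (3 * int d - 3 - int t - int d + 1) * (3 * int d - 3 - int t - int d + 2)" by algebra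
      finally show ?thesis using * e(4) by simp
    qed
  next
    case e
    have m: "min t (3 * d - 3 - t) = t" using e by simp
    have "twice_count t (3 * d) = 0" "twice_count t (2 * d) = 0" using e by (simp_all add: twice_count_def)
    moreover have "2 * int (card (standard_in_degree d t)) = (int t + 1) * (int t + 2) - 3 * (int t - int d + 1) * (int t - int d + 2)"
      using hilbert_half_closed_high[of d t] e d m by (simp add: card_standard_hilbert)
    ultimately show ?thesis using e by (simp add: twice_count_eq)
  next
    case f
    show ?thesis
    proof (cases "3 * d \<le> 2 * t + 2")
      case False
      then have m: "min t (3 * d - 3 - t) = t" using f by simp
      have "twice_count t (3 * d) = 0" "twice_count t (2 * d) = 0" "twice_count t d = 0" using f by (simp_all add: twice_count_def)
      moreover have "2 * int (card (standard_in_degree d t)) = (int t + 1) * (int t + 2)"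
        using hilbert_half_closed_low[of t d] f False d m by (simp add: card_standard_hilbert)
      ultimately show ?thesis by (simp add: twice_count_eq)
    next
      case True
      \<comment> \<open>This case is contradictory: t < d gives 2t+2 <= 2d < 3d.\<close>
      then have "d = t + 1 \<and> t \<le> 1" using f by linarith
      then consider "d = 1" "t = 0" | "d = 2" "t = 1" by linarith
      then show ?thesis
        by cases (simp_all add: card_standard_hilbert hilbert_half_def twice_count_def)
    qed
  qed
qed

section \<open>Graded pieces of ideals\<close>

definition supported :: "('x \<Rightarrow>\<^sub>0 nat) set \<Rightarrow> ('x, 'k::comm_ring_1) poly_ring set" where
  "supported M = {p. Poly_Mapping.keys p \<subseteq> M}"

lemma subspace_supported: "kpoly.subspace (supported M :: ('x, 'k::field) poly_ring set)"
  by (rule kpoly.subspaceI) (auto simp: supported_def in_keys_iff lookup_add subset_iff, metis add_0)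

lemma single_eq_Const_times: "Poly_Mapping.single m c = Const c * Poly_Mapping.single m 1"
  by (simp add: Const_def mult_single)

lemma span_singles: "kpoly.span ((\<lambda>m. Poly_Mapping.single m 1) ` M) = (supported M :: ('x, 'k::field) poly_ring set)"
proof
  show "kpoly.span ((\<lambda>m. Poly_Mapping.single m 1) ` M) \<subseteq> (supported M :: ('x, 'k) poly_ring set)"
    by (rule kpoly.span_minimal[OF _ subspace_supported]) (auto simp: supported_def)
  show "(supported M :: ('x, 'k) poly_ring set) \<subseteq> kpoly.span ((\<lambda>m. Poly_Mapping.single m 1) ` M)"
  proof
    fix p :: "('x, 'k) poly_ring" assume "p \<in> supported M"
    then have "(\<Sum>m\<in>Poly_Mapping.keys p. Const (Poly_Mapping.lookup p m) * Poly_Mapping.single m 1)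
        \<in> kpoly.span ((\<lambda>m. Poly_Mapping.single m 1) ` M)"
      by (intro kpoly.span_sum kpoly.span_scale kpoly.span_base) (auto simp: supported_def)
    then show "p \<in> kpoly.span ((\<lambda>m. Poly_Mapping.single m 1) ` M)"
      by (subst poly_eq_sum_single) (simp only: single_eq_Const_times[of _ "Poly_Mapping.lookup p _"])
  qed
qed

lemma dim_supported:
  assumes "finite M"
  shows "kpoly.dim (supported M :: ('x, 'k::field) poly_ring set) = card M"
proof -
  let ?s = "\<lambda>m. Poly_Mapping.single m 1 :: ('x, 'k) poly_ring"
  have inj: "inj_on ?s M" by (auto simp: inj_on_def dest: arg_cong[of _ _ Poly_Mapping.keys])
  have "kpoly.independent (?s ` M)"
  proof (rule kpoly.independent_if_scalars_zero)
    fix f x assume 0: "(\<Sum>x\<in>?s ` M. Const (f x) * x) = 0" and "x \<in> ?s ` M"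
    then obtain m where m: "m \<in> M" "x = ?s m" by blast
    have "0 = Poly_Mapping.lookup (\<Sum>x\<in>?s ` M. Const (f x) * x) m" by (simp only: 0 lookup_zero)
    also have "\<dots> = (\<Sum>n\<in>M. f (?s n) * Poly_Mapping.lookup (?s n) m)"
      by (simp add: sum.reindex[OF inj] lookup_sum)
    also have "\<dots> = (\<Sum>n\<in>M. if n = m then f (?s n) else 0)"
      by (rule sum.cong) (auto simp: lookup_single when_def)
    also have "\<dots> = f x" using assms m by simp
    finally show "f x = 0" by simp
  qed (use assms in simp)
  then have "kpoly.dim (kpoly.span (?s ` M)) = card (?s ` M)"
    by (rule kpoly.dim_span_eq_card_independent)
  then show ?thesis by (simp only: span_singles card_image[OF inj])
qed

lemma homogeneous_iff_supported: "homogeneous t f \<longleftrightarrow> f \<in> supported (degree_monomials t)"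
  by (auto simp: homogeneous_def supported_def degree_monomials_def)

definition graded_piece :: "('x, 'k::comm_ring_1) poly_ring set \<Rightarrow> nat \<Rightarrow> ('x, 'k) poly_ring set" where
  "graded_piece Q t = {p \<in> Q. homogeneous t p}"

definition graded :: "('x, 'k::comm_ring_1) poly_ring set \<Rightarrow> bool" where
  "graded Q \<longleftrightarrow> (\<forall>p\<in>Q. \<forall>t. hom_component t p \<in> Q)"

lemma gradedD: "graded Q \<Longrightarrow> p \<in> Q \<Longrightarrow> hom_component t p \<in> Q"
  by (simp add: graded_def)

lemma ideal_simps:
  "0 \<in> gen_ideal S" "p \<in> gen_ideal S \<Longrightarrow> q \<in> gen_ideal S \<Longrightarrow> p + q \<in> gen_ideal S"
  "p \<in> gen_ideal S \<Longrightarrow> q \<in> gen_ideal S \<Longrightarrow> p - q \<in> gen_ideal S"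
  "p \<in> gen_ideal S \<Longrightarrow> r * p \<in> gen_ideal S"
  by (auto intro: ring_module.span_zero ring_module.span_add ring_module.span_diff ring_module.span_scale)

lemma kpoly_subspace_gen_ideal: "kpoly.subspace (gen_ideal S :: ('x, 'k::field) poly_ring set)"
  by (rule kpoly.subspaceI) (auto intro: ideal_simps)

lemma kpoly_subspace_graded_piece:
  "kpoly.subspace Q \<Longrightarrow> kpoly.subspace (graded_piece Q t)"
proof -
  assume "kpoly.subspace Q"
  moreover have "graded_piece Q t = Q \<inter> {f. homogeneous t f}" by (auto simp: graded_piece_def)
  ultimately show ?thesis using kpoly.subspace_inter subspace_homogeneous by metis
qed

abbreviation degree_singles :: "nat \<Rightarrow> 'k::comm_ring_1 poly3 set" where
  "degree_singles t \<equiv> (\<lambda>m. Poly_Mapping.single m 1) ` degree_monomials t"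

lemma homogeneous_span: "{f. homogeneous t f} = kpoly.span (degree_singles t :: 'k::field poly3 set)"
  by (simp only: span_singles homogeneous_iff_supported) simp

lemma finite_degree_singles: "finite (degree_singles t)"
  using finite_degree_monomials by simp

lemma graded_piece_span: "graded_piece Q t \<subseteq> kpoly.span (degree_singles t :: 'k::field poly3 set)"
  unfolding homogeneous_span[symmetric] by (auto simp: graded_piece_def)

lemma dim_homogeneous: "kpoly.dim {f :: 'k::field poly3. homogeneous t f} = card (degree_monomials t)"
  using dim_supported[OF finite_degree_monomials, of t] by (simp only: homogeneous_iff_supported) simp

lemma gen_ideal_insert: "p \<in> gen_ideal (insert f S) \<longleftrightarrow> (\<exists>k. p - k * f \<in> gen_ideal S)"
  by (simp only: ring_module.span_insert mem_Collect_eq)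

lemma graded_gen_ideal_insert:
  assumes "graded (gen_ideal S)" "homogeneous d f"
  shows "graded (gen_ideal (insert f S))"
  unfolding graded_def
proof (intro ballI allI)
  fix p t assume "p \<in> gen_ideal (insert f S)"
  then obtain k where k: "p - k * f \<in> gen_ideal S" unfolding gen_ideal_insert by blast
  have "hom_component t p = hom_component t (p - k * f) + hom_component t (f * k)"
    by (simp flip: hom_component_add add: mult.commute)
  then have "hom_component t p - (if d \<le> t then hom_component (t - d) k else 0) * f = hom_component t (p - k * f)"
    by (simp add: hom_component_mult[OF assms(2)] mult.commute)
  then show "hom_component t p \<in> gen_ideal (insert f S)"
    unfolding gen_ideal_insert using gradedD[OF assms(1) k, of t] by metis
qed

global_interpretation kpoly_kpoly: vector_space_pair
    "\<lambda>c p. Const c * p :: ('x, 'k::field) poly_ring" "\<lambda>c p. Const c * p :: ('x, 'k::field) poly_ring"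
  by unfold_locales

global_interpretation kpoly_upoly: vector_space_pair
    "\<lambda>c p. Const c * p :: ('x, 'k::field) poly_ring" "smult :: 'k \<Rightarrow> 'k poly \<Rightarrow> 'k poly"
  by unfold_locales

lemma linear_mult: "Vector_Spaces.linear (\<lambda>c p. Const c * p) (\<lambda>c p. Const c * p) (\<lambda>p. f * p :: ('x, 'k::field) poly_ring)"
proof
  show "f * (p + q) = f * p + f * q" for p q by (rule distrib_left)
  show "f * (Const c * p) = Const c * (f * p)" for c p by (rule mult.left_commute)
qed

lemma dim_mult_image:
  fixes f :: "'k::field poly3"
  assumes "f \<noteq> 0" "kpoly.subspace V"
  shows "kpoly.dim ((\<lambda>p. f * p) ` V) = kpoly.dim V"
  using assms by (intro kpoly_kpoly.dim_injective_image linear_mult) (auto simp: inj_on_def)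

text \<open>With A the ideal of \<open>S\<close>, the degree t part of (A, f) is A_t + f S_(t-d),
  and by regularity the intersection of the two summands is f A_(t-d). Grassmann's formula gives the
  rest. Dimensions are integers here because they will be combined with signs.\<close>

lemma dim_graded_step:
  fixes f :: "'k::field poly3"
  assumes graded: "graded (gen_ideal S)" and f: "homogeneous d f" "f \<noteq> 0"
    and reg: "\<And>g. f * g \<in> gen_ideal S \<Longrightarrow> g \<in> gen_ideal S"
  defines "D \<equiv> \<lambda>t. int (kpoly.dim (graded_piece (gen_ideal S) t))"
  shows "int (kpoly.dim (graded_piece (gen_ideal (insert f S)) t))
     = D t + (if d \<le> t then int (card (degree_monomials (t - d))) - D (t - d) else 0)"
proof (cases "d \<le> t")
  case False
  have "graded_piece (gen_ideal (insert f S)) t = graded_piece (gen_ideal S) t"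
  proof (intro equalityI subsetI)
    fix p assume p: "p \<in> graded_piece (gen_ideal (insert f S)) t"
    then obtain k where k: "p - k * f \<in> gen_ideal S" unfolding graded_piece_def gen_ideal_insert by blast
    have "hom_component t (f * k) = 0" using False by (simp add: hom_component_mult[OF f(1)])
    moreover have "p = (p - k * f) + f * k" by (simp add: mult.commute)
    ultimately have "hom_component t p = hom_component t (p - k * f)"
      by (metis hom_component_add add.right_neutral)
    moreover have "hom_component t p = p"
      using p hom_component_homogeneous[of t p t] by (simp add: graded_piece_def)
    ultimately show "p \<in> graded_piece (gen_ideal S) t"
      using gradedD[OF graded k, of t] p by (simp add: graded_piece_def)
  next
    fix p assume p: "p \<in> graded_piece (gen_ideal S) t"
    then have "p - 0 * f \<in> gen_ideal S" by (simp add: graded_piece_def)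
    then show "p \<in> graded_piece (gen_ideal (insert f S)) t"
      using p unfolding graded_piece_def gen_ideal_insert by blast
  qed
  then show ?thesis using False by (simp add: D_def)
next
  case True
  let ?A = "graded_piece (gen_ideal S) t"
  let ?B = "(\<lambda>p. f * p) ` {g. homogeneous (t - d) g}"
  have hom_f: "homogeneous t (f * g)" if "homogeneous (t - d) g" for g
    using homogeneous_mult[OF f(1) that] True by simp
  have sum: "graded_piece (gen_ideal (insert f S)) t = {x + y | x y. x \<in> ?A \<and> y \<in> ?B}"
  proof (intro equalityI subsetI)
    fix p assume p: "p \<in> graded_piece (gen_ideal (insert f S)) t"
    then obtain k where k: "p - k * f \<in> gen_ideal S" unfolding graded_piece_def gen_ideal_insert by blast
    have "p = (p - k * f) + f * k" by (simp add: mult.commute)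
    then have "hom_component t p = hom_component t (p - k * f) + f * hom_component (t - d) k"
      using True by (metis hom_component_add hom_component_mult[OF f(1)])
    moreover have "hom_component t p = p"
      using p hom_component_homogeneous[of t p t] by (simp add: graded_piece_def)
    moreover have "hom_component t (p - k * f) \<in> ?A"
      using gradedD[OF graded k, of t] by (simp add: graded_piece_def homogeneous_hom_component)
    ultimately show "p \<in> {x + y | x y. x \<in> ?A \<and> y \<in> ?B}"
      using homogeneous_hom_component[of "t - d" k] by auto
  next
    fix p assume "p \<in> {x + y | x y. x \<in> ?A \<and> y \<in> ?B}"
    then obtain x g where p: "p = x + f * g" "x \<in> ?A" "homogeneous (t - d) g" by blast
    then have "p - g * f \<in> gen_ideal S" by (simp add: graded_piece_def mult.commute)
    moreover have "homogeneous t p"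
      using p hom_f by (auto simp: graded_piece_def intro: homogeneous_add)
    ultimately show "p \<in> graded_piece (gen_ideal (insert f S)) t"
      unfolding graded_piece_def gen_ideal_insert by blast
  qed
  have inter: "?A \<inter> ?B = (\<lambda>p. f * p) ` graded_piece (gen_ideal S) (t - d)"
    using reg hom_f by (auto simp: graded_piece_def intro: ideal_simps)
  have subA: "kpoly.subspace ?A" and subC: "kpoly.subspace (graded_piece (gen_ideal S) (t - d))"
    by (intro kpoly_subspace_graded_piece kpoly_subspace_gen_ideal)+
  have lin: "module_hom (\<lambda>c p. Const c * p) (\<lambda>c p. Const c * p) (\<lambda>p. f * p)"
    using linear_mult linear_iff_module_hom by blast
  have subB: "kpoly.subspace ?B"
    by (rule module_hom.subspace_image[OF lin subspace_homogeneous])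
  have "?B \<subseteq> kpoly.span (degree_singles t)" unfolding homogeneous_span[symmetric] using hom_f by blast
  from kpoly.dim_sum_inter[OF subA subB graded_piece_span this finite_degree_singles]
  have "kpoly.dim (graded_piece (gen_ideal (insert f S)) t) + kpoly.dim (graded_piece (gen_ideal S) (t - d))
     = kpoly.dim ?A + card (degree_monomials (t - d))"
    unfolding inter sum[symmetric] dim_mult_image[OF f(2) subC]
      dim_mult_image[OF f(2) subspace_homogeneous] dim_homogeneous .
  then show ?thesis using True by (simp add: D_def)
qed

section \<open>The Hilbert function of a complete intersection\<close>

locale complete_intersection =
  fixes f1 f2 f3 :: "'k::field_char_0 poly3" and d :: nat and I :: "'k poly3 set"
  assumes d: "2 \<le> d"
    and hom: "homogeneous d f1" "homogeneous d f2" "homogeneous d f3"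
    and regular: "regular_sequence [f1, f2, f3]"
    and I_eq: "I = gen_ideal {f1, f2, f3}"
begin

lemma one_notin_I: "1 \<notin> I"
proof
  assume "1 \<in> I"
  then have "p \<in> I" for p using ideal_simps(4)[of 1 _ p] by (simp add: I_eq)
  then show False using regular by (auto simp: regular_sequence_def I_eq)
qed

lemma graded_I: "graded I"
proof -
  have "graded (gen_ideal ({} :: 'k poly3 set))" by (simp add: graded_def)
  then show ?thesis unfolding I_eq by (intro graded_gen_ideal_insert) (use hom in auto)
qed

text \<open>Adding the three generators one at a time with \<open>dim_graded_step\<close> produces
  the alternating sum known from the Koszul complex. It complements the sum in
  \<open>twice_card_standard\<close>, so the number of standard monomials of degree t is the
  dimension of (S/I)_t.\<close>

lemma dim_graded_I:
  "kpoly.dim (graded_piece I t) + card (standard_in_degree d t) = card (degree_monomials t)"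
proof -
  define C where "C t j = (if j \<le> t then int (card (degree_monomials (t - j))) else 0)" for t j
  define D where "D S t = int (kpoly.dim (graded_piece (gen_ideal S) t))" for S :: "'k poly3 set" and t
  have C: "2 * C t j = twice_count t j" for t j
  proof -
    have "2 * int (card (degree_monomials (t - j))) = (int (t - j) + 1) * (int (t - j) + 2)"
      using arg_cong[OF card_degree_monomials[of "t - j"], of int]
      by (simp only: of_nat_mult of_nat_numeral of_nat_add of_nat_1)
    moreover have "int (t - j) = int t - int j" if "j \<le> t" using that by (rule of_nat_diff)
    ultimately show ?thesis by (auto simp: C_def twice_count_def)
  qed
  have C_shift: "C (t - d) j = C t (d + j)" if "d \<le> t" for t j
    using that by (auto simp: C_def)
  have C_0: "C t j = 0" if "t < j" for t j using that by (simp add: C_def)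
  have one: "1 \<notin> gen_ideal S" if "S \<subseteq> {f1, f2, f3}" for S
    using one_notin_I ring_module.span_mono[OF that] by (auto simp: I_eq)
  have step: "D (insert f S) t = D S t + (if d \<le> t then C t d - D S (t - d) else 0)"
    if "graded (gen_ideal S)" "homogeneous d f" "S \<subseteq> {f1, f2, f3}"
      and reg: "\<And>g. f * g \<in> gen_ideal S \<Longrightarrow> g \<in> gen_ideal S" for f S t
  proof -
    \<comment> \<open>If \<open>f\<close> were 0, regularity would put 1 into the ideal of
      \<open>S\<close>, which is proper.\<close>
    have "f \<noteq> 0"
    proof
      assume "f = 0"
      then have "f * 1 \<in> gen_ideal S" using ideal_simps(1) by simp
      then show False using reg one that by blast
    qed
    from dim_graded_step[OF that(1,2) this reg] show ?thesis
      by (simp add: D_def C_def)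
  qed
  have reg: "f1 * g \<in> gen_ideal {} \<Longrightarrow> g \<in> gen_ideal {}" "f2 * g \<in> gen_ideal {f1} \<Longrightarrow> g \<in> gen_ideal {f1}"
    "f3 * g \<in> gen_ideal {f2, f1} \<Longrightarrow> g \<in> gen_ideal {f2, f1}" for g
    using regular unfolding regular_sequence_def
    by (auto dest: spec[of _ 0] spec[of _ 1] spec[of _ 2] simp: numeral_2_eq_2 insert_commute)
  have gr0: "graded (gen_ideal ({} :: 'k poly3 set))" by (simp add: graded_def)
  have D0: "D {} t = 0" for t
  proof -
    have "graded_piece (gen_ideal ({} :: 'k poly3 set)) t \<subseteq> kpoly.span {}" by (auto simp: graded_piece_def)
    from kpoly.dim_le_card[OF this] show ?thesis by (simp add: D_def)
  qed
  have D1: "D {f1} t = C t d" for t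
    using step[OF gr0 hom(1) _ reg(1)] C_0 by (simp add: D0)
  have D2: "D {f2, f1} t = 2 * C t d - C t (2 * d)" for t
  proof -
    have st: "D {f2, f1} t = D {f1} t + (if d \<le> t then C t d - D {f1} (t - d) else 0)"
      by (rule step[OF graded_gen_ideal_insert[OF gr0 hom(1)] hom(2) _ reg(2)]) auto
    show ?thesis
    proof (cases "d \<le> t")
      case True
      then have "C (t - d) d = C t (2 * d)" using C_shift[of t d] by (simp only: mult_2)
      then show ?thesis using st True unfolding D1 by simp
    next
      case False
      then show ?thesis using st C_0[of t d] C_0[of t "2 * d"] unfolding D1 by simp
    qed
  qed
  have D3: "D {f3, f2, f1} t = 3 * C t d - 3 * C t (2 * d) + C t (3 * d)"
  proof -
    have st: "D {f3, f2, f1} t = D {f2, f1} t + (if d \<le> t then C t d - D {f2, f1} (t - d) else 0)"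
      by (rule step[OF graded_gen_ideal_insert[OF graded_gen_ideal_insert[OF gr0 hom(1)] hom(2)] hom(3) _ reg(3)]) auto
    show ?thesis
    proof (cases "d \<le> t")
      case True
      have "d + d = 2 * d" "d + 2 * d = 3 * d" by simp_all
      then have "C (t - d) d = C t (2 * d)" "C (t - d) (2 * d) = C t (3 * d)"
        using C_shift[OF True, of d] C_shift[OF True, of "2 * d"] by (simp_all only:)
      then show ?thesis using st True unfolding D2 by simp
    next
      case False
      then show ?thesis using st C_0[of t d] C_0[of t "2 * d"] C_0[of t "3 * d"] unfolding D2 by simp
    qed
  qed
  have "int (kpoly.dim (graded_piece I t)) = D {f3, f2, f1} t"
    by (simp add: D_def I_eq insert_commute)
  then have "2 * int (kpoly.dim (graded_piece I t)) = 3 * twice_count t d - 3 * twice_count t (2 * d) + twice_count t (3 * d)"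
    unfolding D3 C[symmetric] by simp
  moreover have "2 * int (card (standard_in_degree d t)) = twice_count t 0 - 3 * twice_count t d + 3 * twice_count t (2 * d) - twice_count t (3 * d)"
    using twice_card_standard d by simp
  moreover have "2 * int (card (degree_monomials t)) = twice_count t 0"
    using C[of t 0] by (simp add: C_def)
  ultimately show ?thesis by linarith
qed

section \<open>Residue classes modulo \<open>I\<close>\<close>

lemma kpoly_subspace_I: "kpoly.subspace I"
  unfolding I_eq by (rule kpoly_subspace_gen_ideal)

lemmas I_simps = ideal_simps[where S = "{f1, f2, f3}", folded I_eq]

lemma I_congD: "ideal_cong I `` {f} = ideal_cong I `` {g} \<Longrightarrow> f - g \<in> I"
  using I_simps(1) by (auto simp: ideal_cong_def set_eq_iff)

lemma I_cong_classI:
  assumes "f - g \<in> I"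
  shows "ideal_cong I `` {f} = ideal_cong I `` {g}"
proof -
  have "f - q \<in> I \<longleftrightarrow> g - q \<in> I" for q
  proof
    assume "f - q \<in> I"
    from I_simps(3)[OF this assms] show "g - q \<in> I" by simp
  next
    assume "g - q \<in> I"
    from I_simps(2)[OF assms this] show "f - q \<in> I" by simp
  qed
  then show ?thesis by (auto simp: ideal_cong_def)
qed

lemma quot_mult_class: "quot_mult I h (ideal_cong I `` {f}) = ideal_cong I `` {h * f}"
proof (intro equalityI subsetI)
  fix q assume "q \<in> quot_mult I h (ideal_cong I `` {f})"
  then obtain g where "f - g \<in> I" "h * g - q \<in> I" by (auto simp: quot_mult_def ideal_cong_def)
  then have "h * (f - g) + (h * g - q) \<in> I" using I_simps by blast
  then show "q \<in> ideal_cong I `` {h * f}" by (simp add: ideal_cong_def algebra_simps)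
next
  fix q assume "q \<in> ideal_cong I `` {h * f}"
  then show "q \<in> quot_mult I h (ideal_cong I `` {f})"
    using I_simps(1) by (auto simp: quot_mult_def ideal_cong_def intro!: exI[of _ f])
qed

lemma class_in_component: "homogeneous t f \<Longrightarrow> ideal_cong I `` {f} \<in> quot_component I t"
  by (auto simp: quot_component_def quotient_def)

end

section \<open>Consequences of the Lefschetz property\<close>

locale lefschetz_complete_intersection = complete_intersection +
  fixes l
  assumes hom_l: "homogeneous 1 l"
    and lefschetz: "1 \<le> b \<Longrightarrow> inj_on (quot_mult I (l ^ b)) (quot_component I t)
                 \<or> quot_mult I (l ^ b) ` quot_component I t = quot_component I (t + b)"
begin

text \<open>The Lefschetz property speaks of maps between sets of residue classes. Here it is moved
  to representatives, where dimensions can be counted.\<close>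

lemma lefschetz_cases:
  assumes "1 \<le> b"
  obtains (inj) "\<And>f. homogeneous t f \<Longrightarrow> l ^ b * f \<in> I \<Longrightarrow> f \<in> I"
    | (surj) "\<And>g. homogeneous (t + b) g \<Longrightarrow> \<exists>f. homogeneous t f \<and> g - l ^ b * f \<in> I"
  using lefschetz[OF assms, of t]
proof
  assume inj: "inj_on (quot_mult I (l ^ b)) (quot_component I t)"
  have "f \<in> I" if "homogeneous t f" "l ^ b * f \<in> I" for f
  proof -
    have "ideal_cong I `` {l ^ b * f} = ideal_cong I `` {l ^ b * 0}"
      using that(2) by (intro I_cong_classI) simp
    then have "quot_mult I (l ^ b) (ideal_cong I `` {f}) = quot_mult I (l ^ b) (ideal_cong I `` {0})"
      by (simp only: quot_mult_class)
    then have "ideal_cong I `` {f} = ideal_cong I `` {0}"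
      using inj that(1) class_in_component homogeneous_0 unfolding inj_on_def by blast
    then show "f \<in> I" using I_congD[of f 0] by simp
  qed
  then show thesis by (rule that(1))
next
  assume surj: "quot_mult I (l ^ b) ` quot_component I t = quot_component I (t + b)"
  have "\<exists>f. homogeneous t f \<and> g - l ^ b * f \<in> I" if g: "homogeneous (t + b) g" for g
  proof -
    obtain X where X: "X \<in> quot_component I t" "ideal_cong I `` {g} = quot_mult I (l ^ b) X"
      using surj class_in_component[OF g] by blast
    then obtain f where f: "homogeneous t f" "X = ideal_cong I `` {f}"
      by (auto simp: quot_component_def quotient_def)
    then have "ideal_cong I `` {g} = ideal_cong I `` {l ^ b * f}" using X(2) quot_mult_class by simp
    then show ?thesis using I_congD f(1) by blast
  qed
  then show thesis by (rule that(2))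
qed

text \<open>The zero polynomial counts as homogeneous of degree 1, so it has to be excluded.
  Multiplication by it from degree 0 to degree 1 is not injective, as 1 is not in \<open>I\<close>,
  and not surjective, as d >= 2 makes every monomial of degree 1 standard and hence I_1 = 0.\<close>

lemma l_nonzero: "l \<noteq> 0"
proof
  assume l: "l = 0"
  show False
  proof (rule lefschetz_cases[of 1 0])
    assume "\<And>f. homogeneous 0 f \<Longrightarrow> l ^ 1 * f \<in> I \<Longrightarrow> f \<in> I"
    then have "1 \<in> I" using homogeneous_1 I_simps(1) l by force
    then show False using one_notin_I by simp
  next
    assume *: "\<And>g. homogeneous (0 + 1) g \<Longrightarrow> \<exists>f. homogeneous 0 f \<and> g - l ^ 1 * f \<in> I"
    have xI: "Var 1 \<in> graded_piece I 1"
    proof -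
      have hv: "homogeneous 1 (Var 1 :: 'a poly3)" by (rule homogeneous_Var)
      then have "\<exists>f. homogeneous 0 f \<and> Var 1 - l ^ 1 * f \<in> I" using *[of "Var 1"] by simp
      then show ?thesis using hv l by (simp add: graded_piece_def)
    qed
    have "degree_monomials 1 \<subseteq> standard_monomials d"
    proof
      fix m assume m: "m \<in> degree_monomials 1"
      obtain a b c where "m = mon a b c" by (rule mon_cases)
      then show "m \<in> standard_monomials d" using m d by (auto simp: degree_monomials_def mdeg_mon mon_in_standard)
    qed
    then have "standard_in_degree d 1 = degree_monomials 1" by blast
    then have "kpoly.dim (graded_piece I 1) = 0" using dim_graded_I[of 1] by simp
    moreover have "0 \<in> graded_piece I 1" using I_simps(1) by (simp add: graded_piece_def)
    ultimately have "{0} = graded_piece I 1"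
      by (intro kpoly.subspace_eq_if_dim_le[OF _ _ graded_piece_span finite_degree_singles]) auto
    then have "Var 1 = (0 :: 'a poly3)" using xI by blast
    then have "Poly_Mapping.keys (Var 1 :: 'a poly3) = {}" by simp
    then show False by (simp add: Var_def)
  qed simp
qed

text \<open>In the surjective case S_(k+c) is the sum of l^c S_k and I_(k+c), and their intersection
  is l^c times the kernel \<open>?K\<close>. Since h(k) <= h(k+c), this makes the dimension of
  \<open>?K\<close> at most that of I_k, which \<open>?K\<close> contains; so the two agree.\<close>

lemma mult_l_power_injective:
  assumes k: "2 * k + c + 2 < 3 * d" and f: "homogeneous k f" "l ^ c * f \<in> I"
  shows "f \<in> I"
proof (cases "c = 0")
  case True then show ?thesis using f by simp
next
  case False
  then have "1 \<le> c" by simp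
  then show ?thesis
  proof (cases rule: lefschetz_cases[of c k])
    case inj then show ?thesis using f by blast
  next
    case surj
    let ?m = "\<lambda>p. l ^ c * p"
    let ?K = "{f. homogeneous k f \<and> ?m f \<in> I}"
    let ?A = "?m ` {f. homogeneous k f}"
    have lin: "module_hom (\<lambda>c p. Const c * p) (\<lambda>c p. Const c * p) ?m"
      using linear_mult linear_iff_module_hom by blast
    have nz: "l ^ c \<noteq> 0" using l_nonzero by simp
    have hom_m: "homogeneous (k + c) (?m f)" if "homogeneous k f" for f
      using homogeneous_mult[OF homogeneous_power[OF hom_l] that, of c] by (simp add: add.commute)
    have sum: "{x + y | x y. x \<in> ?A \<and> y \<in> graded_piece I (k + c)} = {g :: 'a poly3. homogeneous (k + c) g}"
    proof (intro equalityI subsetI)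
      fix g :: "'a poly3" assume "g \<in> {g. homogeneous (k + c) g}"
      then have g: "homogeneous (k + c) g" by simp
      then obtain f where f: "homogeneous k f" "g - ?m f \<in> I" using surj by blast
      then have "g - ?m f \<in> graded_piece I (k + c)"
        using g hom_m by (auto simp: graded_piece_def intro: homogeneous_diff)
      moreover have "g = ?m f + (g - ?m f)" by simp
      ultimately show "g \<in> {x + y | x y. x \<in> ?A \<and> y \<in> graded_piece I (k + c)}" using f(1) by blast
    qed (use hom_m in \<open>auto simp: graded_piece_def intro: homogeneous_add\<close>)
    have inter: "?A \<inter> graded_piece I (k + c) = ?m ` ?K"
      using hom_m by (auto simp: graded_piece_def)
    have subA: "kpoly.subspace ?A" by (rule module_hom.subspace_image[OF lin subspace_homogeneous])
    have subI: "kpoly.subspace (graded_piece I t)" for t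
      by (rule kpoly_subspace_graded_piece[OF kpoly_subspace_I])
    have subK: "kpoly.subspace ?K"
    proof -
      have "?K = {f. homogeneous k f} \<inter> {f. ?m f \<in> I}" by auto
      then show ?thesis
        using kpoly.subspace_inter[OF subspace_homogeneous module_hom.subspace_linear_preimage[OF lin kpoly_subspace_I]]
        by simp
    qed
    have "?A \<subseteq> kpoly.span (degree_singles (k + c))" unfolding homogeneous_span[symmetric] using hom_m by blast
    from kpoly.dim_sum_inter[OF subA subI this graded_piece_span finite_degree_singles]
    have "card (degree_monomials (k + c)) + kpoly.dim ?K = card (degree_monomials k) + kpoly.dim (graded_piece I (k + c))"
      unfolding sum inter dim_mult_image[OF nz subK] dim_mult_image[OF nz subspace_homogeneous] dim_homogeneous .
    then have "kpoly.dim ?K \<le> kpoly.dim (graded_piece I k)"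
      using dim_graded_I[of k] dim_graded_I[of "k + c"] card_standard_mono[OF _ k] d by linarith
    moreover have "graded_piece I k \<subseteq> ?K" using I_simps(4) by (auto simp: graded_piece_def)
    moreover have "?K \<subseteq> kpoly.span (degree_singles k)" unfolding homogeneous_span[symmetric] by blast
    ultimately have "graded_piece I k = ?K"
      using kpoly.subspace_eq_if_dim_le[OF subI _ _ finite_degree_singles] by blast
    then show ?thesis using f by (auto simp: graded_piece_def)
  qed
qed

end

section \<open>Coordinates in which the initial ideal is the expected one\<close>

lemma invertible_if_right_inverse:
  fixes A :: "'k::field ^ 'n ^ 'n"
  assumes "A ** B = mat 1"
  shows "invertible A"
  using assms matrix_left_right_inverse by (auto simp: invertible_def)

lemma linear_form_eq_coord_change:
  fixes l :: "'k::field poly3"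
  assumes hom: "homogeneous 1 l" and nz: "l \<noteq> 0"
  obtains \<beta> where "invertible \<beta>" "coord_change \<beta> x3 = l"
proof -
  define c where "c = (\<lambda>i::3. Poly_Mapping.lookup l (Poly_Mapping.single i 1))"
  have l: "l = (\<Sum>i\<in>UNIV. Const (c i) * Var i)"
  proof (rule poly_mapping_eqI)
    fix m
    have sum: "Poly_Mapping.lookup (\<Sum>i\<in>UNIV. Const (c i) * Var i) m
        = (\<Sum>i\<in>UNIV. c i * (1 when Poly_Mapping.single i 1 = m))"
      by (simp add: lookup_sum Var_def lookup_single)
    show "Poly_Mapping.lookup l m = Poly_Mapping.lookup (\<Sum>i\<in>UNIV. Const (c i) * Var i) m"
    proof (cases "\<exists>j::3. m = Poly_Mapping.single j 1")
      case True
      then obtain j where j: "m = Poly_Mapping.single j 1" by blast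
      have "(\<Sum>i\<in>UNIV. c i * (1 when Poly_Mapping.single i 1 = m)) = (\<Sum>i\<in>UNIV. if i = j then c i else 0)"
      proof (rule sum.cong)
        fix i :: 3
        have "Poly_Mapping.single i (1::nat) = m \<longleftrightarrow> i = j"
          using lookup_single_eq[of i "1::nat"] lookup_single_eq[of j "1::nat"]
          by (auto simp: j lookup_single dest: arg_cong[of _ _ Poly_Mapping.keys])
        then show "c i * (1 when Poly_Mapping.single i 1 = m) = (if i = j then c i else 0)" by simp
      qed simp
      then show ?thesis unfolding sum by (simp add: c_def j)
    next
      case False
      have "mdeg m \<noteq> 1"
      proof
        assume m: "mdeg m = 1"
        obtain a b e where abe: "m = mon a b e" by (rule mon_cases)
        then have "a + b + e = 1" using m by (simp add: mdeg_mon)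
        then have "m = mon 1 0 0 \<or> m = mon 0 1 0 \<or> m = mon 0 0 1" unfolding abe mon_eq_iff by linarith
        then show False using False by (auto simp: mon_def)
      qed
      then have "Poly_Mapping.lookup l m = 0" using hom by (auto simp: homogeneous_def in_keys_iff)
      moreover have "(\<Sum>i\<in>UNIV. c i * (1 when Poly_Mapping.single i 1 = m)) = 0"
        by (rule sum.neutral) (use False in auto)
      ultimately show ?thesis unfolding sum by simp
    qed
  qed
  \<comment> \<open>The third column consists of the coefficients of \<open>l\<close>. The two free
    columns become unit vectors in cyclic order, so that the determinant is exactly a nonzero
    coefficient of \<open>l\<close>.\<close>
  define M :: "(3 \<Rightarrow> 'k) \<Rightarrow> (3 \<Rightarrow> 'k) \<Rightarrow> 'k ^ 3 ^ 3"
    where "M u v = (\<chi> i j. if j = 3 then c i else if j = 1 then u i else v i)" for u v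
  have cc: "coord_change (M u v) x3 = l" for u v
    unfolding l by (simp add: coord_change_hom M_def)
  have "c 1 \<noteq> 0 \<or> c 2 \<noteq> 0 \<or> c 3 \<noteq> 0"
  proof (rule ccontr)
    assume "\<not> ?thesis"
    then have "c i = 0" for i using exhaust_3[of i] by auto
    then show False using nz l by simp
  qed
  then consider "c 1 \<noteq> 0" | "c 2 \<noteq> 0" | "c 3 \<noteq> 0" by blast
  then show thesis
  proof cases
    case 1
    have "det (M (\<lambda>i. if i = 2 then 1 else 0) (\<lambda>i. if i = 3 then 1 else 0)) = c 1"
      by (simp add: det_3 M_def)
    then show thesis using that cc 1 invertible_det_nz by metis
  next
    case 2
    have "det (M (\<lambda>i. if i = 3 then 1 else 0) (\<lambda>i. if i = 1 then 1 else 0)) = c 2"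
      by (simp add: det_3 M_def)
    then show thesis using that cc 2 invertible_det_nz by metis
  next
    case 3
    have "det (M (\<lambda>i. if i = 1 then 1 else 0) (\<lambda>i. if i = 2 then 1 else 0)) = c 3"
      by (simp add: det_3 M_def)
    then show thesis using that cc 3 invertible_det_nz by metis
  qed
qed

section \<open>Shears and the restriction to x_3 = 0\<close>

definition shear :: "'k::comm_ring_1 \<Rightarrow> 'k ^ 3 ^ 3" where
  "shear s = (\<chi> i j. if i = j then 1 else if i = 1 \<and> j = 2 then - s else 0)"

lemma invertible_shear: "invertible (shear s :: 'k::field ^ 3 ^ 3)"
  by (simp add: invertible_det_nz det_3 shear_def)

lemma Const_uminus: "Const (- c) = - Const c"
  by (simp add: Const_def single_uminus)

lemma coord_change_shear:
  "coord_change (shear s) x1 = x1" "coord_change (shear s) x2 = x2 - Const s * x1"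
  "coord_change (shear s) x3 = x3"
  by (simp_all add: coord_change_hom shear_def sum_3 Const_uminus)

text \<open>Restriction to x_3 = 0 in the chart x_1 = 1, with x_2 sent to X - s. A factor x_2^v of a
  binary form becomes (X - s)^v, the condition in \<open>finite_exceptional_points\<close>; the
  shear realizes the same shift in three variables without moving x_3.\<close>

definition dehom :: "'k::comm_ring_1 \<Rightarrow> 'k poly3 \<Rightarrow> 'k poly" where
  "dehom s = poly_eval (\<lambda>c. [:c:]) (\<lambda>i. if i = 1 then 1 else if i = 2 then [:- s, 1:] else 0)"

lemma dehom_Var: "dehom s x1 = 1" "dehom s x2 = [:- s, 1:]" "dehom s x3 = 0"
  by (simp_all add: dehom_def)

lemma dehom_shear: "dehom 0 (coord_change (shear s) p) = dehom s p"
proof -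
  have "dehom 0 (coord_change (shear s) p)
      = poly_eval (\<lambda>c. [:c:]) (\<lambda>i. dehom 0 (coord_change (shear s) (Var i))) p"
    by (rule const_upoly.poly_eval_unique)
      (simp_all add: dehom_def coord_change_hom const_upoly.poly_eval_add const_upoly.poly_eval_mult)
  also have "(\<lambda>i. dehom 0 (coord_change (shear s) (Var i))) = (\<lambda>i. if i = 1 then 1 else if i = 2 then [:- s, 1:] else 0)"
  proof
    fix i :: 3
    have 2: "dehom 0 (x2 - Const s * x1) = [:- s, 1:]"
      by (simp add: dehom_def const_upoly.poly_eval_diff const_upoly.poly_eval_mult)
    show "dehom 0 (coord_change (shear s) (Var i)) = (if i = 1 then 1 else if i = 2 then [:- s, 1:] else 0)"
      using exhaust_3[of i] by (auto simp: coord_change_shear dehom_Var 2)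
  qed
  finally show ?thesis by (simp add: dehom_def)
qed

lemma dehom_eq_pcompose: "dehom s p = pcompose (dehom 0 p) [:- s, 1:]"
proof -
  have "pcompose (dehom 0 p) [:- s, 1:] = poly_eval (\<lambda>c. [:c:]) (\<lambda>i. pcompose (dehom 0 (Var i)) [:- s, 1:]) p"
    by (rule const_upoly.poly_eval_unique)
      (simp_all add: dehom_def const_upoly.poly_eval_add const_upoly.poly_eval_mult pcompose_add pcompose_mult)
  also have "(\<lambda>i. pcompose (dehom 0 (Var i)) [:- s, 1:]) = (\<lambda>i. if i = 1 then 1 else if i = 2 then [:- s, 1:] else 0)"
    by (rule ext) (simp add: dehom_def pcompose_pCons pcompose_1)
  finally show ?thesis by (simp add: dehom_def)
qed

text \<open>The factor \<open>0 ^ n\<close> is 1 for \<open>n = 0\<close> and 0 otherwise: it keeps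
  precisely the monomials without x_3.\<close>

lemma dehom_eq_sum:
  "dehom s p = (\<Sum>m\<in>Poly_Mapping.keys p. smult (Poly_Mapping.lookup p m)
     ([:- s, 1:] ^ Poly_Mapping.lookup m 2 * 0 ^ Poly_Mapping.lookup m 3))"
  unfolding dehom_def poly_eval_def monom_val_def[symmetric]
proof (rule sum.cong[OF refl])
  fix m
  obtain a b c where m: "m = mon a b c" by (rule mon_cases)
  show "[:Poly_Mapping.lookup p m:] * monom_val (\<lambda>i. if i = 1 then 1 else if i = 2 then [:- s, 1:] else 0) m
      = smult (Poly_Mapping.lookup p m) ([:- s, 1:] ^ Poly_Mapping.lookup m 2 * 0 ^ Poly_Mapping.lookup m 3)"
    by (simp add: m monom_val_mon lookup_mon)
qed

text \<open>For a form of known degree, setting x_1 = 1 loses nothing, since the exponent of x_1 can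
  be recovered. A monomial without x_3 thus witnesses that the restriction is nonzero.\<close>

lemma coeff_dehom_0:
  assumes "homogeneous k p" "b \<le> k"
  shows "coeff (dehom 0 p) b = Poly_Mapping.lookup p (mon (k - b) b 0)"
proof -
  have "coeff (dehom 0 p) b = (\<Sum>m\<in>Poly_Mapping.keys p. if m = mon (k - b) b 0 then Poly_Mapping.lookup p m else 0)"
    unfolding dehom_eq_sum coeff_sum
  proof (rule sum.cong[OF refl])
    fix m assume mk: "m \<in> Poly_Mapping.keys p"
    obtain a b' c where m: "m = mon a b' c" by (rule mon_cases)
    have "a + b' + c = k" using assms(1) mk by (auto simp: homogeneous_def m mdeg_mon)
    then have iff: "m = mon (k - b) b 0 \<longleftrightarrow> b' = b \<and> c = 0" using assms(2) by (auto simp: m mon_eq_iff)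
    have pw: "[:- 0, 1:] ^ b' = monom (1 :: 'a) b'" by (simp add: monom_altdef)
    have lk: "Poly_Mapping.lookup m 2 = b'" "Poly_Mapping.lookup m 3 = c" unfolding m by (rule lookup_mon)+
    show "coeff (smult (Poly_Mapping.lookup p m) ([:- 0, 1:] ^ Poly_Mapping.lookup m 2 * 0 ^ Poly_Mapping.lookup m 3)) b
        = (if m = mon (k - b) b 0 then Poly_Mapping.lookup p m else 0)"
      unfolding iff lk pw by (cases "c = 0") (simp_all add: zero_power)
  qed
  also have "\<dots> = Poly_Mapping.lookup p (mon (k - b) b 0)"
    by (simp add: not_in_keys_iff_lookup_eq_zero)
  finally show ?thesis .
qed

lemma linear_dehom_coord_change:
  "Vector_Spaces.linear (\<lambda>c p. Const c * p) smult (\<lambda>p. dehom s (coord_change \<alpha> p) :: 'k::field poly)"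
proof
  show "dehom s (coord_change \<alpha> (p + q)) = dehom s (coord_change \<alpha> p) + dehom s (coord_change \<alpha> q)" for p q :: "'k poly3"
    by (simp add: dehom_def coord_change_hom const_upoly.poly_eval_add)
  show "dehom s (coord_change \<alpha> (Const c * p)) = smult c (dehom s (coord_change \<alpha> p))" for c and p :: "'k poly3"
    by (simp add: dehom_def coord_change_hom const_upoly.poly_eval_mult)
qed

lemma linear_coord_change:
  "Vector_Spaces.linear (\<lambda>c p. Const c * p) (\<lambda>c p. Const c * p) (coord_change \<alpha> :: 'k::field poly3 \<Rightarrow> _)"
  by standard (simp_all only: coord_change_hom)

lemma divide_by_x3_power:
  fixes g :: "'k::comm_ring_1 poly3"
  assumes "\<And>m. m \<in> Poly_Mapping.keys g \<Longrightarrow> c \<le> Poly_Mapping.lookup m 3"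
  obtains h where "g = x3 ^ c * h" "\<And>m. Poly_Mapping.lookup h m = Poly_Mapping.lookup g (mon 0 0 c + m)"
proof -
  let ?s = "\<lambda>m. mon 0 0 c + m"
  define h where "h = Poly_Mapping.map_key ?s g"
  have h: "Poly_Mapping.lookup h m = Poly_Mapping.lookup g (?s m)" for m
    unfolding h_def by (subst map_key.rep_eq) (simp_all add: inj_on_def)
  have x3: "x3 ^ c = (Poly_Mapping.single (mon 0 0 c) 1 :: 'k poly3)" by (simp add: single_mon)
  have "g = x3 ^ c * h"
    unfolding x3
  proof (rule poly_mapping_eqI)
    fix k
    obtain a b e where k: "k = mon a b e" by (rule mon_cases)
    show "Poly_Mapping.lookup g k = Poly_Mapping.lookup (Poly_Mapping.single (mon 0 0 c) 1 * h) k"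
    proof (cases "c \<le> e")
      case True
      then have "k = mon 0 0 c + mon a b (e - c)" by (simp add: k mon_add)
      then show ?thesis by (simp only: single_times_poly_lookup h mult_1_left)
    next
      case False
      have "Poly_Mapping.lookup (Poly_Mapping.single (mon 0 0 c) 1 * h) k = 0"
      proof (rule single_times_poly_lookup_eq_0)
        fix n show "k \<noteq> mon 0 0 c + n"
          using False by (cases rule: mon_cases[of n]) (auto simp: k mon_add mon_eq_iff)
      qed
      moreover have "k \<notin> Poly_Mapping.keys g" using assms[of k] False by (auto simp: k lookup_mon)
      ultimately show ?thesis by (simp add: in_keys_iff)
    qed
  qed
  then show thesis using that h by blast
qed

section \<open>Choice of the coordinates\<close>

context lefschetz_complete_intersection
begin

text \<open>The map kills l I_(k-1). Since S_k has k+1 more monomials than S_(k-1), dim I_k - dim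
  I_(k-1) is k+1 minus the first difference of h, which is the bound. Degree 0 is separate because
  it has no predecessor; there I_0 = 0.\<close>

lemma dehom_generators:
  assumes "coord_change \<gamma> l = x3" "2 * k + 2 < 3 * d"
  obtains C where "finite C" "card C \<le> k + 1 - min (k + 1) (3 * d - 2 - 2 * k)"
    "(\<lambda>p. dehom 0 (coord_change \<gamma> p)) ` graded_piece I k \<subseteq> upoly.span C"
proof -
  let ?f = "\<lambda>p. dehom 0 (coord_change \<gamma> p)"
  have subI: "kpoly.subspace (graded_piece I t)" for t
    by (rule kpoly_subspace_graded_piece[OF kpoly_subspace_I])
  obtain L where L: "L \<subseteq> graded_piece I k" "?f ` L \<subseteq> {0}"
    "kpoly.dim (graded_piece I k) - kpoly.dim L \<le> k + 1 - min (k + 1) (3 * d - 2 - 2 * k)"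
  proof (cases k)
    case 0
    have "degree_monomials 0 = {mon 0 0 0}"
    proof -
      have "m \<in> degree_monomials 0 \<longleftrightarrow> m = mon 0 0 0" for m
        by (cases rule: mon_cases[of m]) (auto simp: degree_monomials_def mdeg_mon mon_eq_iff)
      then show ?thesis by blast
    qed
    moreover have "standard_in_degree d 0 = degree_monomials 0"
      using d unfolding calculation by (auto simp: mon_in_standard)
    ultimately have "kpoly.dim (graded_piece I k) = 0" using dim_graded_I[of 0] 0 by simp
    then show thesis using that[of "{}"] by simp
  next
    case (Suc j)
    let ?L = "(\<lambda>p. l * p) ` graded_piece I j"
    have dimL: "kpoly.dim ?L = kpoly.dim (graded_piece I j)" by (rule dim_mult_image[OF l_nonzero subI])
    have "?L \<subseteq> graded_piece I k"
      using homogeneous_mult[OF hom_l, of j] I_simps(4) Suc by (auto simp: graded_piece_def)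
    moreover have "?f ` ?L \<subseteq> {0}"
      by (auto simp: coord_change_hom(3) assms(1) dehom_def const_upoly.poly_eval_mult)
    moreover have "2 * card (degree_monomials k) = 2 * (card (degree_monomials j) + (k + 1))"
      using card_degree_monomials[of k] card_degree_monomials[of j] Suc by (simp add: algebra_simps)
    then have "kpoly.dim (graded_piece I k) - kpoly.dim ?L \<le> k + 1 - min (k + 1) (3 * d - 2 - 2 * k)"
      using dim_graded_I[of k] dim_graded_I[of j] card_standard_Suc[of d j] d assms(2) Suc unfolding dimL by simp
    ultimately show thesis by (rule that)
  qed
  obtain C where C: "finite C" "card C \<le> kpoly.dim (graded_piece I k) - kpoly.dim L"
      "?f ` graded_piece I k \<subseteq> upoly.span C"
    by (rule kpoly_upoly.image_generators[OF linear_dehom_coord_change L(1) graded_piece_span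
          finite_degree_singles subI L(2)])
  show thesis by (rule that[OF C(1) _ C(3)]) (use C(2) L(3) in linarith)
qed

text \<open>Here \<open>\<gamma>\<close> takes \<open>l\<close> to x_3 and \<open>\<sigma>\<close>
  undoes a shear whose parameter \<open>s\<close> avoids the exceptional values. Only finitely many
  degrees k satisfy 2k+2 < 3d, each has finitely many exceptional values, and the field is
  infinite.\<close>

lemma good_coordinates:
  obtains \<alpha> :: "'a ^ 3 ^ 3" where "invertible \<alpha>"
    "\<And>t g. g \<in> coord_change \<alpha> ` I \<Longrightarrow> g \<in> supported (standard_in_degree d t) \<Longrightarrow> g = 0"
proof -
  obtain \<beta> where \<beta>: "invertible \<beta>" "coord_change \<beta> x3 = l"
    using linear_form_eq_coord_change[OF hom_l l_nonzero] by blast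
  obtain \<gamma> where \<gamma>: "\<gamma> ** \<beta> = mat 1" "\<beta> ** \<gamma> = mat 1" using \<beta>(1) by (auto simp: invertible_def)
  have \<gamma>l: "coord_change \<gamma> l = x3"
    unfolding \<beta>(2)[symmetric] coord_change_compose \<gamma>(1) coord_change_id ..
  let ?v = "\<lambda>k. k + 1 - min (k + 1) (3 * d - 2 - 2 * k)"
  have "\<exists>C. 2 * k + 2 < 3 * d \<longrightarrow> finite C \<and> card C \<le> ?v k \<and>
      (\<lambda>p. dehom 0 (coord_change \<gamma> p)) ` graded_piece I k \<subseteq> upoly.span C" for k
    using dehom_generators[OF \<gamma>l, of k] by metis
  then obtain C where C: "finite (C k)" "card (C k) \<le> ?v k"
      "(\<lambda>p. dehom 0 (coord_change \<gamma> p)) ` graded_piece I k \<subseteq> upoly.span (C k)"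
    if "2 * k + 2 < 3 * d" for k by metis
  define bad where "bad k = {s. \<exists>f\<in>upoly.span (C k). f \<noteq> 0 \<and> [:- s, 1:] ^ card (C k) dvd f}" for k
  have "finite (\<Union>k\<in>{k. 2 * k + 2 < 3 * d}. bad k)"
  proof (rule finite_UN_I)
    show "finite {k. 2 * k + 2 < 3 * d}" by (rule finite_subset[of _ "{..3 * d}"]) auto
    show "finite (bad k)" if "k \<in> {k. 2 * k + 2 < 3 * d}" for k
      unfolding bad_def using that C(1) by (intro finite_exceptional_points) auto
  qed
  then obtain s where s: "\<And>k. 2 * k + 2 < 3 * d \<Longrightarrow> s \<notin> bad k"
    using ex_new_if_finite[OF infinite_UNIV_char_0] by blast
  obtain \<sigma> where \<sigma>: "\<sigma> ** shear s = mat 1" "shear s ** \<sigma> = mat 1"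
    using invertible_shear[of s] by (auto simp: invertible_def)
  define \<alpha> where "\<alpha> = \<sigma> ** \<gamma>"
  define \<alpha>' where "\<alpha>' = \<beta> ** shear s"
  have "\<alpha>' ** \<alpha> = \<beta> ** (shear s ** \<sigma>) ** \<gamma>" by (simp add: \<alpha>'_def \<alpha>_def matrix_mul_assoc)
  then have inv: "\<alpha>' ** \<alpha> = mat 1" by (simp add: \<sigma> \<gamma>)
  have "\<alpha> ** \<alpha>' = \<sigma> ** (\<gamma> ** \<beta>) ** shear s" by (simp add: \<alpha>'_def \<alpha>_def matrix_mul_assoc)
  then have inv': "\<alpha> ** \<alpha>' = mat 1" by (simp add: \<sigma> \<gamma>)
  show thesis
  proof (rule that)
    show "invertible \<alpha>" using inv' by (rule invertible_if_right_inverse)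
    fix t g assume g: "g \<in> coord_change \<alpha> ` I" and std: "g \<in> supported (standard_in_degree d t)"
    have gI: "coord_change \<alpha>' g \<in> I"
      using g by (auto simp: coord_change_compose inv coord_change_id)
    show "g = 0"
    proof (rule ccontr)
      assume "g \<noteq> 0"
      then have ne: "Poly_Mapping.keys g \<noteq> {}" by simp
      \<comment> \<open>The exact power of x_3 dividing \<open>g\<close>. A monomial
        \<open>m0\<close> attaining the minimum ensures later that the quotient does not vanish on
        x_3 = 0.\<close>
      define c where "c = Min ((\<lambda>m. Poly_Mapping.lookup m 3) ` Poly_Mapping.keys g)"
      have c_le: "c \<le> Poly_Mapping.lookup m 3" if "m \<in> Poly_Mapping.keys g" for m
        using that by (simp add: c_def)
      have "c \<in> (\<lambda>m. Poly_Mapping.lookup m 3) ` Poly_Mapping.keys g"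
        unfolding c_def using ne by (intro Min_in) auto
      then obtain m0 where m0: "m0 \<in> Poly_Mapping.keys g" "Poly_Mapping.lookup m0 3 = c" by blast
      obtain a0 b0 where m0': "m0 = mon a0 b0 c" using mon_lookup[of m0] m0(2) by metis
      define k where "k = a0 + b0"
      have std_key: "m \<in> standard_in_degree d t" if "m \<in> Poly_Mapping.keys g" for m
        using std that by (auto simp: supported_def)
      have t: "t = k + c" and kc: "2 * k + c + 2 < 3 * d"
        using std_key[OF m0(1)] by (auto simp: m0' k_def degree_monomials_def mdeg_mon mon_in_standard)
      have k: "2 * k + 2 < 3 * d" using kc by simp
      obtain h where h: "g = x3 ^ c * h" "\<And>m. Poly_Mapping.lookup h m = Poly_Mapping.lookup g (mon 0 0 c + m)"
        using divide_by_x3_power[OF c_le] by blast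
      have key_h: "mon a b (c + e) \<in> standard_in_degree d t" if "mon a b e \<in> Poly_Mapping.keys h" for a b e
      proof -
        have "mon 0 0 c + mon a b e \<in> Poly_Mapping.keys g" using that h(2) by (simp add: in_keys_iff)
        then show ?thesis using std_key by (simp add: mon_add)
      qed
      have hom_h: "homogeneous k h"
        unfolding homogeneous_def
      proof
        fix m assume m: "m \<in> Poly_Mapping.keys h"
        obtain a b e where abe: "m = mon a b e" by (rule mon_cases)
        show "mdeg m = k" using key_h[of a b e] m by (auto simp: abe degree_monomials_def mdeg_mon t)
      qed
      \<comment> \<open>Back in the original coordinates the factor x_3^c is l^c, and it can be
        cancelled modulo \<open>I\<close> because \<open>m0\<close> is standard, which gives
        \<open>kc\<close>.\<close>
      have "coord_change \<alpha>' x3 = l"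
        by (simp only: \<alpha>'_def coord_change_compose[symmetric] coord_change_shear \<beta>(2))
      then have "coord_change \<alpha>' g = l ^ c * coord_change \<alpha>' h"
        by (simp add: h(1) coord_change_hom)
      then have "coord_change \<alpha>' h \<in> I"
        using mult_l_power_injective[OF kc homogeneous_coord_change[OF hom_h]] gI by metis
      then have hI: "coord_change \<alpha>' h \<in> graded_piece I k"
        using homogeneous_coord_change[OF hom_h] by (simp add: graded_piece_def)
      have "coord_change \<gamma> (coord_change \<alpha>' h) = coord_change (\<gamma> ** \<beta> ** shear s) h"
        by (simp add: \<alpha>'_def coord_change_compose matrix_mul_assoc)
      also have "\<dots> = coord_change (shear s) h" by (simp add: \<gamma>)
      finally have "dehom 0 (coord_change \<gamma> (coord_change \<alpha>' h)) = dehom s h" by (simp add: dehom_shear)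
      then have span: "dehom s h \<in> upoly.span (C k)" using C(3)[OF k] hI by force
      have "[:- s, 1:] ^ card (C k) dvd dehom s h"
        unfolding dehom_eq_sum
      proof (intro dvd_sum dvd_smult)
        fix m assume m: "m \<in> Poly_Mapping.keys h"
        obtain a b e where abe: "m = mon a b e" by (rule mon_cases)
        have lk: "Poly_Mapping.lookup m 2 = b" "Poly_Mapping.lookup m 3 = e" unfolding abe by (rule lookup_mon)+
        show "[:- s, 1:] ^ card (C k) dvd [:- s, 1:] ^ Poly_Mapping.lookup m 2 * 0 ^ Poly_Mapping.lookup m 3"
        proof (cases "e = 0")
          case True
          \<comment> \<open>Being standard means a + 2k + 2 < 3d, that is a < 3d-2-2k, and a <= k
            holds anyway. As b = k - a, this is precisely \<open>?v k \<le> b\<close>.\<close>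
          then have "a + b = k" "3 * a + 2 * b + 2 < 3 * d"
            using key_h[of a b e] m by (auto simp: abe degree_monomials_def mdeg_mon t mon_in_standard)
          then have "?v k \<le> b" by auto
          then have "card (C k) \<le> b" using C(2)[OF k] by simp
          then show ?thesis unfolding lk by (intro dvd_mult2 le_imp_power_dvd)
        next
          case False
          then show ?thesis unfolding lk by (simp add: zero_power)
        qed
      qed
      moreover have "dehom s h \<noteq> 0"
      proof
        assume "dehom s h = 0"
        then have "pcompose (dehom 0 h) [:- s, 1:] = 0" by (simp add: dehom_eq_pcompose[of s])
        then have "dehom 0 h = 0" by (rule pcompose_eq_0) simp
        then have "Poly_Mapping.lookup h (mon (k - b0) b0 0) = 0"
          using coeff_dehom_0[OF hom_h, of b0] by (simp add: k_def)
        moreover have "mon 0 0 c + mon (k - b0) b0 0 = m0" by (simp add: mon_add m0' k_def)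
        ultimately show False using m0(1) h(2)[of "mon (k - b0) b0 0"] by (simp add: in_keys_iff)
      qed
      ultimately show False using s[OF k] span by (auto simp: bad_def)
    qed
  qed
qed

end

section \<open>Polynomial functions of the matrix entries\<close>

abbreviation matrix_eval :: "'k::field ^ 3 ^ 3 \<Rightarrow> (3 \<times> 3, 'k) poly_ring \<Rightarrow> 'k" where
  "matrix_eval \<alpha> \<equiv> poly_eval id (\<lambda>(i, j). \<alpha> $ i $ j)"

definition polyfun :: "('k::field ^ 3 ^ 3 \<Rightarrow> 'k) \<Rightarrow> bool" where
  "polyfun F \<longleftrightarrow> (\<exists>p. \<forall>\<alpha>. F \<alpha> = matrix_eval \<alpha> p)"

lemma polyfun_const: "polyfun (\<lambda>\<alpha>. c)"
  unfolding polyfun_def by (rule exI[of _ "Const c"]) simp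

lemma polyfun_entry: "polyfun (\<lambda>\<alpha>. \<alpha> $ i $ j)"
  unfolding polyfun_def by (rule exI[of _ "Var (i, j)"]) simp

lemma polyfun_add: "polyfun F \<Longrightarrow> polyfun G \<Longrightarrow> polyfun (\<lambda>\<alpha>. F \<alpha> + G \<alpha>)"
  unfolding polyfun_def using id.poly_eval_add by metis

lemma polyfun_diff: "polyfun F \<Longrightarrow> polyfun G \<Longrightarrow> polyfun (\<lambda>\<alpha>. F \<alpha> - G \<alpha>)"
  unfolding polyfun_def using id.poly_eval_diff by metis

lemma polyfun_mult: "polyfun F \<Longrightarrow> polyfun G \<Longrightarrow> polyfun (\<lambda>\<alpha>. F \<alpha> * G \<alpha>)"
  unfolding polyfun_def using id.poly_eval_mult by metis

lemma polyfun_sum: "(\<And>x. x \<in> A \<Longrightarrow> polyfun (F x)) \<Longrightarrow> polyfun (\<lambda>\<alpha>. \<Sum>x\<in>A. F x \<alpha>)"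
  by (induction A rule: infinite_finite_induct) (auto intro: polyfun_const polyfun_add)

lemma polyfun_prod: "(\<And>x. x \<in> A \<Longrightarrow> polyfun (F x)) \<Longrightarrow> polyfun (\<lambda>\<alpha>. \<Prod>x\<in>A. F x \<alpha>)"
  by (induction A rule: infinite_finite_induct) (auto intro: polyfun_const polyfun_mult)

lemma polyfun_det: "polyfun det"
proof -
  have "polyfun (\<lambda>\<alpha> :: 'a ^ 3 ^ 3. det \<alpha>)"
    unfolding det_3 by (intro polyfun_add polyfun_diff polyfun_mult polyfun_entry)
  then show ?thesis by simp
qed

text \<open>The images of the variables are linear forms whose coefficients are matrix entries, and
  a monomial maps to a product of them. The arbitrary factor \<open>G\<close> in the auxiliary
  claims allows such linear forms to be multiplied on one at a time.\<close>

lemma polyfun_coord_change: "polyfun (\<lambda>\<alpha>. Poly_Mapping.lookup (coord_change \<alpha> f) m)"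
proof -
  define pc where "pc G \<longleftrightarrow> (\<forall>m. polyfun (\<lambda>\<alpha>. Poly_Mapping.lookup (G \<alpha>) m))" for G :: "'a ^ 3 ^ 3 \<Rightarrow> 'a poly3"
  define L where "L \<alpha> j = (\<Sum>i\<in>UNIV. Const (\<alpha> $ i $ j) * Var i :: 'a poly3)" for \<alpha> and j :: 3
  have pc_Var: "pc (\<lambda>\<alpha>. Var i * G \<alpha>)" if "pc G" for i G
    unfolding pc_def
  proof
    fix m
    show "polyfun (\<lambda>\<alpha>. Poly_Mapping.lookup (Var i * G \<alpha>) m)"
    proof (cases "\<exists>n. m = Poly_Mapping.single i 1 + n")
      case True
      then obtain n where n: "m = Poly_Mapping.single i 1 + n" by blast
      have "Poly_Mapping.lookup (Var i * G \<alpha>) m = Poly_Mapping.lookup (G \<alpha>) n" for \<alpha>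
        unfolding Var_def n single_times_poly_lookup by simp
      then show ?thesis using that by (simp add: pc_def)
    next
      case False
      then have "Poly_Mapping.lookup (Var i * G \<alpha>) m = 0" for \<alpha>
        unfolding Var_def by (intro single_times_poly_lookup_eq_0) blast
      then show ?thesis using polyfun_const by simp
    qed
  qed
  have pc_L: "pc (\<lambda>\<alpha>. L \<alpha> j * G \<alpha>)" if "pc G" for j G
  proof -
    have "Poly_Mapping.lookup (L \<alpha> j * G \<alpha>) m = (\<Sum>i\<in>UNIV. \<alpha> $ i $ j * Poly_Mapping.lookup (Var i * G \<alpha>) m)" for \<alpha> m
      by (simp only: L_def sum_distrib_right lookup_sum mult.assoc lookup_Const_times)
    then show ?thesis
      using pc_Var[OF that] unfolding pc_def by (auto intro!: polyfun_sum polyfun_mult polyfun_entry)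
  qed
  have pc_L_power: "pc (\<lambda>\<alpha>. L \<alpha> j ^ n * G \<alpha>)" if "pc G" for j n G
  proof (induction n)
    case 0 then show ?case using that by simp
  next
    case (Suc n)
    then have "pc (\<lambda>\<alpha>. L \<alpha> j * (L \<alpha> j ^ n * G \<alpha>))" by (rule pc_L)
    then show ?case by (simp only: power_Suc mult.assoc)
  qed
  have pc1: "pc (\<lambda>\<alpha>. 1)" by (simp add: pc_def polyfun_const)
  have pc_mon: "pc (\<lambda>\<alpha>. monom_val (L \<alpha>) n)" for n
  proof -
    obtain a b c where n: "n = mon a b c" by (rule mon_cases)
    have "pc (\<lambda>\<alpha>. L \<alpha> 1 ^ a * (L \<alpha> 2 ^ b * (L \<alpha> 3 ^ c * 1)))"
      by (intro pc_L_power pc1)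
    then show ?thesis by (simp only: n monom_val_mon mult.assoc mult_1_right)
  qed
  have "Poly_Mapping.lookup (coord_change \<alpha> f) m
      = (\<Sum>n\<in>Poly_Mapping.keys f. Poly_Mapping.lookup f n * Poly_Mapping.lookup (monom_val (L \<alpha>) n) m)" for \<alpha>
    unfolding coord_change_def poly_eval_def monom_val_def[symmetric] L_def[symmetric]
    by (simp only: lookup_sum lookup_Const_times)
  then show ?thesis
    using pc_mon by (auto simp: pc_def intro!: polyfun_sum polyfun_mult polyfun_const)
qed

text \<open>The set \<open>X\<close> of columns may be infinite: in the application it consists of
  all nonstandard monomials, while the rows belong to a basis of I_t.\<close>

definition independent_rows :: "'i set \<Rightarrow> 'x set \<Rightarrow> ('i \<Rightarrow> 'x \<Rightarrow> 'k::field) \<Rightarrow> bool" where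
  "independent_rows A X v \<longleftrightarrow> (\<forall>c. (\<forall>x\<in>X. (\<Sum>i\<in>A. c i * v i x) = 0) \<longrightarrow> (\<forall>i\<in>A. c i = 0))"

text \<open>One elimination step, with the pivot in row \<open>n\<close> and column
  \<open>x\<close>: the new rows vanish in column \<open>x\<close>. No division occurs, so that
  entries polynomial in \<alpha> stay polynomial.\<close>

lemma independent_rows_pivot:
  assumes A: "finite A" "n \<notin> A" and x: "x \<in> X" "v n x \<noteq> 0"
  shows "independent_rows (insert n A) X v
     \<longleftrightarrow> independent_rows A X (\<lambda>i y. v n x * v i y - v i x * v n y)" (is "?L \<longleftrightarrow> ?R")
proof
  assume L: ?L
  show ?R unfolding independent_rows_def
  proof (intro allI impI)
    fix c assume 0: "\<forall>y\<in>X. (\<Sum>i\<in>A. c i * (v n x * v i y - v i x * v n y)) = 0"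
    define c' where "c' i = (if i = n then - (\<Sum>i\<in>A. c i * v i x) else v n x * c i)" for i
    have "(\<Sum>i\<in>insert n A. c' i * v i y) = 0" if "y \<in> X" for y
    proof -
      have "(\<Sum>i\<in>insert n A. c' i * v i y) = c' n * v n y + (\<Sum>i\<in>A. c' i * v i y)"
        using A by simp
      also have "(\<Sum>i\<in>A. c' i * v i y) = (\<Sum>i\<in>A. c i * (v n x * v i y))"
        using A by (intro sum.cong) (auto simp: c'_def)
      also have "c' n * v n y + \<dots> = (\<Sum>i\<in>A. c i * (v n x * v i y - v i x * v n y))"
      proof -
        have "c' n * v n y = - ((\<Sum>i\<in>A. c i * v i x) * v n y)"
          unfolding c'_def by (simp only: if_True refl minus_mult_left)
        then have "c' n * v n y = - (\<Sum>i\<in>A. c i * (v i x * v n y))"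
          by (simp only: sum_distrib_right mult.assoc)
        then show ?thesis
          by (simp only: right_diff_distrib sum_subtractf uminus_add_conv_diff)
      qed
      finally show ?thesis using 0 that by simp
    qed
    then have "\<forall>i\<in>insert n A. c' i = 0" using L unfolding independent_rows_def by blast
    then show "\<forall>i\<in>A. c i = 0" using A x(2) by (auto simp: c'_def split: if_splits)
  qed
next
  assume R: ?R
  show ?L unfolding independent_rows_def
  proof (intro allI impI)
    fix c assume "\<forall>y\<in>X. (\<Sum>i\<in>insert n A. c i * v i y) = 0"
    then have 0: "(\<Sum>i\<in>A. c i * v i y) = - c n * v n y" if "y \<in> X" for y
      using A that by (simp add: eq_neg_iff_add_eq_0 add.commute)
    have "(\<Sum>i\<in>A. c i * (v n x * v i y - v i x * v n y)) = 0" if "y \<in> X" for y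
    proof -
      have "(\<Sum>i\<in>A. c i * (v n x * v i y - v i x * v n y))
          = v n x * (\<Sum>i\<in>A. c i * v i y) - (\<Sum>i\<in>A. c i * v i x) * v n y"
      proof -
        have "v n x * (\<Sum>i\<in>A. c i * v i y) = (\<Sum>i\<in>A. c i * (v n x * v i y))"
          unfolding sum_distrib_left by (rule sum.cong[OF refl mult.left_commute])
        moreover have "(\<Sum>i\<in>A. c i * v i x) * v n y = (\<Sum>i\<in>A. c i * (v i x * v n y))"
          unfolding sum_distrib_right by (rule sum.cong[OF refl mult.assoc])
        ultimately show ?thesis by (simp only: right_diff_distrib sum_subtractf)
      qed
      then show ?thesis using 0[OF that] 0[OF x(1)] by simp
    qed
    then have cA: "\<forall>i\<in>A. c i = 0" using R unfolding independent_rows_def by blast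
    then have "c n * v n x = 0" using 0[OF x(1)] by simp
    then show "\<forall>i\<in>insert n A. c i = 0" using cA x(2) by simp
  qed
qed

text \<open>Elimination with pivots that are nonzero at \<open>\<alpha>0\<close>; their product replaces a determinant.\<close>

lemma independent_rows_open:
  fixes v :: "'i \<Rightarrow> 'x \<Rightarrow> 'k::field ^ 3 ^ 3 \<Rightarrow> 'k"
  assumes "finite A" "\<And>i x. polyfun (v i x)" "independent_rows A X (\<lambda>i x. v i x \<alpha>0)"
  shows "\<exists>P. polyfun P \<and> P \<alpha>0 \<noteq> 0 \<and> (\<forall>\<alpha>. P \<alpha> \<noteq> 0 \<longrightarrow> independent_rows A X (\<lambda>i x. v i x \<alpha>))"
  using assms
proof (induction A arbitrary: v rule: finite_induct)
  case empty
  show ?case by (rule exI[of _ "\<lambda>_. 1"]) (simp add: polyfun_const independent_rows_def)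
next
  case (insert n A)
  have "\<exists>x\<in>X. v n x \<alpha>0 \<noteq> 0"
  proof (rule ccontr)
    assume *: "\<not> (\<exists>x\<in>X. v n x \<alpha>0 \<noteq> 0)"
    have "(\<Sum>i\<in>insert n A. of_bool (i = n) * v i x \<alpha>0) = 0" if "x \<in> X" for x
      using that * by (intro sum.neutral) auto
    then have "of_bool (n = n) = (0 :: 'k)"
      using spec[OF insert.prems(2)[unfolded independent_rows_def], of "\<lambda>i. of_bool (i = n)"] by simp
    then show False by simp
  qed
  then obtain x where x: "x \<in> X" "v n x \<alpha>0 \<noteq> 0" by blast
  define w where "w i y \<alpha> = v n x \<alpha> * v i y \<alpha> - v i x \<alpha> * v n y \<alpha>" for i y \<alpha>
  have "polyfun (w i y)" for i y
    unfolding w_def by (intro polyfun_diff polyfun_mult insert.prems(1))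
  moreover have "independent_rows A X (\<lambda>i y. w i y \<alpha>0)"
    using insert.prems(2) unfolding w_def
    by (subst (asm) independent_rows_pivot[where x = x]) (use insert.hyps x in auto)
  ultimately obtain P where P: "polyfun P" "P \<alpha>0 \<noteq> 0"
      "\<And>\<alpha>. P \<alpha> \<noteq> 0 \<Longrightarrow> independent_rows A X (\<lambda>i y. w i y \<alpha>)"
    using insert.IH[of w] by blast
  show ?case
  proof (intro exI conjI allI impI)
    show "polyfun (\<lambda>\<alpha>. P \<alpha> * v n x \<alpha>)" by (intro polyfun_mult P insert.prems)
    show "P \<alpha>0 * v n x \<alpha>0 \<noteq> 0" using P(2) x(2) by simp
    fix \<alpha> assume "P \<alpha> * v n x \<alpha> \<noteq> 0"
    then have nz: "P \<alpha> \<noteq> 0" "v n x \<alpha> \<noteq> 0" by auto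
    from P(3)[OF nz(1)] show "independent_rows (insert n A) X (\<lambda>i x. v i x \<alpha>)"
      unfolding w_def
      by (subst independent_rows_pivot[where x = x]) (use insert.hyps x nz in auto)
  qed
qed

section \<open>Generic initial ideals\<close>

text \<open>Join a point of \<open>U\<close> to a point of \<open>V\<close> by a line. A defining
  polynomial of each set and the determinant restrict to nonzero univariate polynomials, and their
  product has only finitely many zeros in the infinite field.\<close>

lemma zariski_open_GL3_inter:
  fixes U V :: "('k::field_char_0 ^ 3 ^ 3) set"
  assumes U: "zariski_open_GL3 U" "U \<noteq> {}" and V: "zariski_open_GL3 V" "V \<noteq> {}"
  shows "U \<inter> V \<noteq> {}"
proof -
  obtain F where F: "U = {\<alpha>. invertible \<alpha> \<and> (\<exists>p\<in>F. matrix_eval \<alpha> p \<noteq> 0)}"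
    using U(1) unfolding zariski_open_GL3_def by blast
  obtain G where G: "V = {\<alpha>. invertible \<alpha> \<and> (\<exists>p\<in>G. matrix_eval \<alpha> p \<noteq> 0)}"
    using V(1) unfolding zariski_open_GL3_def by blast
  obtain \<alpha> p where \<alpha>: "invertible \<alpha>" "p \<in> F" "matrix_eval \<alpha> p \<noteq> 0" using U(2) F by blast
  obtain \<beta> q where \<beta>: "q \<in> G" "matrix_eval \<beta> q \<noteq> 0" using V(2) G by blast
  define line where "line z = (\<chi> i j. \<alpha> $ i $ j + z * (\<beta> $ i $ j - \<alpha> $ i $ j))" for z
  define u where "u = poly_eval (\<lambda>c. [:c:]) (\<lambda>(i, j). [:\<alpha> $ i $ j, \<beta> $ i $ j - \<alpha> $ i $ j:])"
  have u: "poly (u r) z = matrix_eval (line z) r" for r z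
  proof -
    have "poly (u r) z = poly_eval id (\<lambda>ij. poly (u (Var ij)) z) r"
      by (rule id.poly_eval_unique) (simp_all add: u_def const_upoly.poly_eval_add const_upoly.poly_eval_mult)
    also have "(\<lambda>ij. poly (u (Var ij)) z) = (\<lambda>(i, j). line z $ i $ j)"
      by (auto simp: u_def line_def)
    finally show ?thesis .
  qed
  obtain D where D: "\<And>A :: 'k ^ 3 ^ 3. det A = matrix_eval A D"
    using polyfun_det unfolding polyfun_def by blast
  have line: "line 0 = \<alpha>" "line 1 = \<beta>" by (simp_all add: line_def vec_eq_iff)
  have "poly (u p) 0 \<noteq> 0" "poly (u q) 1 \<noteq> 0" "poly (u D) 0 \<noteq> 0"
    unfolding u line D[symmetric] using \<alpha> \<beta> invertible_det_nz by auto
  then have "u p * u q * u D \<noteq> 0" by auto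
  from ex_new_if_finite[OF infinite_UNIV_char_0 poly_roots_finite[OF this]]
  obtain z where "poly (u p * u q * u D) z \<noteq> 0" by blast
  then have "matrix_eval (line z) p \<noteq> 0" "matrix_eval (line z) q \<noteq> 0" "det (line z) \<noteq> 0"
    by (auto simp: u D)
  then have "line z \<in> U \<inter> V" using F G \<alpha> \<beta> invertible_det_nz by blast
  then show ?thesis by blast
qed

text \<open>The definite description in \<open>Gin\<close> is justified by uniqueness: two nonempty
  open sets meet, and at a common point both ideals equal the same initial ideal.\<close>

lemma Gin_eqI:
  fixes I :: "'k::field_char_0 poly3 set"
  assumes "zariski_open_GL3 U" "U \<noteq> {}" "\<And>\<alpha>. \<alpha> \<in> U \<Longrightarrow> initial_ideal (coord_change \<alpha> ` I) = J"
  shows "Gin I = J"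
  unfolding Gin_def
proof (rule the_equality)
  show "\<exists>U. zariski_open_GL3 U \<and> U \<noteq> {} \<and> (\<forall>\<alpha>\<in>U. initial_ideal (coord_change \<alpha> ` I) = J)"
    using assms by blast
  fix J' assume "\<exists>U. zariski_open_GL3 U \<and> U \<noteq> {} \<and> (\<forall>\<alpha>\<in>U. initial_ideal (coord_change \<alpha> ` I) = J')"
  then obtain V where V: "zariski_open_GL3 V" "V \<noteq> {}" "\<And>\<alpha>. \<alpha> \<in> V \<Longrightarrow> initial_ideal (coord_change \<alpha> ` I) = J'"
    by blast
  obtain \<alpha> where "\<alpha> \<in> U \<inter> V" using zariski_open_GL3_inter assms(1,2) V(1,2) by blast
  then show "J' = J" using assms(3) V(3) by blast
qed

lemma coord_change_eq_0:
  assumes "invertible \<alpha>" "coord_change \<alpha> p = 0"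
  shows "p = 0"
proof -
  obtain \<beta> where "\<beta> ** \<alpha> = mat 1" using assms(1) by (auto simp: invertible_def)
  then have "coord_change \<beta> (coord_change \<alpha> p) = p"
    by (simp only: coord_change_compose coord_change_id)
  then show ?thesis by (simp add: assms(2) coord_change_hom(6))
qed

lemma hom_component_coord_change: "hom_component t (coord_change \<alpha> p) = coord_change \<alpha> (hom_component t p)"
proof -
  define E where "E = insert t (mdeg ` Poly_Mapping.keys p)"
  have E: "finite E" "(\<Sum>e\<in>E. hom_component e p) = p" "t \<in> E"
    by (auto simp: E_def intro: sum_hom_component)
  have "hom_component t (coord_change \<alpha> p) = hom_component t (coord_change \<alpha> (\<Sum>e\<in>E. hom_component e p))"
    by (simp add: E(2))
  also have "\<dots> = (\<Sum>e\<in>E. if e = t then coord_change \<alpha> (hom_component e p) else 0)"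
    by (simp add: coord_change_hom hom_component_sum
        hom_component_homogeneous[OF homogeneous_coord_change[OF homogeneous_hom_component]])
  also have "\<dots> = coord_change \<alpha> (hom_component t p)"
    using E by simp
  finally show ?thesis .
qed

lemma revlex_less_trans: "revlex_less m n \<Longrightarrow> revlex_less n k \<Longrightarrow> revlex_less m k"
  by (auto simp: revlex_less_def)

lemma revlex_less_irrefl: "\<not> revlex_less m m"
  by (auto simp: revlex_less_def)

lemma revlex_less_add: "revlex_less m n \<Longrightarrow> revlex_less (k + m) (k + n)"
  by (auto simp: revlex_less_def mdeg_add lookup_add)

section \<open>Openness of the condition on the coordinates\<close>

context lefschetz_complete_intersection
begin

text \<open>The element \<open>p\<close> is taken before the change of coordinates, so that I_t and
  a basis of it stay fixed while \<alpha> varies.\<close>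

definition transversal :: "'a ^ 3 ^ 3 \<Rightarrow> bool" where
  "transversal \<alpha> \<longleftrightarrow> invertible \<alpha> \<and>
     (\<forall>p t. p \<in> graded_piece I t \<longrightarrow> coord_change \<alpha> p \<in> supported (standard_monomials d) \<longrightarrow> p = 0)"

text \<open>For a basis of I_t the condition says that the rows of coefficients at nonstandard
  monomials are independent, so each degree contributes one polynomial in the entries. In degrees at
  least 3d there are no standard monomials and the condition is automatic; hence the finite product
  suffices.\<close>

lemma transversal_open:
  obtains P where "polyfun P" "\<exists>\<alpha>. invertible \<alpha> \<and> P \<alpha> \<noteq> 0"
    "\<And>\<alpha>. invertible \<alpha> \<Longrightarrow> P \<alpha> \<noteq> 0 \<Longrightarrow> transversal \<alpha>"
proof -
  obtain \<alpha>0 :: "'a ^ 3 ^ 3" where \<alpha>0: "invertible \<alpha>0"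
    "\<And>t g. g \<in> coord_change \<alpha>0 ` I \<Longrightarrow> g \<in> supported (standard_in_degree d t) \<Longrightarrow> g = 0"
    using good_coordinates by blast
  have "\<exists>P. polyfun P \<and> P \<alpha>0 \<noteq> 0 \<and> (\<forall>\<alpha>. P \<alpha> \<noteq> 0 \<longrightarrow>
      (\<forall>p\<in>graded_piece I t. coord_change \<alpha> p \<in> supported (standard_monomials d) \<longrightarrow> p = 0))" for t
  proof -
    obtain B where B: "B \<subseteq> graded_piece I t" "kpoly.independent B" "graded_piece I t \<subseteq> kpoly.span B" "finite B"
      by (rule kpoly.finite_basis[OF graded_piece_span finite_degree_singles])
    define v where "v p m \<alpha> = Poly_Mapping.lookup (coord_change \<alpha> p) m" for p m and \<alpha> :: "'a ^ 3 ^ 3"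
    have comb: "(\<Sum>p\<in>B. c p * v p m \<alpha>) = Poly_Mapping.lookup (coord_change \<alpha> (\<Sum>p\<in>B. Const (c p) * p)) m" for c m \<alpha>
      by (simp add: coord_change_hom lookup_sum v_def)
    have "independent_rows B (- standard_monomials d) (\<lambda>p m. v p m \<alpha>0)"
      unfolding independent_rows_def comb
    proof (intro allI impI)
      fix c assume 0: "\<forall>m\<in>- standard_monomials d. Poly_Mapping.lookup (coord_change \<alpha>0 (\<Sum>p\<in>B. Const (c p) * p)) m = 0"
      let ?q = "\<Sum>p\<in>B. Const (c p) * p"
      have q: "?q \<in> graded_piece I t"
        using B(1) by (intro kpoly.subspace_sum kpoly.subspace_scale kpoly_subspace_graded_piece kpoly_subspace_I) auto
      then have "homogeneous t (coord_change \<alpha>0 ?q)"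
        by (auto simp: graded_piece_def intro: homogeneous_coord_change)
      then have "coord_change \<alpha>0 ?q \<in> supported (standard_in_degree d t)"
        using 0 by (fastforce simp: supported_def homogeneous_def degree_monomials_def in_keys_iff)
      then have "coord_change \<alpha>0 ?q = 0" using \<alpha>0(2) q by (auto simp: graded_piece_def)
      then have q0: "?q = 0" by (rule coord_change_eq_0[OF \<alpha>0(1)])
      show "\<forall>p\<in>B. c p = 0"
        by (rule ballI) (rule kpoly.independentD[OF B(2) B(4) subset_refl q0])
    qed
    then obtain P where P: "polyfun P" "P \<alpha>0 \<noteq> 0"
      "\<And>\<alpha>. P \<alpha> \<noteq> 0 \<Longrightarrow> independent_rows B (- standard_monomials d) (\<lambda>p m. v p m \<alpha>)"
      using independent_rows_open[OF B(4), of v] polyfun_coord_change unfolding v_def by blast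
    have "p = 0" if "P \<alpha> \<noteq> 0" "p \<in> graded_piece I t" "coord_change \<alpha> p \<in> supported (standard_monomials d)" for p \<alpha>
    proof -
      have "p \<in> kpoly.span B" using that(2) B(3) by blast
      then obtain c where p: "p = (\<Sum>b\<in>B. Const (c b) * b)" unfolding kpoly.span_finite[OF B(4)] by blast
      have "(\<Sum>b\<in>B. c b * v b m \<alpha>) = 0" if "m \<in> - standard_monomials d" for m
        unfolding comb p[symmetric] using that \<open>coord_change \<alpha> p \<in> _\<close> by (auto simp: supported_def in_keys_iff)
      then have "\<forall>b\<in>B. c b = 0" using P(3)[OF that(1)] unfolding independent_rows_def by blast
      then show "p = 0" unfolding p by simp
    qed
    then show ?thesis using P(1,2) by blast
  qed
  then obtain P where P: "\<And>t. polyfun (P t)" "\<And>t. P t \<alpha>0 \<noteq> 0"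
      "\<And>t \<alpha> p. P t \<alpha> \<noteq> 0 \<Longrightarrow> p \<in> graded_piece I t \<Longrightarrow> coord_change \<alpha> p \<in> supported (standard_monomials d) \<Longrightarrow> p = 0"
    by metis
  show thesis
  proof (rule that)
    show "polyfun (\<lambda>\<alpha>. \<Prod>t<3 * d. P t \<alpha>)" by (intro polyfun_prod P)
    show "\<exists>\<alpha>. invertible \<alpha> \<and> (\<Prod>t<3 * d. P t \<alpha>) \<noteq> 0" using \<alpha>0(1) P(2) by (intro exI[of _ \<alpha>0]) simp
    fix \<alpha> :: "'a ^ 3 ^ 3" assume \<alpha>: "invertible \<alpha>" "(\<Prod>t<3 * d. P t \<alpha>) \<noteq> 0"
    have "p = 0" if p: "p \<in> graded_piece I t" "coord_change \<alpha> p \<in> supported (standard_monomials d)" for p t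
    proof (cases "t < 3 * d")
      case True
      then have "P t \<alpha> \<noteq> 0" using \<alpha>(2) by auto
      then show ?thesis using P(3) p by blast
    next
      case False
      have "m \<notin> Poly_Mapping.keys (coord_change \<alpha> p)" for m
      proof
        assume m: "m \<in> Poly_Mapping.keys (coord_change \<alpha> p)"
        obtain a b c where abc: "m = mon a b c" by (rule mon_cases)
        have "homogeneous t (coord_change \<alpha> p)" using p(1) homogeneous_coord_change by (auto simp: graded_piece_def)
        then have "a + b + c = t" using m by (auto simp: homogeneous_def abc mdeg_mon)
        moreover have "2 * (a + b) + c + 2 < 3 * d" using p(2) m by (auto simp: supported_def abc mon_in_standard)
        ultimately show False using False by presburger
      qed
      then have "coord_change \<alpha> p = 0" using keys_eq_empty by blast
      then show ?thesis by (rule coord_change_eq_0[OF \<alpha>(1)])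
    qed
    then show "transversal \<alpha>" using \<alpha>(1) unfolding transversal_def by blast
  qed
qed

end

text \<open>The restriction to one degree makes the set finite, so that its cardinality can serve as
  induction measure for the reduction of monomials.\<close>

definition revlex_below :: "(3 \<Rightarrow>\<^sub>0 nat) \<Rightarrow> (3 \<Rightarrow>\<^sub>0 nat) set" where
  "revlex_below m = {n. mdeg n = mdeg m \<and> revlex_less n m}"

lemma finite_revlex_below: "finite (revlex_below m)"
  by (rule finite_subset[OF _ finite_degree_monomials[of "mdeg m"]])
    (auto simp: revlex_below_def degree_monomials_def)

lemma revlex_below_psubset: "n \<in> revlex_below m \<Longrightarrow> revlex_below n \<subset> revlex_below m"
proof -
  assume n: "n \<in> revlex_below m"
  then have "revlex_below n \<subseteq> revlex_below m" using revlex_less_trans by (auto simp: revlex_below_def)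
  moreover have "n \<notin> revlex_below n" using revlex_less_irrefl by (simp add: revlex_below_def)
  ultimately show ?thesis using n by blast
qed

lemma poly_eq_sum_Const_single: "p = (\<Sum>n\<in>Poly_Mapping.keys p. Const (Poly_Mapping.lookup p n) * Poly_Mapping.single n 1)"
  unfolding single_eq_Const_times[symmetric] by (rule poly_eq_sum_single)

section \<open>Initial monomials in transversal coordinates\<close>

context lefschetz_complete_intersection
begin

context
  fixes \<alpha> Q
  assumes transversal: "transversal \<alpha>" and Q: "Q = coord_change \<alpha> ` I"
begin

lemma subspace_Q: "kpoly.subspace Q"
proof -
  have "module_hom (\<lambda>c p. Const c * p) (\<lambda>c p. Const c * p) (coord_change \<alpha> :: 'a poly3 \<Rightarrow> _)"
    using linear_coord_change linear_iff_module_hom by blast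
  then show ?thesis unfolding Q by (rule module_hom.subspace_image[OF _ kpoly_subspace_I])
qed

lemma mult_in_Q: "q \<in> Q \<Longrightarrow> r * q \<in> Q"
proof -
  assume "q \<in> Q"
  then obtain p where p: "q = coord_change \<alpha> p" "p \<in> I" unfolding Q by blast
  obtain \<beta> where "\<alpha> ** \<beta> = mat 1" using transversal by (auto simp: transversal_def invertible_def)
  then have "r * q = coord_change \<alpha> (coord_change \<beta> r * p)"
    by (simp add: coord_change_hom(3) coord_change_compose coord_change_id p(1))
  then show "r * q \<in> Q" unfolding Q using I_simps(4)[OF p(2)] by blast
qed

lemma hom_component_in_Q: "q \<in> Q \<Longrightarrow> hom_component t q \<in> coord_change \<alpha> ` graded_piece I t"
  unfolding Q using gradedD[OF graded_I]
  by (auto simp: hom_component_coord_change graded_piece_def homogeneous_hom_component)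

lemma Q_piece_standard:
  "q \<in> coord_change \<alpha> ` graded_piece I t \<Longrightarrow> q \<in> supported (standard_monomials d) \<Longrightarrow> q = 0"
  using transversal coord_change_hom(6) unfolding transversal_def by blast

text \<open>By \<open>dim_graded_I\<close> the dimensions of the transformed I_t and of the span of
  the standard monomials add up to that of S_t. As they meet only in 0, their sum is all of
  S_t.\<close>

lemma normal_form:
  obtains r where "r \<in> supported (standard_in_degree d (mdeg m))" "Poly_Mapping.single m 1 - r \<in> Q"
proof -
  let ?t = "mdeg m"
  let ?A = "coord_change \<alpha> ` graded_piece I ?t"
  let ?B = "supported (standard_in_degree d ?t) :: 'a poly3 set"
  have lin: "module_hom (\<lambda>c p. Const c * p) (\<lambda>c p. Const c * p) (coord_change \<alpha> :: 'a poly3 \<Rightarrow> _)"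
    using linear_coord_change linear_iff_module_hom by blast
  have subI: "kpoly.subspace (graded_piece I ?t)"
    by (rule kpoly_subspace_graded_piece[OF kpoly_subspace_I])
  have subA: "kpoly.subspace ?A" by (rule module_hom.subspace_image[OF lin subI])
  have inv: "invertible \<alpha>" using transversal by (simp add: transversal_def)
  have "inj_on (coord_change \<alpha>) (graded_piece I ?t)"
  proof (rule inj_onI)
    fix p q :: "'a poly3" assume "coord_change \<alpha> p = coord_change \<alpha> q"
    then have "coord_change \<alpha> (p - q) = 0" by (simp add: coord_change_hom(2))
    then show "p = q" using coord_change_eq_0[OF inv] by fastforce
  qed
  then have dimA: "kpoly.dim ?A = kpoly.dim (graded_piece I ?t)"
    by (rule kpoly_kpoly.dim_injective_image[OF linear_coord_change subI])
  have dimB: "kpoly.dim ?B = card (standard_in_degree d ?t)"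
    by (rule dim_supported) (use finite_degree_monomials in blast)
  have A: "?A \<subseteq> {f. homogeneous ?t f}"
    using homogeneous_coord_change by (auto simp: graded_piece_def)
  have B: "?B \<subseteq> {f. homogeneous ?t f}"
    by (auto simp: homogeneous_iff_supported supported_def)
  have "?A \<inter> ?B \<subseteq> kpoly.span {}"
  proof
    fix q assume q: "q \<in> ?A \<inter> ?B"
    then have "q \<in> supported (standard_monomials d)" by (auto simp: supported_def)
    then show "q \<in> kpoly.span {}" using Q_piece_standard[of q "mdeg m"] q by simp
  qed
  then have dim0: "kpoly.dim (?A \<inter> ?B) = 0" using kpoly.dim_le_card[of "?A \<inter> ?B" "{}"] by simp
  let ?S = "{x + y | x y. x \<in> ?A \<and> y \<in> ?B}"
  have "?S = {f. homogeneous ?t f}"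
  proof (rule kpoly.subspace_eq_if_dim_le)
    show "kpoly.subspace ?S" by (rule kpoly.subspace_sums[OF subA subspace_supported])
    show "?S \<subseteq> {f. homogeneous ?t f}" using A B by (auto intro: homogeneous_add)
    show "{f. homogeneous ?t f} \<subseteq> kpoly.span (degree_singles ?t :: 'a poly3 set)" by (simp only: homogeneous_span)
    show "finite (degree_singles ?t :: 'a poly3 set)" by (rule finite_degree_singles)
    have "kpoly.dim ?S + kpoly.dim (?A \<inter> ?B) = kpoly.dim ?A + kpoly.dim ?B"
      by (rule kpoly.dim_sum_inter[OF subA subspace_supported _ _ finite_degree_singles])
        (use A B in \<open>simp_all only: homogeneous_span\<close>)
    then show "kpoly.dim {f :: 'a poly3. homogeneous ?t f} \<le> kpoly.dim ?S"
      using dim_graded_I[of ?t] unfolding dim0 dimA dimB dim_homogeneous by simp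
  qed
  moreover have "homogeneous ?t (Poly_Mapping.single m (1::'a))" by (rule homogeneous_single) simp
  ultimately have "Poly_Mapping.single m 1 \<in> ?S" by simp
  then obtain x y where xy: "Poly_Mapping.single m 1 = x + y" "x \<in> ?A" "y \<in> ?B" by blast
  then have "Poly_Mapping.single m 1 - y \<in> Q" unfolding Q by (auto simp: graded_piece_def)
  then show thesis using that xy(3) by blast
qed

text \<open>The tail \<open>r\<close> is only claimed to be smaller than \<open>m\<close>: in the
  second case it is a multiple by x_3^c of a standard combination and need not be standard
  itself.\<close>

lemma leading_element:
  assumes "m \<notin> standard_monomials d"
  obtains r where "r \<in> supported (revlex_below m)" "Poly_Mapping.single m 1 - r \<in> Q"
proof -
  obtain a b c where m: "m = mon a b c" by (rule mon_cases)
  show thesis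
  proof (cases "2 * (a + b) + c + 2 < 3 * d")
    case False
    have sub: "standard_in_degree d (mdeg m) \<subseteq> revlex_below m"
    proof
      fix n assume n: "n \<in> standard_in_degree d (mdeg m)"
      obtain a' b' c' where abc: "n = mon a' b' c'" by (rule mon_cases)
      have "2 * (a' + b') + c' + 2 < 3 * d" "a' + b' + c' = a + b + c"
        using n by (auto simp: abc m mdeg_mon degree_monomials_def mon_in_standard)
      \<comment> \<open>In equal degrees 2(a+b)+c is a+b plus the degree, so a smaller weight means
        a smaller a+b and hence a larger exponent of x_3.\<close>
      then have "c < c'" using False by auto
      then show "n \<in> revlex_below m"
        using \<open>a' + b' + c' = a + b + c\<close> by (simp add: revlex_below_def abc m mdeg_mon revlex_less_mon)
    qed
    obtain r where r: "r \<in> supported (standard_in_degree d (mdeg m))" "Poly_Mapping.single m 1 - r \<in> Q"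
      by (rule normal_form)
    then have "r \<in> supported (revlex_below m)" using sub by (auto simp: supported_def)
    then show thesis using that r(2) by blast
  next
    case True
    then have ab: "3 * d \<le> 3 * a + 2 * b + 2" using assms by (simp add: m mon_in_standard)
    let ?m' = "mon a b 0"
    have sub: "standard_in_degree d (mdeg ?m') \<subseteq> revlex_below ?m'"
    proof
      fix n assume n: "n \<in> standard_in_degree d (mdeg ?m')"
      obtain a' b' c' where abc: "n = mon a' b' c'" by (rule mon_cases)
      have "3 * a' + 2 * b' + 2 < 3 * d" "a' + b' + c' = a + b"
        using n by (auto simp: abc mdeg_mon degree_monomials_def mon_in_standard)
      \<comment> \<open>If c' = 0, both monomials have the same a+b, and 3a+2b is a plus twice that
        number; a smaller weight then means a smaller a and a larger b.\<close>
      then have "c' > 0 \<or> c' = 0 \<and> b' > b" using ab by auto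
      then show "n \<in> revlex_below ?m'"
        using \<open>a' + b' + c' = a + b\<close> by (auto simp: revlex_below_def abc mdeg_mon revlex_less_mon)
    qed
    obtain r where r: "r \<in> supported (standard_in_degree d (mdeg ?m'))" "Poly_Mapping.single ?m' 1 - r \<in> Q"
      by (rule normal_form)
    let ?c = "Poly_Mapping.single (mon 0 0 c) (1::'a)"
    have "?c * (Poly_Mapping.single ?m' 1 - r) = Poly_Mapping.single m 1 - ?c * r"
      by (simp add: right_diff_distrib mult_single mon_add m)
    then have "Poly_Mapping.single m 1 - ?c * r \<in> Q" using mult_in_Q[OF r(2), of ?c] by simp
    moreover have "?c * r \<in> supported (revlex_below m)"
      unfolding supported_def
    proof (intro CollectI subsetI)
      fix n assume "n \<in> Poly_Mapping.keys (?c * r)"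
      then obtain k where k: "n = mon 0 0 c + k" "k \<in> Poly_Mapping.keys r"
        using keys_mult[of ?c r] by auto
      then have "k \<in> revlex_below ?m'" using r(1) sub by (auto simp: supported_def)
      then have "mdeg n = mdeg m" "revlex_less n (mon 0 0 c + ?m')"
        using revlex_less_add by (auto simp: revlex_below_def k(1) m mdeg_add mdeg_mon)
      then show "n \<in> revlex_below m" by (simp add: revlex_below_def m mon_add)
    qed
    ultimately show thesis using that by blast
  qed
qed

text \<open>Replaces the nonstandard terms in the tail of \<open>leading_element\<close>
  recursively. Every term lies below \<open>m\<close>, so the finite sets
  \<open>revlex_below\<close> shrink and the recursion ends.\<close>

lemma reduced_element:
  assumes "m \<notin> standard_monomials d"
  shows "\<exists>r. r \<in> supported (standard_monomials d \<inter> revlex_below m) \<and> Poly_Mapping.single m 1 - r \<in> Q"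
  using assms
proof (induction "card (revlex_below m)" arbitrary: m rule: less_induct)
  case less
  let ?X = "\<lambda>n. Poly_Mapping.single n (1::'a)"
  let ?W = "supported (standard_monomials d \<inter> revlex_below m)"
  obtain s where s: "s \<in> supported (revlex_below m)" "?X m - s \<in> Q" by (rule leading_element[OF less.prems])
  have "\<exists>r. r \<in> ?W \<and> ?X n - r \<in> Q" if n: "n \<in> Poly_Mapping.keys s" for n
  proof (cases "n \<in> standard_monomials d")
    case True
    then have "?X n \<in> ?W" using s(1) n by (auto simp: supported_def)
    then show ?thesis using kpoly.subspace_0[OF subspace_Q] by (intro exI[of _ "?X n"]) simp
  next
    case False
    have below: "revlex_below n \<subset> revlex_below m"
      using s(1) n by (intro revlex_below_psubset) (auto simp: supported_def)
    obtain r where "r \<in> supported (standard_monomials d \<inter> revlex_below n)" "?X n - r \<in> Q"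
      using less.hyps[OF psubset_card_mono[OF finite_revlex_below below] False] by blast
    then show ?thesis using below by (intro exI[of _ r]) (auto simp: supported_def)
  qed
  then obtain R where R: "\<And>n. n \<in> Poly_Mapping.keys s \<Longrightarrow> R n \<in> ?W \<and> ?X n - R n \<in> Q"
    by metis
  let ?r = "\<Sum>n\<in>Poly_Mapping.keys s. Const (Poly_Mapping.lookup s n) * R n"
  have "?r \<in> ?W"
    using R by (intro kpoly.subspace_sum kpoly.subspace_scale subspace_supported) blast
  moreover have "?X m - ?r \<in> Q"
  proof -
    have "s - ?r = (\<Sum>n\<in>Poly_Mapping.keys s. Const (Poly_Mapping.lookup s n) * (?X n - R n))"
      by (subst poly_eq_sum_Const_single[of s]) (simp only: right_diff_distrib sum_subtractf)
    also have "\<dots> \<in> Q"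
      using R by (intro kpoly.subspace_sum kpoly.subspace_scale subspace_Q) blast
    finally have "(?X m - s) + (s - ?r) \<in> Q" by (rule kpoly.subspace_add[OF subspace_Q s(2)])
    then show ?thesis by simp
  qed
  ultimately show ?case by blast
qed

text \<open>If an element of \<open>Q\<close> had a standard initial monomial, reducing its
  nonstandard terms would leave an element of \<open>Q\<close> supported on standard monomials. By
  transversality this is 0, although the coefficient of the initial monomial has not
  changed.\<close>

lemma initial_monomial_iff: "(\<exists>f\<in>Q. is_initial_monomial f m) \<longleftrightarrow> m \<notin> standard_monomials d"
proof
  let ?X = "\<lambda>n. Poly_Mapping.single n (1::'a)"
  assume "m \<notin> standard_monomials d"
  then obtain r where r: "r \<in> supported (revlex_below m)" "?X m - r \<in> Q" by (rule leading_element)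
  have "m \<notin> Poly_Mapping.keys r" using r(1) revlex_less_irrefl by (auto simp: supported_def revlex_below_def)
  then have m: "m \<in> Poly_Mapping.keys (?X m - r)"
    by (simp add: in_keys_iff lookup_minus)
  have "revlex_less n m" if "n \<in> Poly_Mapping.keys (?X m - r)" "n \<noteq> m" for n
  proof -
    have "n \<in> Poly_Mapping.keys r" using that by (auto simp: in_keys_iff lookup_minus lookup_single)
    then show ?thesis using r(1) by (auto simp: supported_def revlex_below_def)
  qed
  then have "is_initial_monomial (?X m - r) m" using m by (simp add: is_initial_monomial_def)
  then show "\<exists>f\<in>Q. is_initial_monomial f m" using r(2) by blast
next
  let ?X = "\<lambda>n. Poly_Mapping.single n (1::'a)"
  assume "\<exists>f\<in>Q. is_initial_monomial f m"
  then obtain f where f: "f \<in> Q" "is_initial_monomial f m" by blast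
  show "m \<notin> standard_monomials d"
  proof
    assume std: "m \<in> standard_monomials d"
    \<comment> \<open>Transversality is a statement in each single degree; the component in the
      degree of \<open>m\<close> still has initial monomial \<open>m\<close>.\<close>
    define g where "g = hom_component (mdeg m) f"
    have g: "g \<in> coord_change \<alpha> ` graded_piece I (mdeg m)"
      unfolding g_def by (rule hom_component_in_Q[OF f(1)])
    have gQ: "g \<in> Q" using g unfolding Q by (auto simp: graded_piece_def)
    have keys_g: "n = m \<or> n \<in> revlex_below m" if "n \<in> Poly_Mapping.keys g" for n
    proof -
      have "n \<in> Poly_Mapping.keys f" "mdeg n = mdeg m"
        using that by (auto simp: g_def in_keys_iff lookup_hom_component when_def split: if_splits)
      then show ?thesis using f(2) by (auto simp: is_initial_monomial_def revlex_below_def)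
    qed
    have gm: "Poly_Mapping.lookup g m \<noteq> 0"
      using f(2) by (simp add: g_def lookup_hom_component is_initial_monomial_def in_keys_iff)
    let ?K = "Poly_Mapping.keys g - standard_monomials d"
    obtain R where R: "\<And>n. n \<notin> standard_monomials d \<Longrightarrow>
        R n \<in> supported (standard_monomials d \<inter> revlex_below n) \<and> ?X n - R n \<in> Q"
      using reduced_element by metis
    let ?c = "\<lambda>n. Const (Poly_Mapping.lookup g n)"
    \<comment> \<open>Each nonstandard \<open>n\<close> here is smaller than \<open>m\<close>, and
      its replacement \<open>R n\<close> lies below \<open>n\<close>, so the subtraction does not
      touch the coefficient at \<open>m\<close>.\<close>
    define e where "e = g - (\<Sum>n\<in>?K. ?c n * (?X n - R n))"
    have "(\<Sum>n\<in>?K. ?c n * (?X n - R n)) \<in> Q"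
      using R by (intro kpoly.subspace_sum kpoly.subspace_scale subspace_Q) blast
    then have eQ: "e \<in> Q" unfolding e_def by (rule kpoly.subspace_diff[OF subspace_Q gQ])
    have lookup_e: "Poly_Mapping.lookup e k = Poly_Mapping.lookup g k
        - (\<Sum>n\<in>?K. Poly_Mapping.lookup g n * (Poly_Mapping.lookup (?X n) k - Poly_Mapping.lookup (R n) k))" for k
      by (simp only: e_def lookup_minus lookup_sum lookup_Const_times)
    have "e \<in> supported (standard_monomials d)"
      unfolding supported_def
    proof (intro CollectI subsetI)
      fix k assume k: "k \<in> Poly_Mapping.keys e"
      show "k \<in> standard_monomials d"
      proof (rule ccontr)
        assume nstd: "k \<notin> standard_monomials d"
        have "(\<Sum>n\<in>?K. Poly_Mapping.lookup g n * (Poly_Mapping.lookup (?X n) k - Poly_Mapping.lookup (R n) k))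
            = (\<Sum>n\<in>?K. if n = k then Poly_Mapping.lookup g n else 0)"
        proof (rule sum.cong[OF refl])
          fix n assume "n \<in> ?K"
          then have "R n \<in> supported (standard_monomials d)" using R by (auto simp: supported_def)
          then have "Poly_Mapping.lookup (R n) k = 0" using nstd by (auto simp: supported_def in_keys_iff)
          then show "Poly_Mapping.lookup g n * (Poly_Mapping.lookup (?X n) k - Poly_Mapping.lookup (R n) k)
              = (if n = k then Poly_Mapping.lookup g n else 0)" by (simp add: lookup_single)
        qed
        also have "\<dots> = Poly_Mapping.lookup g k"
          using nstd by (simp add: not_in_keys_iff_lookup_eq_zero)
        finally have "Poly_Mapping.lookup e k = 0" unfolding lookup_e by simp
        then show False using k by (simp add: in_keys_iff)
      qed
    qed
    moreover have "e \<in> coord_change \<alpha> ` graded_piece I (mdeg m)"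
    proof -
      have "homogeneous (mdeg m) e"
        unfolding e_def
      proof (intro homogeneous_diff homogeneous_sum homogeneous_Const_times)
        show "homogeneous (mdeg m) g" unfolding g_def by (rule homogeneous_hom_component)
        fix n assume n: "n \<in> ?K"
        then have deg: "mdeg n = mdeg m" using keys_g by (auto simp: revlex_below_def)
        then show "homogeneous (mdeg m) (?X n)" by (rule homogeneous_single)
        show "homogeneous (mdeg m) (R n)"
          using R[of n] n deg by (auto simp: homogeneous_def supported_def revlex_below_def)
      qed
      then have "hom_component (mdeg m) e = e" by (simp add: hom_component_homogeneous)
      then show ?thesis using hom_component_in_Q[OF eQ, of "mdeg m"] by simp
    qed
    ultimately have e0: "e = 0" using Q_piece_standard by blast
    have "(\<Sum>n\<in>?K. Poly_Mapping.lookup g n * (Poly_Mapping.lookup (?X n) m - Poly_Mapping.lookup (R n) m)) = 0"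
    proof (rule sum.neutral, rule ballI)
      fix n assume n: "n \<in> ?K"
      then have "n \<noteq> m" using std by blast
      then have nm: "revlex_less n m" using n keys_g by (auto simp: revlex_below_def)
      have "m \<notin> Poly_Mapping.keys (R n)"
      proof
        assume "m \<in> Poly_Mapping.keys (R n)"
        then have "revlex_less m n" using R[of n] n by (auto simp: supported_def revlex_below_def)
        then show False using nm revlex_less_trans revlex_less_irrefl by blast
      qed
      then show "Poly_Mapping.lookup g n * (Poly_Mapping.lookup (?X n) m - Poly_Mapping.lookup (R n) m) = 0"
        using \<open>n \<noteq> m\<close> by (simp add: in_keys_iff lookup_single)
    qed
    then show False using lookup_e[of m] gm unfolding e0 by simp
  qed
qed

end

lemma Gin_eq: "Gin I = gen_ideal {Poly_Mapping.single m 1 | m. m \<notin> standard_monomials d}"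
proof -
  obtain P where P: "polyfun P" "\<exists>\<alpha>. invertible \<alpha> \<and> P \<alpha> \<noteq> 0"
    "\<And>\<alpha>. invertible \<alpha> \<Longrightarrow> P \<alpha> \<noteq> 0 \<Longrightarrow> transversal \<alpha>"
    using transversal_open by blast
  obtain p where p: "\<And>\<alpha>. P \<alpha> = matrix_eval \<alpha> p" using P(1) unfolding polyfun_def by blast
  let ?U = "{\<alpha>. invertible \<alpha> \<and> P \<alpha> \<noteq> 0}"
  show ?thesis
  proof (rule Gin_eqI)
    show "zariski_open_GL3 ?U" unfolding zariski_open_GL3_def by (rule exI[of _ "{p}"]) (simp add: p)
    show "?U \<noteq> {}" using P(2) by blast
    fix \<alpha> assume "\<alpha> \<in> ?U"
    then have "transversal \<alpha>" using P(3) by blast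
    from initial_monomial_iff[OF this refl]
    show "initial_ideal (coord_change \<alpha> ` I) = gen_ideal {Poly_Mapping.single m 1 | m. m \<notin> standard_monomials d}"
      unfolding initial_ideal_def by simp
  qed
qed

end

section \<open>The monomial generators\<close>

abbreviation xmon :: "nat \<Rightarrow> nat \<Rightarrow> nat \<Rightarrow> 'k::comm_ring_1 poly3" where
  "xmon a b c \<equiv> Poly_Mapping.single (mon a b c) 1"

lemma xmon_mult: "xmon a b c * xmon a' b' c' = xmon (a + a') (b + b') (c + c')"
  by (simp add: mult_single mon_add)

lemma xmon_prod: "x1 ^ a * x2 ^ b = xmon a b 0"
  by (simp add: single_mon)

lemma xmon_simps: "x2 ^ b = xmon 0 b 0" "x1 * xmon 0 b 0 = xmon 1 b 0" "x3 * xmon 0 b 0 = xmon 0 b 1"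
  by (simp_all add: single_mon mult.commute)

lemma xmon_products:
  "x1 ^ e * (x1 ^ a * x2 ^ b) = xmon (e + a) b 0"
  "x3 ^ c * (x1 ^ a * x2 ^ b) = xmon a b c"
  "x3 ^ c * x1 ^ a * x2 ^ b = xmon a b c"
  by (simp_all add: single_mon power_add mult.assoc mult.commute mult.left_commute)

lemma x12_monomials_x1: "x12_monomials (x1 ^ e) j = {xmon (e + a) b 0 | a b. a + b = j}"
  by (simp only: x12_monomials_def xmon_products)

lemma x12_monomials_x3: "x12_monomials (x3 ^ e) j = {xmon a b e | a b. a + b = j}"
  by (simp only: x12_monomials_def xmon_products)

lemma monomial_list_eq: "monomial_list c a b = {xmon (a - i) (b + i) c | i. i \<le> a}"
  by (simp only: monomial_list_def xmon_products)

lemma gen_ideal_standard_complement_eqI: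
  fixes G :: "'k::comm_ring_1 poly3 set"
  assumes sub: "\<And>g. g \<in> G \<Longrightarrow> \<exists>a b c. g = xmon a b c \<and> mon a b c \<notin> standard_monomials d"
    and div: "\<And>a b c. mon a b c \<notin> standard_monomials d \<Longrightarrow>
        \<exists>a' b' c'. a' \<le> a \<and> b' \<le> b \<and> c' \<le> c \<and> xmon a' b' c' \<in> G"
  shows "gen_ideal {Poly_Mapping.single m 1 | m. m \<notin> standard_monomials d} = gen_ideal G"
proof
  show "gen_ideal {Poly_Mapping.single m 1 | m. m \<notin> standard_monomials d} \<subseteq> gen_ideal G"
  proof (rule ring_module.span_minimal[OF _ ring_module.subspace_span], rule subsetI)
    fix g :: "'k poly3" assume "g \<in> {Poly_Mapping.single m 1 | m. m \<notin> standard_monomials d}"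
    then obtain m where m: "g = Poly_Mapping.single m 1" "m \<notin> standard_monomials d" by blast
    obtain a b c where abc: "m = mon a b c" by (rule mon_cases)
    obtain a' b' c' where G: "a' \<le> a" "b' \<le> b" "c' \<le> c" "xmon a' b' c' \<in> G"
      using div m(2) unfolding abc by blast
    have "xmon (a - a') (b - b') (c - c') * xmon a' b' c' = g"
      unfolding xmon_mult using G by (simp add: m(1) abc)
    then show "g \<in> gen_ideal G"
      using ideal_simps(4)[OF ring_module.span_base[OF G(4)]] by metis
  qed
  show "gen_ideal G \<subseteq> gen_ideal {Poly_Mapping.single m 1 | m. m \<notin> standard_monomials d}"
    using sub by (intro ring_module.span_mono) blast
qed

text \<open>Without x_3, the generators are given for each a <= d by the least b with 3a+2b >= 3d-2;
  the parity of a selects the form. For the others put k = a+b: the least exponent violating the x_3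
  bound is c = 3d-2-2k, with j = d-k if k < d and j = (3d-3)/2 - k if k >= d. The value j = 0 of the
  latter gives x_3 x_2^((3d-3)/2).\<close>

lemma gen_ideal_odd:
  assumes "odd d" "2 \<le> d"
  shows "gen_ideal {Poly_Mapping.single m 1 | m. m \<notin> standard_monomials d} = (gen_ideal (
            x12_monomials (x1 ^ (d - 2)) 2
          \<union> (\<Union>j\<in>{1..(d - 3) div 2}. {x1 ^ (d - 2 * j - 1) * x2 ^ (3 * j + 1),
                                      x1 ^ (d - 2 * j - 2) * x2 ^ (3 * j + 2)})
          \<union> {x2 ^ ((3 * d - 1) div 2), x3 * x2 ^ ((3 * d - 3) div 2)}
          \<union> (\<Union>j\<in>{1..(d - 3) div 2}.
               monomial_list (2 * j + 1) (2 * j) ((3 * d - 3) div 2 - 3 * j))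
          \<union> (\<Union>j\<in>{1..d}. x12_monomials (x3 ^ (d - 2 + 2 * j)) (d - j))) :: 'k::comm_ring_1 poly3 set)"
    (is "_ = gen_ideal (?G1 \<union> ?G2 \<union> ?G3 \<union> ?G4 \<union> ?G5)")
proof -
  obtain e where e: "d = 2 * e + 1" using assms(1) by (rule oddE)
  have e1: "1 \<le> e" using assms(2) e by simp
  have nums: "(d - 3) div 2 = e - 1" "(3 * d - 1) div 2 = 3 * e + 1" "(3 * d - 3) div 2 = 3 * e"
    using e1 by (simp_all add: e)
  show ?thesis
  proof (rule gen_ideal_standard_complement_eqI)
    fix g :: "'k poly3" assume "g \<in> ?G1 \<union> ?G2 \<union> ?G3 \<union> ?G4 \<union> ?G5"
    then consider "g \<in> ?G1" | "g \<in> ?G2" | "g \<in> ?G3" | "g \<in> ?G4" | "g \<in> ?G5" by blast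
    then show "\<exists>a b c. g = xmon a b c \<and> mon a b c \<notin> standard_monomials d"
    proof cases
      case 1
      then obtain a b where "g = xmon (d - 2 + a) b 0" "a + b = 2" unfolding x12_monomials_x1 by blast
      then show ?thesis using e1 by (intro exI[of _ "d - 2 + a"] exI[of _ b] exI[of _ 0]) (auto simp: mon_in_standard e)
    next
      case 2
      then obtain j where j: "1 \<le> j" "j \<le> e - 1"
        "g = xmon (d - 2 * j - 1) (3 * j + 1) 0 \<or> g = xmon (d - 2 * j - 2) (3 * j + 2) 0"
        unfolding xmon_prod nums by auto
      have "mon (d - 2 * j - 1) (3 * j + 1) 0 \<notin> standard_monomials d"
        "mon (d - 2 * j - 2) (3 * j + 2) 0 \<notin> standard_monomials d"
        using j(1,2) by (auto simp: mon_in_standard e)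
      then show ?thesis using j(3) by blast
    next
      case 3
      have "mon 0 (3 * e + 1) 0 \<notin> standard_monomials d" "mon 0 (3 * e) 1 \<notin> standard_monomials d"
        by (auto simp: mon_in_standard e)
      then show ?thesis using 3 unfolding xmon_simps nums by blast
    next
      case 4
      then obtain i j where j: "1 \<le> j" "j \<le> e - 1" "i \<le> 2 * j"
        "g = xmon (2 * j - i) (3 * e - 3 * j + i) (2 * j + 1)"
        unfolding monomial_list_eq nums by auto
      have "mon (2 * j - i) (3 * e - 3 * j + i) (2 * j + 1) \<notin> standard_monomials d"
        using j(1-3) by (auto simp: mon_in_standard e)
      then show ?thesis using j(4) by blast
    next
      case 5
      then obtain j a b where j: "1 \<le> j" "j \<le> d" "a + b = d - j" "g = xmon a b (d - 2 + 2 * j)"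
        unfolding x12_monomials_x3 by auto
      have "mon a b (d - 2 + 2 * j) \<notin> standard_monomials d"
        using j(1-3) e1 by (auto simp: mon_in_standard e)
      then show ?thesis using j(4) by blast
    qed
  next
    fix a b c assume abc: "mon a b c \<notin> standard_monomials d"
    show "\<exists>a' b' c'. a' \<le> a \<and> b' \<le> b \<and> c' \<le> c \<and> xmon a' b' c' \<in> ?G1 \<union> ?G2 \<union> ?G3 \<union> ?G4 \<union> ?G5"
    proof (cases "3 * d \<le> 3 * a + 2 * b + 2")
      case A: True
      consider (a) "2 * e - 1 \<le> a" | (b) "a = 0" | (c) "0 < a" "a < 2 * e - 1" "odd a" | (d) "0 < a" "a < 2 * e - 1" "even a"
        by linarith
      then show ?thesis
      proof cases
        case a
        \<comment> \<open>The excess of a over d-2, cut off at 2. The weight inequality then forces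
          b >= 2 - i, so one of the three monomials of \<open>?G1\<close> divides.\<close>
        define i where "i = min (a - (2 * e - 1)) 2"
        have "d - 2 + i \<le> a" "2 - i \<le> b" using a A e1 by (auto simp: i_def e)
        moreover have "xmon (d - 2 + i) (2 - i) 0 \<in> ?G1"
          unfolding x12_monomials_x1 by (rule CollectI, rule exI[of _ i], rule exI[of _ "2 - i"]) (simp add: i_def)
        ultimately show ?thesis by blast
      next
        case b
        have "3 * e + 1 \<le> b" using A b by (simp add: e)
        moreover have "xmon 0 (3 * e + 1) 0 \<in> ?G3" unfolding xmon_simps nums by simp
        ultimately show ?thesis by blast
      next
        case c
        obtain i where i: "a = 2 * i + 1" using c(3) by (rule oddE)
        define j where "j = e - 1 - i"
        have j: "j \<in> {1..e - 1}" "d - 2 * j - 2 = a" "3 * j + 2 \<le> b" using c A by (auto simp: j_def i e)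
        have "xmon a (3 * j + 2) 0 \<in> ?G2"
          unfolding xmon_prod nums by (rule UN_I[OF j(1)]) (simp only: j(2) insert_iff simp_thms)
        then show ?thesis using j(3) by blast
      next
        case d
        obtain i where i: "a = 2 * i" using d(3) by (rule evenE)
        define j where "j = e - i"
        have j: "j \<in> {1..e - 1}" "d - 2 * j - 1 = a" "3 * j + 1 \<le> b" using d A by (auto simp: j_def i e)
        have "xmon a (3 * j + 1) 0 \<in> ?G2"
          unfolding xmon_prod nums by (rule UN_I[OF j(1)]) (simp only: j(2) insert_iff simp_thms)
        then show ?thesis using j(3) by blast
      qed
    next
      case A: False
      then have B: "3 * d \<le> 2 * (a + b) + c + 2" using abc by (auto simp: mon_in_standard)
      consider (low) "a + b < d" | (top) "d \<le> a + b" "a + b = 3 * e" | (high) "d \<le> a + b" "a + b < 3 * e"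
        using A by (force simp: e)
      then show ?thesis
      proof cases
        case low
        define j where "j = d - (a + b)"
        have j: "j \<in> {1..d}" "a + b = d - j" "d - 2 + 2 * j \<le> c" using low B e1 by (auto simp: j_def e)
        have "xmon a b (d - 2 + 2 * j) \<in> ?G5"
          unfolding x12_monomials_x3 using j(2) by (intro UN_I[OF j(1)]) blast
        then show ?thesis using j(3) by blast
      next
        case top
        then have "a = 0" "b = 3 * e" "1 \<le> c" using A B by (auto simp: e)
        moreover have "xmon 0 (3 * e) 1 \<in> ?G3" unfolding xmon_simps nums by simp
        ultimately show ?thesis by blast
      next
        case high
        \<comment> \<open>This makes the least forbidden exponent of x_3 equal to 2j+1, and the
          bound on 3a+2b becomes a <= 2j, the length of the list.\<close>
        define j where "j = 3 * e - (a + b)"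
        have j: "j \<in> {1..e - 1}" "a \<le> 2 * j" "2 * j + 1 \<le> c" "3 * e - 3 * j + (2 * j - a) = b"
          using high A B by (auto simp: j_def e)
        have "xmon a b (2 * j + 1) = xmon (2 * j - (2 * j - a)) (3 * e - 3 * j + (2 * j - a)) (2 * j + 1)"
          using j(2,4) by simp
        then have "xmon a b (2 * j + 1) \<in> ?G4"
          unfolding monomial_list_eq nums by (intro UN_I[OF j(1)]) (use diff_le_self in blast)
        then show ?thesis using j(3) by blast
      qed
    qed
  qed
qed

text \<open>The same description as for odd d. Now (3d-2)/2 is an integer, so j = (3d-2)/2 - k for k
  >= d, the least forbidden exponent of x_3 is 2j, and the exponents a = 0 and a = 1 without x_3 are
  listed on their own.\<close>

lemma gen_ideal_even:
  assumes "even d" "2 \<le> d"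
  shows "gen_ideal {Poly_Mapping.single m 1 | m. m \<notin> standard_monomials d} = (gen_ideal (
            x12_monomials (x1 ^ (d - 2)) 2
          \<union> (\<Union>j\<in>{1..(d - 4) div 2}. {x1 ^ (d - 2 * j - 1) * x2 ^ (3 * j + 1),
                                      x1 ^ (d - 2 * j - 2) * x2 ^ (3 * j + 2)})
          \<union> {x1 * x2 ^ ((3 * d - 4) div 2), x2 ^ ((3 * d - 2) div 2)}
          \<union> (\<Union>j\<in>{1..(d - 2) div 2}.
               monomial_list (2 * j) (2 * j - 1) (3 * d div 2 - 3 * j))
          \<union> (\<Union>j\<in>{1..d}. x12_monomials (x3 ^ (d - 2 + 2 * j)) (d - j))) :: 'k::comm_ring_1 poly3 set)"
    (is "_ = gen_ideal (?G1 \<union> ?G2 \<union> ?G3 \<union> ?G4 \<union> ?G5)")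
proof -
  obtain e where e: "d = 2 * e" using assms(1) by (rule evenE)
  have e1: "1 \<le> e" using assms(2) e by simp
  \<comment> \<open>For \<open>d = 2\<close> the truncated differences \<open>d - 4\<close> and
    \<open>d - 2\<close> are both 0, and the families indexed by them are empty.\<close>
  have nums: "(d - 4) div 2 = e - 2" "(3 * d - 4) div 2 = 3 * e - 2" "(3 * d - 2) div 2 = 3 * e - 1"
    "(d - 2) div 2 = e - 1" "3 * d div 2 = 3 * e"
    using e1 by (auto simp: e)
  show ?thesis
  proof (rule gen_ideal_standard_complement_eqI)
    fix g :: "'k poly3" assume "g \<in> ?G1 \<union> ?G2 \<union> ?G3 \<union> ?G4 \<union> ?G5"
    then consider "g \<in> ?G1" | "g \<in> ?G2" | "g \<in> ?G3" | "g \<in> ?G4" | "g \<in> ?G5" by blast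
    then show "\<exists>a b c. g = xmon a b c \<and> mon a b c \<notin> standard_monomials d"
    proof cases
      case 1
      then obtain a b where "g = xmon (d - 2 + a) b 0" "a + b = 2" unfolding x12_monomials_x1 by blast
      then show ?thesis using e1 by (intro exI[of _ "d - 2 + a"] exI[of _ b] exI[of _ 0]) (auto simp: mon_in_standard e)
    next
      case 2
      then obtain j where j: "1 \<le> j" "j \<le> e - 2"
        "g = xmon (d - 2 * j - 1) (3 * j + 1) 0 \<or> g = xmon (d - 2 * j - 2) (3 * j + 2) 0"
        unfolding xmon_prod nums by auto
      have "mon (d - 2 * j - 1) (3 * j + 1) 0 \<notin> standard_monomials d"
        "mon (d - 2 * j - 2) (3 * j + 2) 0 \<notin> standard_monomials d"
        using j(1,2) by (auto simp: mon_in_standard e)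
      then show ?thesis using j(3) by blast
    next
      case 3
      have "mon 1 (3 * e - 2) 0 \<notin> standard_monomials d" "mon 0 (3 * e - 1) 0 \<notin> standard_monomials d"
        using e1 by (auto simp: mon_in_standard e)
      then show ?thesis using 3 unfolding xmon_simps nums by blast
    next
      case 4
      then obtain i j where j: "1 \<le> j" "j \<le> e - 1" "i \<le> 2 * j - 1"
        "g = xmon (2 * j - 1 - i) (3 * e - 3 * j + i) (2 * j)"
        unfolding monomial_list_eq nums by auto
      have "mon (2 * j - 1 - i) (3 * e - 3 * j + i) (2 * j) \<notin> standard_monomials d"
        using j(1-3) by (auto simp: mon_in_standard e)
      then show ?thesis using j(4) by blast
    next
      case 5
      then obtain j a b where j: "1 \<le> j" "j \<le> d" "a + b = d - j" "g = xmon a b (d - 2 + 2 * j)"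
        unfolding x12_monomials_x3 by auto
      have "mon a b (d - 2 + 2 * j) \<notin> standard_monomials d"
        using j(1-3) e1 by (auto simp: mon_in_standard e)
      then show ?thesis using j(4) by blast
    qed
  next
    fix a b c assume abc: "mon a b c \<notin> standard_monomials d"
    show "\<exists>a' b' c'. a' \<le> a \<and> b' \<le> b \<and> c' \<le> c \<and> xmon a' b' c' \<in> ?G1 \<union> ?G2 \<union> ?G3 \<union> ?G4 \<union> ?G5"
    proof (cases "3 * d \<le> 3 * a + 2 * b + 2")
      case A: True
      consider (a) "2 * e - 2 \<le> a" | (b) "a = 0" | (b1) "a = 1" | (c) "1 < a" "a < 2 * e - 2" "even a" | (d) "1 < a" "a < 2 * e - 2" "odd a"
        by linarith
      then show ?thesis
      proof cases
        case a
        define i where "i = min (a - (2 * e - 2)) 2"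
        have "d - 2 + i \<le> a" "2 - i \<le> b" using a A e1 by (auto simp: i_def e)
        moreover have "xmon (d - 2 + i) (2 - i) 0 \<in> ?G1"
          unfolding x12_monomials_x1 by (rule CollectI, rule exI[of _ i], rule exI[of _ "2 - i"]) (simp add: i_def)
        ultimately show ?thesis by blast
      next
        case b
        have "3 * e - 1 \<le> b" using A b by (simp add: e)
        moreover have "xmon 0 (3 * e - 1) 0 \<in> ?G3" unfolding xmon_simps nums by simp
        ultimately show ?thesis by blast
      next
        case b1
        have "3 * e - 2 \<le> b" "1 \<le> a" using A b1 by (simp_all add: e)
        moreover have "xmon 1 (3 * e - 2) 0 \<in> ?G3" unfolding xmon_simps nums by simp
        ultimately show ?thesis by blast
      next
        case c
        obtain i where i: "a = 2 * i" using c(3) by (rule evenE)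
        define j where "j = e - 1 - i"
        have j: "j \<in> {1..e - 2}" "d - 2 * j - 2 = a" "3 * j + 2 \<le> b" using c A by (auto simp: j_def i e)
        have "xmon a (3 * j + 2) 0 \<in> ?G2"
          unfolding xmon_prod nums by (rule UN_I[OF j(1)]) (simp only: j(2) insert_iff simp_thms)
        then show ?thesis using j(3) by blast
      next
        case d
        obtain i where i: "a = 2 * i + 1" using d(3) by (rule oddE)
        define j where "j = e - 1 - i"
        have j: "j \<in> {1..e - 2}" "d - 2 * j - 1 = a" "3 * j + 1 \<le> b" using d A by (auto simp: j_def i e)
        have "xmon a (3 * j + 1) 0 \<in> ?G2"
          unfolding xmon_prod nums by (rule UN_I[OF j(1)]) (simp only: j(2) insert_iff simp_thms)
        then show ?thesis using j(3) by blast
      qed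
    next
      case A: False
      then have B: "3 * d \<le> 2 * (a + b) + c + 2" using abc by (auto simp: mon_in_standard)
      consider (low) "a + b < d" | (high) "d \<le> a + b" by linarith
      then show ?thesis
      proof cases
        case low
        define j where "j = d - (a + b)"
        have j: "j \<in> {1..d}" "a + b = d - j" "d - 2 + 2 * j \<le> c" using low B e1 by (auto simp: j_def e)
        have "xmon a b (d - 2 + 2 * j) \<in> ?G5"
          unfolding x12_monomials_x3 using j(2) by (intro UN_I[OF j(1)]) blast
        then show ?thesis using j(3) by blast
      next
        case high
        have k: "a + b + 2 \<le> 3 * e" using A by (auto simp: e)
        \<comment> \<open>Here 3d-2-2k equals 2j, and the bound on 3a+2b becomes a <= 2j-1.\<close>
        define j where "j = 3 * e - 1 - (a + b)"
        have j: "j \<in> {1..e - 1}" "a \<le> 2 * j - 1" "2 * j \<le> c" "3 * e - 3 * j + (2 * j - 1 - a) = b"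
          using high k A B by (auto simp: j_def e)
        have "xmon a b (2 * j) = xmon (2 * j - 1 - (2 * j - 1 - a)) (3 * e - 3 * j + (2 * j - 1 - a)) (2 * j)"
          by (simp only: diff_diff_cancel[OF j(2)] j(4))
        then have "xmon a b (2 * j) \<in> ?G4"
          unfolding monomial_list_eq nums by (intro UN_I[OF j(1)]) (use diff_le_self in blast)
        then show ?thesis using j(3) by blast
      qed
    qed
  qed
qed

theorem proposition2p3p3:
  fixes f1 f2 f3 :: "'k::field_char_0 poly3"
    and I J :: "'k poly3 set"
    and d :: nat
  assumes "2 \<le> d"
    and "homogeneous d f1" "homogeneous d f2" "homogeneous d f3"
    and "regular_sequence [f1, f2, f3]"
    and "I = gen_ideal {f1, f2, f3}"
    and "J = Gin I"
    and "strong_lefschetz I"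
  shows "(odd d \<longrightarrow> J = gen_ideal (
            x12_monomials (x1 ^ (d - 2)) 2
          \<union> (\<Union>j\<in>{1..(d - 3) div 2}. {x1 ^ (d - 2 * j - 1) * x2 ^ (3 * j + 1),
                                      x1 ^ (d - 2 * j - 2) * x2 ^ (3 * j + 2)})
          \<union> {x2 ^ ((3 * d - 1) div 2), x3 * x2 ^ ((3 * d - 3) div 2)}
          \<union> (\<Union>j\<in>{1..(d - 3) div 2}.
               monomial_list (2 * j + 1) (2 * j) ((3 * d - 3) div 2 - 3 * j))
          \<union> (\<Union>j\<in>{1..d}. x12_monomials (x3 ^ (d - 2 + 2 * j)) (d - j))))
       \<and> (even d \<longrightarrow> J = gen_ideal (
            x12_monomials (x1 ^ (d - 2)) 2
          \<union> (\<Union>j\<in>{1..(d - 4) div 2}. {x1 ^ (d - 2 * j - 1) * x2 ^ (3 * j + 1),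
                                      x1 ^ (d - 2 * j - 2) * x2 ^ (3 * j + 2)})
          \<union> {x1 * x2 ^ ((3 * d - 4) div 2), x2 ^ ((3 * d - 2) div 2)}
          \<union> (\<Union>j\<in>{1..(d - 2) div 2}.
               monomial_list (2 * j) (2 * j - 1) (3 * d div 2 - 3 * j))
          \<union> (\<Union>j\<in>{1..d}. x12_monomials (x3 ^ (d - 2 + 2 * j)) (d - j))))"
proof -
  interpret complete_intersection f1 f2 f3 d I
    by standard (use assms in auto)
  obtain l where l: "homogeneous 1 l \<and>
      (\<forall>b\<ge>1. \<forall>t. inj_on (quot_mult I (l ^ b)) (quot_component I t)
                 \<or> quot_mult I (l ^ b) ` quot_component I t = quot_component I (t + b))"
    using assms(8) unfolding strong_lefschetz_def by (rule exE)
  interpret lefschetz_complete_intersection f1 f2 f3 d I l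
    by standard (fact conjunct1[OF l], fact conjunct2[OF l, rule_format])
  have J: "J = gen_ideal {Poly_Mapping.single m 1 | m. m \<notin> standard_monomials d}"
    unfolding assms(7) by (rule Gin_eq)
  show ?thesis
    unfolding J by (intro conjI impI gen_ideal_odd gen_ideal_even assms(1)) assumption+
qed

end
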